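(* The natural quotient map $Q: Z(\mathcal T^2)\to\ell_2$, $Q(x,y)=y$, is strictly singular.
   Context: An operator between Banach spaces is strictly singular if no restriction to an infinite-dimensional closed subspace is an isomorphism onto its image. $\omega$ is the space of all complex sequences with pointwise convergence; $c_{00}$ is the space of finitely supported sequences. Tsirelson's space. For $x\in c_{00}$ let $\|x\|_0=\max_j|x_j|$ and $\|x\|_{n+1}=\max\{\|x\|_n,\frac12\max\sum_{j=1}^k\|A_jx\|_n\}$, where the inner maximum is over all $k$ and finite subsets $k\le A_1<\dots<A_k$ of $\mathbb N$ ($A_j<A_{j+1}$ means $\max A_j<\min A_{j+1}$; $A_jx$ is the restriction of $x$ to $A_j$). $\mathcal T$ is the completion of $c_{00}$ under $\|x\|=\lim_n\|x\|_n$. $\mathcal T^2$ (2-convexification) is the completion of $c_{00}$ under $\|x\|_{\mathcal T^2}=\|\,|x|^2\,\|_{\mathcal T}^{1/2}$. The space $Z(X)$. Let $X$ be a space with an unconditional basis $(e_j)$, regarded as a sequence space in $\omega$ through the basis, with $X^*$ regarded as a sequence space through $x^*\mapsto(x^*(e_j))_j$. Let $\mathbb S=\{z\in\mathbb C:0\le \operatorname{Re}z\le 1\}$. $\mathcal F_\infty(X,X^* )$ is the space of functions $F:\mathbb S\to\omega$, bounded and continuous on $\mathbb S$, analytic in its interior, such that $t\mapsto F(it)\in X$ and $t\mapsto F(1+it)\in X^*$ are bounded and continuous, with norm $\max(\sup_t\|F(it)\|_X,\sup_t\|F(1+it)\|_{X^*})$. The interpolation space $(X,X^* )_{1/2}=\{F(1/2):F\in\mathcal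 F_\infty(X,X^* )\}$ with the quotient norm equals $\ell_2$ up to an equivalent norm. Fix a homogeneous selection $x\in\ell_2\mapsto B(x)\in\mathcal F_\infty(X,X^* )$ with $B(x)(1/2)=x$ and $\|B(x)\|\le C\|x\|_2$, and put $\Omega(x)=B(x)'(1/2)\in\omega$. Then $Z(X)=\{(x,y)\in\omega\times\omega: y\in\ell_2,\ x-\Omega(y)\in\ell_2\}$ with the quasi-norm $\|(x,y)\|=\|x-\Omega(y)\|_2+\|y\|_2$, which is equivalent to a norm; different selections give equivalent quasi-norms. *)

theory Defs
  imports "HOL-Analysis.Analysis" "HOL-Library.Function_Algebras"
begin

text \<open>Complex sequences and pairs of such as complex vector spaces. Addition on sequences is
  the pointwise one of \<^theory>\<open>HOL-Library.Function_Algebras\<close>; the topology on sequences is the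
  product topology, i.e. pointwise convergence. The index \<open>j :: nat\<close> stands for the coordinate
  \<open>j + 1\<close> of a sequence indexed by \<open>1, 2, 3, \<dots>\<close>.\<close>

type_synonym cseq = "nat \<Rightarrow> complex"

definition seq_scale :: "complex \<Rightarrow> cseq \<Rightarrow> cseq" where
  "seq_scale c x = (\<lambda>j. c * x j)"

definition pair_scale :: "complex \<Rightarrow> cseq \<times> cseq \<Rightarrow> cseq \<times> cseq" where
  "pair_scale c p = (seq_scale c (fst p), seq_scale c (snd p))"

lemma vector_space_seq_scale: "vector_space seq_scale"
  by standard (auto simp: seq_scale_def fun_eq_iff algebra_simps)

lemma vector_space_pair_scale: "vector_space pair_scale"
  by standard (auto simp: pair_scale_def seq_scale_def fun_eq_iff algebra_simps)

text \<open>A linear subspace \<open>pts\<close> of an ambient vector space together with a (quasi-)norm on it;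
  the values of \<open>nrm\<close> outside \<open>pts\<close> carry no meaning.\<close>

record 'v nspace =
  pts :: "'v set"
  nrm :: "'v \<Rightarrow> real"


subsection \<open>Strictly singular operators\<close>

definition bounded_operator ::
  "(complex \<Rightarrow> 'v::ab_group_add \<Rightarrow> 'v) \<Rightarrow> (complex \<Rightarrow> 'w::ab_group_add \<Rightarrow> 'w) \<Rightarrow>
    'v nspace \<Rightarrow> 'w nspace \<Rightarrow> ('v \<Rightarrow> 'w) \<Rightarrow> bool" where
  "bounded_operator s1 s2 V W T \<longleftrightarrow>
    T ` pts V \<subseteq> pts W \<and>
    (\<forall>u\<in>pts V. \<forall>v\<in>pts V. T (u + v) = T u + T v) \<and>
    (\<forall>c. \<forall>v\<in>pts V. T (s1 c v) = s2 c (T v)) \<and>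
    (\<exists>K. \<forall>v\<in>pts V. nrm W (T v) \<le> K * nrm V v)"

definition closed_subspace ::
  "(complex \<Rightarrow> 'v::ab_group_add \<Rightarrow> 'v) \<Rightarrow> 'v nspace \<Rightarrow> 'v set \<Rightarrow> bool" where
  "closed_subspace s V E \<longleftrightarrow>
    E \<subseteq> pts V \<and> module.subspace s E \<and>
    (\<forall>u. \<forall>v\<in>pts V. (\<forall>n. u n \<in> E) \<and> (\<lambda>n::nat. nrm V (u n - v)) \<longlonglongrightarrow> 0 \<longrightarrow> v \<in> E)"

definition infinite_dimensional ::
  "(complex \<Rightarrow> 'v::ab_group_add \<Rightarrow> 'v) \<Rightarrow> 'v set \<Rightarrow> bool" where
  "infinite_dimensional s E \<longleftrightarrow> \<not> (\<exists>S. finite S \<and> E \<subseteq> module.span s S)"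

definition isomorphism_onto_image ::
  "'v nspace \<Rightarrow> 'w nspace \<Rightarrow> ('v \<Rightarrow> 'w) \<Rightarrow> 'v set \<Rightarrow> bool" where
  "isomorphism_onto_image V W T E \<longleftrightarrow>
    inj_on T E \<and>
    (\<exists>K. \<forall>v\<in>E. nrm W (T v) \<le> K * nrm V v) \<and>
    (\<exists>K. \<forall>w\<in>T ` E. nrm V (inv_into E T w) \<le> K * nrm W w)"

definition strictly_singular ::
  "(complex \<Rightarrow> 'v::ab_group_add \<Rightarrow> 'v) \<Rightarrow> (complex \<Rightarrow> 'w::ab_group_add \<Rightarrow> 'w) \<Rightarrow>
    'v nspace \<Rightarrow> 'w nspace \<Rightarrow> ('v \<Rightarrow> 'w) \<Rightarrow> bool" where
  "strictly_singular s1 s2 V W T \<longleftrightarrow>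
    bounded_operator s1 s2 V W T \<and>
    \<not> (\<exists>E. closed_subspace s1 V E \<and> infinite_dimensional s1 E \<and> isomorphism_onto_image V W T E)"


subsection \<open>Sequence spaces and their duals\<close>

definition unit_seq :: "nat \<Rightarrow> cseq" where
  "unit_seq j = (\<lambda>i. if i = j then 1 else 0)"

definition restrict_seq :: "nat set \<Rightarrow> cseq \<Rightarrow> cseq" where
  "restrict_seq A x = (\<lambda>j. if j \<in> A then x j else 0)"

definition ell2 :: "cseq nspace" where
  "ell2 = \<lparr>pts = {x. summable (\<lambda>j. (cmod (x j))\<^sup>2)},
           nrm = (\<lambda>x. sqrt (\<Sum>j. (cmod (x j))\<^sup>2))\<rparr>"

text \<open>The completion of the finitely supported sequences under a norm \<open>N\<close> for which the unit
  vectors form a Schauder basis, seen as a sequence space through that basis: \<open>x\<close> belongs to it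
  iff the expansion \<open>\<Sum>j. x j \<cdot> e j\<close> converges in the completion, i.e. iff its partial sums are
  \<open>N\<close>-Cauchy, and then the norm of the sum is the limit of the norms of the partial sums.\<close>

definition basis_completion :: "(cseq \<Rightarrow> real) \<Rightarrow> cseq nspace" where
  "basis_completion N =
    \<lparr>pts = {x. \<forall>\<epsilon>>0. \<exists>M. \<forall>m\<ge>M. \<forall>n\<ge>M. N (restrict_seq {..<m} x - restrict_seq {..<n} x) < \<epsilon>},
     nrm = (\<lambda>x. lim (\<lambda>n. N (restrict_seq {..<n} x)))\<rparr>"

definition functional_bounded_by :: "cseq nspace \<Rightarrow> (cseq \<Rightarrow> complex) \<Rightarrow> real \<Rightarrow> bool" where
  "functional_bounded_by X \<phi> K \<longleftrightarrow>
    (\<forall>x\<in>pts X. \<forall>y\<in>pts X. \<phi> (x + y) = \<phi> x + \<phi> y) \<and>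
    (\<forall>c. \<forall>x\<in>pts X. \<phi> (seq_scale c x) = c * \<phi> x) \<and>
    (\<forall>x\<in>pts X. cmod (\<phi> x) \<le> K * nrm X x)"

text \<open>The dual, through \<open>\<phi> \<mapsto> (\<phi> (e j))\<^sub>j\<close>. When the unit vectors span a dense subspace, \<open>\<phi>\<close> is
  determined by \<open>b\<close> and the infimum below is its operator norm.\<close>

definition dual_seq_space :: "cseq nspace \<Rightarrow> cseq nspace" where
  "dual_seq_space X =
    \<lparr>pts = {b. \<exists>\<phi> K. functional_bounded_by X \<phi> K \<and> (\<forall>j. \<phi> (unit_seq j) = b j)},
     nrm = (\<lambda>b. Inf {K. 0 \<le> K \<and> (\<exists>\<phi>. functional_bounded_by X \<phi> K \<and> (\<forall>j. \<phi> (unit_seq j) = b j))})\<rparr>"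


subsection \<open>Tsirelson's space and its 2-convexification\<close>

text \<open>A list \<open>[A\<^sub>1, \<dots>, A\<^sub>k]\<close> with \<open>k \<le> A\<^sub>1 < \<dots> < A\<^sub>k\<close>; the \<open>Suc\<close> accounts for coordinates being
  numbered from 1.\<close>

definition admissible :: "nat set list \<Rightarrow> bool" where
  "admissible As \<longleftrightarrow>
    As \<noteq> [] \<and> (\<forall>A\<in>set As. finite A \<and> A \<noteq> {}) \<and>
    length As \<le> Suc (Min (hd As)) \<and>
    sorted_wrt (\<lambda>A A'. Max A < Min A') As"

primrec tsirelson_step :: "nat \<Rightarrow> cseq \<Rightarrow> real" where
  "tsirelson_step 0 x = (SUP j. cmod (x j))"
| "tsirelson_step (Suc n) x =
    max (tsirelson_step n x)
      (1 / 2 * (SUP As\<in>{As. admissible As}. \<Sum>A\<leftarrow>As. tsirelson_step n (restrict_seq A x)))"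

text \<open>This norm and the next one are meant for finitely supported sequences.\<close>

definition tsirelson_norm :: "cseq \<Rightarrow> real" where
  "tsirelson_norm x = lim (\<lambda>n. tsirelson_step n x)"

definition convexify2 :: "(cseq \<Rightarrow> real) \<Rightarrow> cseq \<Rightarrow> real" where
  "convexify2 N x = sqrt (N (\<lambda>j. complex_of_real ((cmod (x j))\<^sup>2)))"

definition T2 :: "cseq nspace" where
  "T2 = basis_completion (convexify2 tsirelson_norm)"


subsection \<open>Complex interpolation and the twisted sum\<close>

definition strip :: "complex set" where
  "strip = {z. 0 \<le> Re z \<and> Re z \<le> 1}"

definition bounded_continuous_curve :: "cseq nspace \<Rightarrow> (real \<Rightarrow> cseq) \<Rightarrow> bool" where
  "bounded_continuous_curve X f \<longleftrightarrow>
    range f \<subseteq> pts X \<and>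
    bdd_above (range (\<lambda>t. nrm X (f t))) \<and>
    (\<forall>t. ((\<lambda>s. nrm X (f s - f t)) \<longlongrightarrow> 0) (at t))"

text \<open>Boundedness and analyticity of maps into the Frechet space of all sequences are
  coordinatewise. The constant \<^const>\<open>bounded\<close> on sequences would refer to a bounded metric,
  hence be void.\<close>

definition F_inf :: "cseq nspace \<Rightarrow> cseq nspace \<Rightarrow> (complex \<Rightarrow> cseq) set" where
  "F_inf X Y = {F.
    (\<forall>j. bounded ((\<lambda>z. F z j) ` strip)) \<and>
    continuous_on strip F \<and>
    (\<forall>j. (\<lambda>z. F z j) holomorphic_on interior strip) \<and>
    bounded_continuous_curve X (\<lambda>t. F (\<i> * complex_of_real t)) \<and>
    bounded_continuous_curve Y (\<lambda>t. F (1 + \<i> * complex_of_real t))}"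

definition F_inf_norm :: "cseq nspace \<Rightarrow> cseq nspace \<Rightarrow> (complex \<Rightarrow> cseq) \<Rightarrow> real" where
  "F_inf_norm X Y F =
    max (SUP t. nrm X (F (\<i> * complex_of_real t))) (SUP t. nrm Y (F (1 + \<i> * complex_of_real t)))"

definition homogeneous_selection :: "cseq nspace \<Rightarrow> (cseq \<Rightarrow> complex \<Rightarrow> cseq) \<Rightarrow> bool" where
  "homogeneous_selection X B \<longleftrightarrow>
    (\<forall>x\<in>pts ell2. B x \<in> F_inf X (dual_seq_space X) \<and> B x (1 / 2) = x) \<and>
    (\<exists>C. \<forall>x\<in>pts ell2. F_inf_norm X (dual_seq_space X) (B x) \<le> C * nrm ell2 x) \<and>
    (\<forall>c. \<forall>x\<in>pts ell2. \<forall>z\<in>strip. B (seq_scale c x) z = seq_scale c (B x z))"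

definition Omega :: "(cseq \<Rightarrow> complex \<Rightarrow> cseq) \<Rightarrow> cseq \<Rightarrow> cseq" where
  "Omega B x = (\<lambda>j. deriv (\<lambda>z. B x z j) (1 / 2))"

text \<open>\<open>Z(X)\<close>, where \<open>B\<close> is a homogeneous selection for \<open>X\<close>.\<close>

definition Z_space :: "(cseq \<Rightarrow> complex \<Rightarrow> cseq) \<Rightarrow> (cseq \<times> cseq) nspace" where
  "Z_space B =
    \<lparr>pts = {(x, y). y \<in> pts ell2 \<and> x - Omega B y \<in> pts ell2},
     nrm = (\<lambda>(x, y). nrm ell2 (x - Omega B y) + nrm ell2 y)\<rparr>"

end

theory Submission
  imports Defs "HOL-Complex_Analysis.Complex_Analysis" "HOL-Real_Asymp.Real_Asymp"
begin

text \<open>Suppose that \<open>Q\<close> is an isomorphism on an infinite-dimensional \<open>E\<close>. A gliding hump gives \<open>w\<^sub>i\<close> in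
  \<open>Q E\<close> that are almost supported on successive blocks. Take \<open>a\<close> in the span of a set of unit
  vectors of the 2-convexified space and a functional \<open>g\<close> that almost norms the squares \<open>a\<^sub>i\<^sup>2\<close> in
  Tsirelson's space. The function \<open>z \<mapsto> \<Sum>i. \<plusminus>a\<^sub>i g\<^sub>i\<^sup>z B(w\<^sub>i)(z)\<close>, cut down to the blocks, is bounded in
  the interpolation space, by the block estimates in Tsirelson's space. Its value at \<open>1/2\<close> is
  nearly \<open>y = \<Sum>i. \<plusminus>\<lambda>\<^sub>i w\<^sub>i\<close> with \<open>\<lambda>\<^sub>i\<^sup>2 = a\<^sub>i\<^sup>2 g\<^sub>i\<close>, and its derivative there contains the term
  \<open>\<Sum>i. \<plusminus>\<lambda>\<^sub>i ln g\<^sub>i w\<^sub>i\<close>. Two bounded functions with the same value at \<open>1/2\<close> have derivatives at distance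
  \<open>O(1)\<close> in \<open>\<ell>\<^sub>2\<close>, and \<open>\<Omega>(y)\<close> is at distance \<open>O(1)\<close> from a linear function of \<open>y\<close>; averaging over the signs
  bounds \<open>\<Sum>i. \<lambda>\<^sub>i\<^sup>2 (ln g\<^sub>i)\<^sup>2\<close> by a constant. But for repeated averages \<open>a\<^sub>i\<^sup>2\<close> of high order, the functional \<open>g\<close>
  must have most of its mass at a large depth \<open>D\<close> of its tree, where \<open>g\<^sub>i \<le> 1 / 2 ^ D\<close>.\<close>

subsection \<open>Norming functionals of Tsirelson's space and the lower block estimate\<close>

text \<open>The factor \<open>a_i g_i^z\<close> is a Calderon factorization of
  \<open>\<lambda>\<close>. Its modulus is at most \<open>a_i\<close> on the line
  \<open>Re z = 0\<close> and equals \<open>a_i g_i\<close> on \<open>Re z = 1\<close>, where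
  Cauchy-Schwarz and the norming property of \<open>g\<close> bound it in the dual by the square
  root of the sum of \<open>a_i^2 g_i\<close>. That blocks may replace unit vectors is the
  peculiarity of Tsirelson's space: up to constants, blocks behave like unit vectors at positions
  next to them. The distance \<open>O(1)\<close> of the derivatives comes from dividing the
  difference of the functions by \<open>z - 1/2\<close>, which is bounded away from zero on the
  boundary. The linear function close to \<open>\<Omega>\<close> is the one that sends
  \<open>y\<close> to \<open>x\<close> for \<open>(x, y)\<close> in \<open>E\<close>; continuity of
  the inverse of \<open>Q\<close> on \<open>E\<close> bounds \<open>x - \<Omega>(y)\<close>. The
  signs are needed because the derivative is controlled only as a whole sum, while its logarithmic
  terms come together with terms \<open>\<Omega>(w_i)\<close>. The latter cancel against
  \<open>x_i\<close> for each \<open>i\<close> separately, so one needs a bound for the sum of the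
  squared norms of the summands.\<close>

definition successive :: "nat \<Rightarrow> (nat \<Rightarrow> nat set) \<Rightarrow> bool" where
  "successive n P \<longleftrightarrow>
    (\<forall>r<n. \<forall>a\<in>P r. n \<le> Suc a) \<and> (\<forall>r<n. \<forall>s<n. r < s \<longrightarrow> (\<forall>a\<in>P r. \<forall>b\<in>P s. a < b))"

lemma successive_count: "successive n P \<Longrightarrow> r < n \<Longrightarrow> a \<in> P r \<Longrightarrow> n \<le> Suc a"
  unfolding successive_def by blast

lemma successive_less:
  "successive n P \<Longrightarrow> r < s \<Longrightarrow> s < n \<Longrightarrow> a \<in> P r \<Longrightarrow> b \<in> P s \<Longrightarrow> a < b"
  unfolding successive_def by (meson less_trans)

lemma successive_unique:
  assumes "successive n P" "r < n" "s < n" "a \<in> P r" "a \<in> P s"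
  shows "r = s"
  using successive_less[OF assms(1)] assms by (metis less_irrefl linorder_neqE_nat)

lemma sum_successive:
  fixes h :: "nat \<Rightarrow> real"
  assumes "successive n P" "r < n" "i \<in> P r"
  shows "(\<Sum>r<n. if i \<in> P r then h r else 0) = h r"
proof -
  have "(\<Sum>q<n. if i \<in> P q then h q else 0) = (\<Sum>q<n. if q = r then h r else 0)"
  proof (rule sum.cong[OF refl])
    fix q assume "q \<in> {..<n}"
    then have "i \<in> P q \<longleftrightarrow> q = r"
      using successive_unique[OF assms(1) _ assms(2) _ assms(3)] assms(3) by blast
    then show "(if i \<in> P q then h q else 0) = (if q = r then h r else 0)" by simp
  qed
  then show ?thesis using assms(2) by simp
qed

text \<open>The usual norming set of Tsirelson's space, reduced to nonnegative coefficients because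
  the norm depends only on moduli. A leaf at depth \<open>D\<close> has coefficient
  \<open>(1 / 2) ^ D\<close>. The sets \<open>P r\<close> do the restricting, so \<open>h r\<close>
  need not be supported there; they may be empty, which lets a node be cut down to any set.\<close>

inductive norming :: "(nat \<Rightarrow> real) \<Rightarrow> bool" where
  leaf: "norming (\<lambda>i. if i = j then 1 else 0)"
| node: "\<lbrakk>successive n P; \<And>r. r < n \<Longrightarrow> norming (h r)\<rbrakk>
    \<Longrightarrow> norming (\<lambda>i. (\<Sum>r<n. if i \<in> P r then h r i else 0) / 2)"

lemma norming_bounds: "norming g \<Longrightarrow> 0 \<le> g i \<and> g i \<le> 1"
proof (induction rule: norming.induct)
  case (node n P h)
  show ?case
  proof (cases "\<exists>r<n. i \<in> P r")
    case True
    then obtain r where r: "r < n" "i \<in> P r" by auto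
    show ?thesis using sum_successive[OF node(1) r, of "\<lambda>r. h r i"] node(3)[OF r(1)] by auto
  next
    case False
    then have "(\<Sum>r<n. if i \<in> P r then h r i else 0) = 0" by (intro sum.neutral) auto
    then show ?thesis by simp
  qed
qed auto

lemma norming_nonneg: "norming g \<Longrightarrow> 0 \<le> g i" and norming_le_1: "norming g \<Longrightarrow> g i \<le> 1"
  using norming_bounds by auto

text \<open>Tsirelson's norm of the vector with entry \<open>f i\<close> at position \<open>\<kappa> i\<close>, for \<open>i \<in> J\<close> and \<open>f \<ge> 0\<close>.\<close>

definition tau :: "(nat \<Rightarrow> nat) \<Rightarrow> nat set \<Rightarrow> (nat \<Rightarrow> real) \<Rightarrow> real" where
  "tau \<kappa> J f = (SUP g\<in>Collect norming. \<Sum>i\<in>J. g (\<kappa> i) * f i)"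

abbreviation tau_id :: "nat set \<Rightarrow> (nat \<Rightarrow> real) \<Rightarrow> real" where
  "tau_id \<equiv> tau (\<lambda>j. j)"

lemma norming_sum_le:
  assumes "norming g" "\<And>i. 0 \<le> f i"
  shows "(\<Sum>i\<in>J. g (\<kappa> i) * f i) \<le> (\<Sum>i\<in>J. f i)"
  by (intro sum_mono) (use assms norming_bounds[OF assms(1)] in \<open>auto intro: mult_left_le_one_le\<close>)

lemma tau_upper:
  assumes "norming g" "\<And>i. 0 \<le> f i"
  shows "(\<Sum>i\<in>J. g (\<kappa> i) * f i) \<le> tau \<kappa> J f"
  unfolding tau_def
proof (rule cSUP_upper)
  show "bdd_above ((\<lambda>g. \<Sum>i\<in>J. g (\<kappa> i) * f i) ` Collect norming)"
    by (rule bdd_aboveI2[where M="\<Sum>i\<in>J. f i"]) (use norming_sum_le assms(2) in auto)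
qed (use assms in auto)

lemma tau_least:
  assumes "\<And>g. norming g \<Longrightarrow> (\<Sum>i\<in>J. g (\<kappa> i) * f i) \<le> M"
  shows "tau \<kappa> J f \<le> M"
  unfolding tau_def using norming.leaf assms by (intro cSUP_least) auto

lemma tau_nonneg:
  assumes "\<And>i. 0 \<le> f i"
  shows "0 \<le> tau \<kappa> J f"
proof -
  have "0 \<le> (\<Sum>i\<in>J. (if \<kappa> i = 0 then 1 else 0) * f i)"
    using assms by (intro sum_nonneg) auto
  also have "\<dots> \<le> tau \<kappa> J f" using tau_upper[OF norming.leaf[of 0] assms] .
  finally show ?thesis .
qed

lemma tau_le_sum: "(\<And>i. 0 \<le> f i) \<Longrightarrow> tau \<kappa> J f \<le> (\<Sum>i\<in>J. f i)"
  by (intro tau_least norming_sum_le)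

lemma tau_mono:
  assumes "finite J'" "J \<subseteq> J'" "\<And>i. 0 \<le> f i" "\<And>i. 0 \<le> f' i" "\<And>i. i \<in> J \<Longrightarrow> f i \<le> f' i"
  shows "tau \<kappa> J f \<le> tau \<kappa> J' f'"
proof (rule tau_least)
  fix g assume g: "norming g"
  have "(\<Sum>i\<in>J. g (\<kappa> i) * f i) \<le> (\<Sum>i\<in>J. g (\<kappa> i) * f' i)"
    using assms(5) by (intro sum_mono mult_left_mono norming_nonneg[OF g])
  also have "\<dots> \<le> (\<Sum>i\<in>J'. g (\<kappa> i) * f' i)"
    by (intro sum_mono2 assms) (use assms(4) norming_nonneg[OF g] in auto)
  also have "\<dots> \<le> tau \<kappa> J' f'" using tau_upper[OF g assms(4)] .
  finally show "(\<Sum>i\<in>J. g (\<kappa> i) * f i) \<le> tau \<kappa> J' f'" .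
qed

lemma tau_le_scale:
  assumes "\<And>i. 0 \<le> f i" "0 \<le> c"
  shows "tau \<kappa> J (\<lambda>i. c * f i) \<le> c * tau \<kappa> J f"
proof (rule tau_least)
  fix g assume g: "norming g"
  have "(\<Sum>i\<in>J. g (\<kappa> i) * (c * f i)) = c * (\<Sum>i\<in>J. g (\<kappa> i) * f i)"
    by (simp add: sum_distrib_left algebra_simps)
  also have "\<dots> \<le> c * tau \<kappa> J f" using tau_upper[OF g] assms by (intro mult_left_mono) auto
  finally show "(\<Sum>i\<in>J. g (\<kappa> i) * (c * f i)) \<le> c * tau \<kappa> J f" .
qed

lemma tau_approx:
  assumes "M < tau \<kappa> J f"
  obtains g where "norming g" "M < (\<Sum>i\<in>J. g (\<kappa> i) * f i)"
  using assms tau_least by (meson not_le)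

lemma tau_member:
  assumes "finite J" "i \<in> J" "\<And>i. 0 \<le> f i"
  shows "f i \<le> tau \<kappa> J f"
proof -
  have "f i = (\<Sum>q\<in>{i}. (if \<kappa> q = \<kappa> i then 1 else 0) * f q)" by simp
  also have "\<dots> \<le> (\<Sum>q\<in>J. (if \<kappa> q = \<kappa> i then 1 else 0) * f q)"
    using assms by (intro sum_mono2) auto
  also have "\<dots> \<le> tau \<kappa> J f" using tau_upper[OF norming.leaf[of "\<kappa> i"] assms(3)] .
  finally show ?thesis .
qed

lemma sum_node:
  fixes f :: "nat \<Rightarrow> real"
  assumes "finite J" "inj_on \<kappa> J" "\<And>r. r < n \<Longrightarrow> Q r \<subseteq> J"
  shows "(\<Sum>i\<in>J. (\<Sum>r<n. if \<kappa> i \<in> \<kappa> ` Q r then h r (\<kappa> i) else 0) / 2 * f i)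
    = (\<Sum>r<n. \<Sum>i\<in>Q r. h r (\<kappa> i) * f i) / 2"
proof -
  have "(\<Sum>i\<in>J. (\<Sum>r<n. if \<kappa> i \<in> \<kappa> ` Q r then h r (\<kappa> i) else 0) / 2 * f i)
    = (\<Sum>i\<in>J. \<Sum>r<n. (if i \<in> Q r then h r (\<kappa> i) * f i else 0) / 2)"
  proof (intro sum.cong refl)
    fix i assume i: "i \<in> J"
    have "\<kappa> i \<in> \<kappa> ` Q r \<longleftrightarrow> i \<in> Q r" if "r < n" for r
      using assms(2) assms(3)[OF that] i by (auto dest: inj_onD)
    then show "(\<Sum>r<n. if \<kappa> i \<in> \<kappa> ` Q r then h r (\<kappa> i) else 0) / 2 * f i =
        (\<Sum>r<n. (if i \<in> Q r then h r (\<kappa> i) * f i else 0) / 2)"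
      by (auto simp: sum_divide_distrib sum_distrib_right intro!: sum.cong)
  qed
  also have "\<dots> = (\<Sum>r<n. \<Sum>i\<in>J. (if i \<in> Q r then h r (\<kappa> i) * f i else 0) / 2)"
    by (rule sum.swap)
  also have "\<dots> = (\<Sum>r<n. (\<Sum>i\<in>Q r. h r (\<kappa> i) * f i) / 2)"
  proof (intro sum.cong refl)
    fix r assume "r \<in> {..<n}"
    then have "J \<inter> Q r = Q r" using assms(3) by auto
    then show "(\<Sum>i\<in>J. (if i \<in> Q r then h r (\<kappa> i) * f i else 0) / 2) = (\<Sum>i\<in>Q r. h r (\<kappa> i) * f i) / 2"
      using assms(1) by (simp add: sum_divide_distrib[symmetric] sum.inter_restrict[symmetric])
  qed
  finally show ?thesis by (simp add: sum_divide_distrib)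
qed

text \<open>The implicit inequality of Tsirelson's norm: almost norming functionals of the pieces
  become the children of one node. The supremum need not be attained, so each piece gets an error;
  the denominator \<open>Suc n\<close> also covers \<open>n = 0\<close>.\<close>

lemma tau_successive:
  assumes "finite J" "inj_on \<kappa> J" "\<And>i. 0 \<le> f i"
    and Q: "\<And>r. r < n \<Longrightarrow> Q r \<subseteq> J" and succ: "successive n (\<lambda>r. \<kappa> ` Q r)"
  shows "(\<Sum>r<n. tau \<kappa> (Q r) f) / 2 \<le> tau \<kappa> J f"
proof (rule field_le_epsilon)
  fix e :: real assume e: "0 < e"
  have "\<exists>g. norming g \<and> tau \<kappa> (Q r) f - e / real (Suc n) < (\<Sum>i\<in>Q r. g (\<kappa> i) * f i)" for r
  proof -
    have "tau \<kappa> (Q r) f - e / real (Suc n) < tau \<kappa> (Q r) f" using e by simp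
    then show ?thesis by (rule tau_approx) blast
  qed
  then obtain h where h: "\<And>r. norming (h r)"
    "\<And>r. tau \<kappa> (Q r) f - e / real (Suc n) < (\<Sum>i\<in>Q r. h r (\<kappa> i) * f i)"
    by metis
  have "(\<Sum>r<n. tau \<kappa> (Q r) f) / 2 \<le> (\<Sum>r<n. (\<Sum>i\<in>Q r. h r (\<kappa> i) * f i) + e / real (Suc n)) / 2"
    using h(2) by (intro divide_right_mono sum_mono) (auto simp: algebra_simps intro: less_imp_le)
  also have "\<dots> = (\<Sum>r<n. \<Sum>i\<in>Q r. h r (\<kappa> i) * f i) / 2 + real n * (e / real (Suc n)) / 2"
    by (simp add: sum.distrib add_divide_distrib)
  also have "real n * (e / real (Suc n)) / 2 \<le> e"
    using e by (simp add: field_simps)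
  also have "(\<Sum>r<n. \<Sum>i\<in>Q r. h r (\<kappa> i) * f i) / 2 =
      (\<Sum>i\<in>J. (\<Sum>r<n. if \<kappa> i \<in> \<kappa> ` Q r then h r (\<kappa> i) else 0) / 2 * f i)"
    by (rule sum_node[OF assms(1,2) Q, symmetric])
  also have "\<dots> \<le> tau \<kappa> J f"
    using tau_upper[OF norming.node[OF succ, of h] assms(3)] h(1) by simp
  finally show "(\<Sum>r<n. tau \<kappa> (Q r) f) / 2 \<le> tau \<kappa> J f + e" by simp
qed

text \<open>Grafting norms of the blocks onto the leaves of a tree over their left end points keeps the
  tree admissible.\<close>

lemma lower_block_estimate:
  assumes "norming g" "finite J" "finite V" "strict_mono \<kappa>" "\<And>i. 0 \<le> f i"
    and I: "\<And>i j. j \<in> I i \<Longrightarrow> \<kappa> i \<le> j \<and> j < \<kappa> (Suc i)"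
  shows "(\<Sum>i\<in>J. g (\<kappa> i) * tau_id (V \<inter> I i) f) \<le> tau_id V f"
  using assms(1-3)
proof (induction arbitrary: J V rule: norming.induct)
  case (leaf j)
  show ?case
  proof (cases "\<exists>i\<in>J. \<kappa> i = j")
    case True
    then obtain i where i: "i \<in> J" "\<kappa> i = j" by auto
    have "(\<Sum>q\<in>J. (if \<kappa> q = j then 1 else 0) * tau_id (V \<inter> I q) f)
        = (\<Sum>q\<in>J. if q = i then tau_id (V \<inter> I i) f else 0)"
      using i assms(4) by (intro sum.cong) (auto dest: strict_mono_eq)
    also have "\<dots> = tau_id (V \<inter> I i) f" using leaf i by simp
    also have "\<dots> \<le> tau_id V f" using leaf assms(5) by (intro tau_mono) auto
    finally show ?thesis .
  next
    case False
    then have "(\<Sum>q\<in>J. (if \<kappa> q = j then 1 else 0) * tau_id (V \<inter> I q) f) = 0"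
      by (intro sum.neutral) auto
    then show ?thesis using tau_nonneg assms(5) by simp
  qed
next
  case (node n P h)
  \<comment> \<open>Indices are sorted by the child that contains the left end point of their block,
    and the union \<open>Vr r\<close> of these blocks, cut to \<open>V\<close>, replaces the child.
    No block reaches to the left of its left end point or up to the next one, so count and order
    survive.\<close>
  define Jr where "Jr r = {i\<in>J. \<kappa> i \<in> P r}" for r
  define Vr where "Vr r = V \<inter> (\<Union>i\<in>Jr r. I i)" for r
  have inj: "inj_on \<kappa> J" using assms(4) by (meson inj_on_subset strict_mono_on_imp_inj_on subset_UNIV)
  have "(\<Sum>i\<in>J. (\<Sum>r<n. if \<kappa> i \<in> P r then h r (\<kappa> i) else 0) / 2 * tau_id (V \<inter> I i) f)
     = (\<Sum>i\<in>J. (\<Sum>r<n. if \<kappa> i \<in> \<kappa> ` Jr r then h r (\<kappa> i) else 0) / 2 * tau_id (V \<inter> I i) f)"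
    using assms(4) by (auto intro!: sum.cong simp: Jr_def)
  also have "\<dots> = (\<Sum>r<n. \<Sum>i\<in>Jr r. h r (\<kappa> i) * tau_id (V \<inter> I i) f) / 2"
    by (intro sum_node[OF node(4) inj]) (auto simp: Jr_def)
  also have "\<dots> = (\<Sum>r<n. \<Sum>i\<in>Jr r. h r (\<kappa> i) * tau_id (Vr r \<inter> I i) f) / 2"
  proof -
    have "Vr r \<inter> I i = V \<inter> I i" if "i \<in> Jr r" for r i using that by (auto simp: Vr_def)
    then show ?thesis by simp
  qed
  also have "\<dots> \<le> (\<Sum>r<n. tau_id (Vr r) f) / 2"
  proof (intro divide_right_mono sum_mono)
    fix r assume "r \<in> {..<n}"
    then show "(\<Sum>i\<in>Jr r. h r (\<kappa> i) * tau_id (Vr r \<inter> I i) f) \<le> tau_id (Vr r) f"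
      by (intro node(3)) (simp_all add: Jr_def Vr_def node)
  qed simp
  also have "\<dots> \<le> tau_id V f"
  proof (rule tau_successive)
    show "successive n (\<lambda>r. (\<lambda>j. j) ` Vr r)"
      unfolding successive_def
    proof (intro conjI allI impI ballI)
      fix r a assume r: "r < n" "a \<in> (\<lambda>j. j) ` Vr r"
      then obtain i where i: "\<kappa> i \<in> P r" "a \<in> I i" by (auto simp: Vr_def Jr_def)
      show "n \<le> Suc a" using successive_count[OF node(1) r(1) i(1)] I[OF i(2)] by linarith
    next
      fix r s a b assume r: "r < n" "s < n" "r < s" "a \<in> (\<lambda>j. j) ` Vr r" "b \<in> (\<lambda>j. j) ` Vr s"
      then obtain i i' where i: "\<kappa> i \<in> P r" "a \<in> I i" "\<kappa> i' \<in> P s" "b \<in> I i'"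
        by (auto simp: Vr_def Jr_def)
      have "\<kappa> i < \<kappa> i'" using successive_less[OF node(1) r(3,2) i(1,3)] .
      then have "Suc i \<le> i'" using assms(4) by (simp add: strict_mono_less Suc_le_eq)
      then have "\<kappa> (Suc i) \<le> \<kappa> i'" using assms(4) by (simp add: strict_mono_less_eq)
      then show "a < b" using I[OF i(2)] I[OF i(4)] by linarith
    qed
  qed (use node assms(5) in \<open>auto simp: Vr_def\<close>)
  finally show ?case .
qed

subsection \<open>The upper block estimate\<close>

lemma sum_pairs:
  fixes F :: "nat \<Rightarrow> real"
  shows "(\<Sum>q<2 * n. F q) = (\<Sum>r<n. F (2 * r) + F (Suc (2 * r)))"
  by (induction n) auto

text \<open>An interval meeting two sets of a node is charged to its own norm. The intervals of this kind
  contribute at most one further set after each of the \<open>n\<close> sets of the node, so the doubling condition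
  on the positions \<open>\<kappa>\<close> keeps the resulting \<open>2 n\<close> sets admissible.\<close>

lemma upper_block_estimate:
  assumes "norming g" "finite J" "finite V" and mono: "strict_mono \<kappa>"
    and f: "\<And>i. 0 \<le> f i" and \<xi>: "\<And>i. 0 \<le> \<xi> i"
    and I: "\<And>i j. j \<in> I i \<Longrightarrow> \<kappa> i \<le> j \<and> 2 * Suc j \<le> \<kappa> (Suc i)"
    and block: "\<And>i. i \<in> J \<Longrightarrow> tau_id (V \<inter> I i) f \<le> \<xi> i"
  shows "(\<Sum>i\<in>J. \<Sum>j\<in>V \<inter> I i. g j * f j) \<le> 2 * tau (\<lambda>i. \<kappa> (Suc i)) J \<xi>"
  using assms(1,2) block
proof (induction arbitrary: J rule: norming.induct)
  case (leaf j0)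
  show ?case
  proof (cases "\<exists>i\<in>J. j0 \<in> V \<inter> I i")
    case True
    then obtain i where i: "i \<in> J" "j0 \<in> V \<inter> I i" by auto
    have uniq: "j0 \<in> I q \<longleftrightarrow> q = i" for q
    proof
      assume q: "j0 \<in> I q"
      have "\<kappa> i < \<kappa> (Suc q)" "\<kappa> q < \<kappa> (Suc i)" using I[OF q] I[of j0 i] i by auto
      then have "i < Suc q" "q < Suc i" using mono by (auto simp: strict_mono_less)
      then show "q = i" by simp
    qed (use i in auto)
    have "(\<Sum>q\<in>J. \<Sum>j\<in>V \<inter> I q. (if j = j0 then 1 else 0) * f j)
        = (\<Sum>q\<in>J. if q = i then f j0 else 0)"
    proof (intro sum.cong refl)
      fix q
      have "(\<Sum>j\<in>V \<inter> I q. (if j = j0 then 1 else 0) * f j) = (\<Sum>j\<in>V \<inter> I q. if j = j0 then f j0 else 0)"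
        by (intro sum.cong) auto
      also have "\<dots> = (if q = i then f j0 else 0)"
        using assms(3) uniq[of q] i by simp
      finally show "(\<Sum>j\<in>V \<inter> I q. (if j = j0 then 1 else 0) * f j) = (if q = i then f j0 else 0)" .
    qed
    also have "\<dots> = f j0" using leaf(1) i by simp
    also have "\<dots> \<le> tau_id (V \<inter> I i) f" using assms(3) i f by (intro tau_member) auto
    also have "\<dots> \<le> \<xi> i" using leaf i by simp
    also have "\<dots> \<le> tau (\<lambda>i. \<kappa> (Suc i)) J \<xi>" using leaf i \<xi> by (intro tau_member) auto
    also have "\<dots> \<le> 2 * tau (\<lambda>i. \<kappa> (Suc i)) J \<xi>" using tau_nonneg[of \<xi>] \<xi> by simp
    finally show ?thesis .
  next
    case False
    then have "(\<Sum>q\<in>J. \<Sum>j\<in>V \<inter> I q. (if j = j0 then 1 else 0) * f j) = 0"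
      by (intro sum.neutral ballI) auto
    then show ?thesis using tau_nonneg[of \<xi>] \<xi> by simp
  qed
next
  case (node n P h)
  define g where "g i = (\<Sum>r<n. if i \<in> P r then h r i else 0) / 2" for i
  have g: "norming g" unfolding g_def using norming.node[OF node(1,2)] .
  define c where "c i = (\<Sum>j\<in>V \<inter> I i. g j * f j)" for i
  have c0: "0 \<le> c i" for i
    unfolding c_def by (intro sum_nonneg mult_nonneg_nonneg norming_nonneg[OF g] f)
  \<comment> \<open>Each block is filed under the first child that it meets: in \<open>A r\<close>
    if it meets no other, in \<open>S r\<close> if it meets a later one as well. \<open>Q\<close>
    interleaves these sets as \<open>A 0, S 0, A 1, S 1, ...\<close>, which is their order on the
    line.\<close>
  define hits where "hits i r \<longleftrightarrow> r < n \<and> V \<inter> I i \<inter> P r \<noteq> {}" for i r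
  define A where "A r = {i\<in>J. hits i r \<and> (\<forall>s. hits i s \<longrightarrow> s = r)}" for r
  define S where "S r = {i\<in>J. hits i r \<and> (\<forall>s<r. \<not> hits i s) \<and> (\<exists>s>r. hits i s)}" for r
  define Q where "Q q = (if even q then A (q div 2) else S (q div 2))" for q
  have A_D: "hits i r" "hits i s \<Longrightarrow> s = r" if "i \<in> A r" for i r s
    using that unfolding A_def by blast+
  have S_D: "hits i r" "s < r \<Longrightarrow> \<not> hits i s" "\<exists>s>r. hits i s" if "i \<in> S r" for i r s
    using that unfolding S_def by blast+
  let ?t = "\<lambda>J. tau (\<lambda>i. \<kappa> (Suc i)) J \<xi>"

  have hits_le: "i \<le> i'" if hit: "hits i r" "hits i' s" "r < s" for i i' r s
  proof -
    obtain a b where ab: "a \<in> I i" "a \<in> P r" "b \<in> I i'" "b \<in> P s"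
      using hit(1,2) unfolding hits_def by blast
    have "s < n" using hit by (simp add: hits_def)
    then have "a < b" using successive_less[OF node(1) hit(3) _ ab(2,4)] by blast
    then have "\<kappa> i < \<kappa> (Suc i')" using I[OF ab(1)] I[OF ab(3)] by auto
    then show ?thesis using mono by (simp add: strict_mono_less)
  qed
  have Q_hits: "hits i (q div 2)" if "i \<in> Q q" for i q
    using that A_D(1) S_D(1) by (cases "even q") (simp_all add: Q_def)
  have Q_less: "i < i'" if i: "i \<in> Q q" "i' \<in> Q q'" and "q < q'" for i i' q q'
  proof (cases "q div 2 = q' div 2")
    case True
    then have q: "even q" "q' = Suc q" using \<open>q < q'\<close> by presburger+
    have "i \<in> A (q div 2)" "i' \<in> S (q div 2)" using i q by (auto simp: Q_def)
    then obtain s where s: "s > q div 2" "hits i' s" "hits i (q div 2)" "\<not> hits i s"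
      using A_D S_D(3) by (metis less_irrefl)
    then show ?thesis using hits_le[OF s(3,2,1)] by (metis le_neq_implies_less)
  next
    case False
    then have lt: "q div 2 < q' div 2" using \<open>q < q'\<close> by presburger
    have "i \<le> i'" using hits_le[OF Q_hits[OF i(1)] Q_hits[OF i(2)] lt] .
    moreover have "\<not> hits i' (q div 2)"
    proof (cases "even q'")
      case True
      then show ?thesis using i(2) lt A_D(2)[of i' "q' div 2" "q div 2"] by (auto simp: Q_def)
    next
      case False
      then show ?thesis using i(2) lt S_D(2)[of i' "q' div 2" "q div 2"] by (auto simp: Q_def)
    qed
    ultimately show ?thesis using Q_hits[OF i(1)] by (metis le_neq_implies_less)
  qed
  have QJ: "Q q \<subseteq> J" for q by (auto simp: Q_def A_def S_def)
  have succ: "successive (2 * n) (\<lambda>q. (\<lambda>i. \<kappa> (Suc i)) ` Q q)"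
    unfolding successive_def
  proof (intro conjI allI impI ballI)
    fix q a assume "a \<in> (\<lambda>i. \<kappa> (Suc i)) ` Q q"
    then obtain i where i: "i \<in> Q q" "a = \<kappa> (Suc i)" by auto
    obtain b where b: "b \<in> I i" "b \<in> P (q div 2)" "q div 2 < n"
      using Q_hits[OF i(1)] unfolding hits_def by blast
    \<comment> \<open>Twice as many sets need twice as large a first position; moving from the block
      to the start \<open>\<kappa> (Suc i)\<close> of the next one provides it.\<close>
    have "2 * n \<le> 2 * Suc b" using successive_count[OF node(1) b(3,2)] by (rule mult_le_mono2)
    also have "\<dots> \<le> \<kappa> (Suc i)" using I[OF b(1)] by (rule conjunct2)
    finally show "2 * n \<le> Suc a" using i(2) by simp
  next
    fix q q' a b assume "q < q'" "a \<in> (\<lambda>i. \<kappa> (Suc i)) ` Q q" "b \<in> (\<lambda>i. \<kappa> (Suc i)) ` Q q'"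
    then show "a < b" using Q_less mono by (auto simp: strict_mono_less)
  qed

  \<comment> \<open>The factor \<open>1 / 2\<close> of the node cancels the factor \<open>2\<close>
    of the induction hypothesis, so the constant does not grow with the depth of the tree.\<close>
  have cA: "(\<Sum>i\<in>A r. c i) \<le> ?t (A r)" if r: "r < n" for r
  proof -
    have "c i \<le> (\<Sum>j\<in>V \<inter> I i. h r j * f j) / 2" if i: "i \<in> A r" for i
      unfolding c_def sum_divide_distrib
    proof (rule sum_mono)
      fix j assume j: "j \<in> V \<inter> I i"
      have "(if j \<in> P s then h s j else 0) = 0" if "s < n" "s \<noteq> r" for s
      proof -
        have "\<not> hits i s" using A_D(2)[OF i] that by blast
        then have "j \<notin> P s" using j that unfolding hits_def by blast
        then show ?thesis by simp
      qed
      then have "(\<Sum>s<n. if j \<in> P s then h s j else 0) = (\<Sum>s<n. if s = r then (if j \<in> P r then h r j else 0) else 0)"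
        by (intro sum.cong) auto
      then have "g j = (if j \<in> P r then h r j else 0) / 2" using r by (simp add: g_def)
      also have "\<dots> \<le> h r j / 2" using norming_nonneg[OF node(2)[OF r]] by simp
      finally show "g j * f j \<le> h r j * f j / 2" using f[of j] mult_right_mono by fastforce
    qed
    then have "(\<Sum>i\<in>A r. c i) \<le> (\<Sum>i\<in>A r. (\<Sum>j\<in>V \<inter> I i. h r j * f j) / 2)" by (rule sum_mono)
    also have "\<dots> = (\<Sum>i\<in>A r. \<Sum>j\<in>V \<inter> I i. h r j * f j) / 2" by (simp add: sum_divide_distrib)
    also have "\<dots> \<le> ?t (A r)"
    proof -
      have "finite (A r)" "\<And>i. i \<in> A r \<Longrightarrow> tau_id (V \<inter> I i) f \<le> \<xi> i"
        using node(4,5) by (auto simp: A_def)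
      from node(3)[OF r this] show ?thesis by simp
    qed
    finally show ?thesis .
  qed
  have cS: "(\<Sum>i\<in>S r. c i) \<le> ?t (S r)" if r: "r < n" for r
  proof (cases "S r = {}")
    case False
    then obtain i where i: "i \<in> S r" by auto
    \<comment> \<open>One block meets child \<open>r\<close> and the other a later child, which
      orders them weakly; by symmetry they coincide, so \<open>S r\<close> has at most one
      element.\<close>
    have le: "i1 \<le> i2" if S12: "i1 \<in> S r" "i2 \<in> S r" for i1 i2
    proof -
      obtain s where "s > r" "hits i2 s" using S_D(3)[OF S12(2)] by blast
      then show ?thesis using hits_le[OF S_D(1)[OF S12(1)]] by blast
    qed
    have "i' = i" if "i' \<in> S r" for i'
      using le[OF that i] le[OF i that] by simp
    then have Si: "S r = {i}" using i by blast
    have "c i \<le> tau_id (V \<inter> I i) f"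
      unfolding c_def using tau_upper[where \<kappa>="\<lambda>j. j", OF g f] by simp
    also have "\<dots> \<le> \<xi> i" using node(5) i by (auto simp: S_def)
    also have "\<dots> \<le> ?t (S r)" using Si \<xi> by (intro tau_member) auto
    finally show ?thesis using Si by simp
  qed (simp add: tau_nonneg[OF \<xi>])

  have "(\<Sum>i\<in>J. c i) \<le> (\<Sum>i\<in>J. \<Sum>r<n. (if i \<in> A r then c i else 0) + (if i \<in> S r then c i else 0))"
  proof (rule sum_mono)
    fix i assume i: "i \<in> J"
    show "c i \<le> (\<Sum>r<n. (if i \<in> A r then c i else 0) + (if i \<in> S r then c i else 0))"
    proof (cases "\<exists>r. hits i r")
      case True
      define r where "r = (LEAST r. hits i r)"
      have r: "hits i r" "\<And>s. s < r \<Longrightarrow> \<not> hits i s"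
        using True unfolding r_def by (auto intro: LeastI dest: not_less_Least)
      have "i \<in> A r \<or> i \<in> S r"
        using r i unfolding A_def S_def by (simp, metis linorder_neqE_nat)
      then have "c i \<le> (if i \<in> A r then c i else 0) + (if i \<in> S r then c i else 0)"
        using c0[of i] by auto
      also have "\<dots> \<le> (\<Sum>r<n. (if i \<in> A r then c i else 0) + (if i \<in> S r then c i else 0))"
        using r c0[of i] by (intro member_le_sum) (auto simp: hits_def)
      finally show ?thesis .
    next
      case False
      have "g j = 0" if "j \<in> V \<inter> I i" for j
      proof -
        have "(\<Sum>r<n. if j \<in> P r then h r j else 0) = 0"
          using that False unfolding hits_def by (intro sum.neutral ballI) auto
        then show ?thesis by (simp add: g_def)
      qed
      then have "c i = 0" unfolding c_def by (intro sum.neutral) simp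
      then show ?thesis by (simp cong: if_cong)
    qed
  qed
  also have "\<dots> = (\<Sum>r<n. \<Sum>i\<in>J. (if i \<in> A r then c i else 0) + (if i \<in> S r then c i else 0))"
    by (rule sum.swap)
  also have "\<dots> = (\<Sum>r<n. (\<Sum>i\<in>A r. c i) + (\<Sum>i\<in>S r. c i))"
  proof (intro sum.cong refl)
    fix r
    have "J \<inter> A r = A r" "J \<inter> S r = S r" by (auto simp: A_def S_def)
    then show "(\<Sum>i\<in>J. (if i \<in> A r then c i else 0) + (if i \<in> S r then c i else 0))
        = (\<Sum>i\<in>A r. c i) + (\<Sum>i\<in>S r. c i)"
      using node(4) by (simp add: sum.distrib sum.inter_restrict[symmetric])
  qed
  also have "\<dots> \<le> (\<Sum>r<n. ?t (A r) + ?t (S r))"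
    using cA cS by (intro sum_mono add_mono) auto
  also have "\<dots> = (\<Sum>q<2 * n. ?t (Q q))"
    unfolding sum_pairs by (simp add: Q_def)
  also have "\<dots> \<le> 2 * ?t J"
  proof -
    have "inj_on (\<lambda>i. \<kappa> (Suc i)) J"
      using mono by (intro inj_onI) (simp add: strict_mono_eq)
    then have "(\<Sum>q<2 * n. ?t (Q q)) / 2 \<le> ?t J"
      by (intro tau_successive node(4) \<xi> QJ succ)
    then show ?thesis by simp
  qed
  finally show ?case by (simp add: c_def g_def)
qed

subsection \<open>Repeated averages\<close>

lemma sum_mono_concat:
  fixes F :: "nat \<Rightarrow> real"
  assumes "\<And>l. mm l \<le> mm (Suc l)"
  shows "(\<Sum>i=mm 0..<mm N. F i) = (\<Sum>l<N. \<Sum>i=mm l..<mm (Suc l). F i)"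
proof (induction N)
  case (Suc N)
  have "mm 0 \<le> mm N" using assms lift_Suc_mono_le by blast
  then have "(\<Sum>i=mm 0..<mm (Suc N). F i) = (\<Sum>i=mm 0..<mm N. F i) + (\<Sum>i=mm N..<mm (Suc N). F i)"
    using assms by (intro sum.atLeastLessThan_concat[symmetric])
  then show ?case using Suc by simp
qed simp

text \<open>Repeated averages: at depth \<open>D + 1\<close> one averages successive vectors of depth \<open>D\<close>. Once the
  first of them that meets a node has fixed the number of its children, the shallow part of the
  later ones is negligible.\<close>

lemma repeated_averages:
  assumes k: "strict_mono k" and "0 < \<epsilon>"
  shows "\<exists>b v. m < b \<and> (\<forall>i. 0 \<le> v i) \<and> (\<Sum>i=m..<b. v i) = 1 \<and> (1 / 2) ^ D \<le> tau k {m..<b} v \<and>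
    (\<forall>s\<le>S. \<forall>g. norming g \<longrightarrow>
      (\<Sum>i=m..<b. if (1 / 2) ^ D < g (k (i + s)) then g (k (i + s)) * v i else 0) \<le> \<epsilon>)"
  using assms(2)
proof (induction D arbitrary: m \<epsilon>)
  case 0
  let ?v = "\<lambda>i. if i = m then 1 else 0 :: real"
  have "1 \<le> tau k {m..<Suc m} ?v" using tau_member[of "{m..<Suc m}" m ?v k] by simp
  moreover have "(\<Sum>i=m..<Suc m. if (1 / 2) ^ 0 < g (k (i + s)) then g (k (i + s)) * ?v i else 0) \<le> \<epsilon>"
    if "norming g" for s and g :: "nat \<Rightarrow> real"
    using norming_le_1[OF that, of "k (m + s)"] 0 by simp
  ultimately show ?case
    by (intro exI[of _ "Suc m"] exI[of _ ?v]) auto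
next
  case (Suc D)
  \<comment> \<open>A leaf sees one coordinate, and a node may see the shallow part of one whole
    block; either costs at most \<open>1 / N\<close>, hence at most half of
    \<open>\<epsilon>\<close>.\<close>
  define N where "N = Suc (nat \<lceil>2 / \<epsilon>\<rceil>)"
  have N: "0 < N" "2 / \<epsilon> \<le> real N" unfolding N_def by (simp, linarith)
  then have N_eps: "1 / real N \<le> \<epsilon> / 2" using Suc.prems by (simp add: field_simps)
  define sh where "sh g v s b a = (\<Sum>i=a..<b. if (1 / 2) ^ D < g (k (i + s)) then g (k (i + s)) * v i else 0)"
    for g v :: "nat \<Rightarrow> real" and s b a
  \<comment> \<open>A node that meets an earlier block, at a position at most
    \<open>k (a + S)\<close>, has at most \<open>Suc (k (a + S))\<close> children, and each of them
    contributes one error; hence the denominator. All shifts \<open>s \<le> S\<close> are treated at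
    once because the shift is chosen only after the averages.\<close>
  define spec where "spec a b v \<longleftrightarrow> a < b \<and> (\<forall>i. 0 \<le> v i) \<and> (\<Sum>i=a..<b. v i) = 1 \<and>
    (1 / 2) ^ D \<le> tau k {a..<b} v \<and>
    (\<forall>s\<le>S. \<forall>g. norming g \<longrightarrow> sh g v s b a \<le> \<epsilon> / real (Suc (k (a + S))))" for a b v
  have "\<exists>b v. spec a b v" for a
    unfolding spec_def sh_def using Suc.prems by (intro Suc.IH) simp
  then obtain bb vv where bv: "\<And>a. spec a (bb a) (vv a)" by metis
  \<comment> \<open>Starting at \<open>max m N\<close> makes the \<open>N\<close> blocks admissible,
    because \<open>i \<le> k i\<close>.\<close>
  define mm where "mm l = (bb ^^ l) (max m N)" for l
  have mm0: "mm 0 = max m N" and mmS: "mm (Suc l) = bb (mm l)" for l by (simp_all add: mm_def)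
  have mm_less: "mm l < mm (Suc l)" for l using bv[of "mm l"] by (simp add: spec_def mmS)
  have mm_mono: "mm l \<le> mm l'" if "l \<le> l'" for l l'
    using that by (rule lift_Suc_mono_le[of mm, rotated]) (rule less_imp_le[OF mm_less])
  define u where "u l = vv (mm l)" for l
  define J where "J l = {mm l..<mm (Suc l)}" for l
  have u: "0 \<le> u l i" "(\<Sum>i\<in>J l. u l i) = 1" "(1 / 2) ^ D \<le> tau k (J l) (u l)" for l i
    using bv[of "mm l"] by (simp_all add: spec_def mmS u_def J_def)
  have u_sh: "(\<Sum>i\<in>J l. if (1 / 2) ^ D < g (k (i + s)) then g (k (i + s)) * u l i else 0)
      \<le> \<epsilon> / real (Suc (k (mm l + S)))" if "norming g" "s \<le> S" for g s l
    using bv[of "mm l"] that unfolding spec_def sh_def mmS u_def J_def by blast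
  have J_disj: "l = l'" if "i \<in> J l" "i \<in> J l'" for i l l'
  proof (rule ccontr)
    assume "l \<noteq> l'"
    then consider "Suc l \<le> l'" | "Suc l' \<le> l" by linarith
    then show False using that mm_mono[of "Suc l" l'] mm_mono[of "Suc l'" l] by cases (auto simp: J_def)
  qed
  define v where "v i = (\<Sum>l<N. if i \<in> J l then u l i else 0) / N" for i
  have v0: "0 \<le> v i" for i unfolding v_def by (intro divide_nonneg_nonneg sum_nonneg) (simp_all add: u)
  have v_J: "v i = u l i / N" if "i \<in> J l" "l < N" for i l
  proof -
    have "(\<Sum>l'<N. if i \<in> J l' then u l' i else 0) = (\<Sum>l'<N. if l' = l then u l i else 0)"
    proof (intro sum.cong refl)
      fix l'
      have "i \<in> J l' \<longleftrightarrow> l' = l" using J_disj[of i l' l] that(1) by blast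
      then show "(if i \<in> J l' then u l' i else 0) = (if l' = l then u l i else 0)" by simp
    qed
    then show ?thesis using that by (simp add: v_def)
  qed
  have v_low: "v i = 0" if "i < mm 0" for i
  proof -
    have "i \<notin> J l" for l using that mm_mono[of 0 l] by (auto simp: J_def)
    then show ?thesis by (simp add: v_def)
  qed
  have split: "(\<Sum>i=m..<mm N. F i) = (\<Sum>l<N. \<Sum>i\<in>J l. F i)"
    if "\<And>i. i < mm 0 \<Longrightarrow> F i = 0" for F :: "nat \<Rightarrow> real"
  proof -
    have "(\<Sum>i=m..<mm N. F i) = (\<Sum>i=mm 0..<mm N. F i)"
      using that by (intro sum.mono_neutral_right) (auto simp: mm0)
    also have "\<dots> = (\<Sum>l<N. \<Sum>i\<in>J l. F i)"
      unfolding J_def using mm_less by (intro sum_mono_concat less_imp_le)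
    finally show ?thesis .
  qed
  have J_sub: "J l \<subseteq> {m..<mm N}" if "l < N" for l
  proof
    fix i assume "i \<in> J l"
    then show "i \<in> {m..<mm N}"
      using mm_mono[of 0 l] mm_mono[of "Suc l" N] that by (simp add: J_def mm0)
  qed
  have k_ge: "i \<le> k i" for i using k by (rule strict_mono_imp_increasing)

  have "(\<Sum>i=m..<mm N. v i) = (\<Sum>l<N. \<Sum>i\<in>J l. v i)" using v_low by (rule split)
  also have "\<dots> = (\<Sum>l<N. 1 / real N)"
  proof (intro sum.cong refl)
    fix l assume "l \<in> {..<N}"
    then have "(\<Sum>i\<in>J l. v i) = (\<Sum>i\<in>J l. u l i / N)" using v_J by (intro sum.cong) auto
    then show "(\<Sum>i\<in>J l. v i) = 1 / real N" using u(2)[of l] by (simp add: sum_divide_distrib[symmetric])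
  qed
  finally have v_sum: "(\<Sum>i=m..<mm N. v i) = 1" using N by simp

  have v_tau: "(1 / 2) ^ Suc D \<le> tau k {m..<mm N} v"
  proof -
    have "(1 / 2) ^ D \<le> N * tau k (J l) v" if "l < N" for l
    proof -
      have "(1 / 2) ^ D \<le> tau k (J l) (u l)" by (rule u)
      also have "\<dots> \<le> tau k (J l) (\<lambda>i. real N * v i)"
        using u(1) v0 v_J that N(1) by (intro tau_mono) (auto simp: J_def)
      also have "\<dots> \<le> N * tau k (J l) v" using v0 by (intro tau_le_scale) auto
      finally show ?thesis .
    qed
    then have "(1 / 2) ^ D / N \<le> tau k (J l) v" if "l < N" for l
      using that N by (simp add: field_simps)
    then have "(\<Sum>l<N. (1 / 2) ^ D / real N) / 2 \<le> (\<Sum>l<N. tau k (J l) v) / 2"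
      by (intro divide_right_mono sum_mono) auto
    also have "\<dots> \<le> tau k {m..<mm N} v"
    proof (rule tau_successive)
      show "inj_on k {m..<mm N}" using k by (intro inj_onI) (simp add: strict_mono_eq)
      show "successive N (\<lambda>r. k ` J r)"
        unfolding successive_def
      proof (intro conjI allI impI ballI)
        fix r a assume "a \<in> k ` J r"
        then obtain i where "a = k i" "i \<in> J r" by auto
        then show "N \<le> Suc a" using k_ge[of i] mm_mono[of 0 r] by (simp add: J_def mm0)
      next
        fix r s a b assume "r < s" "a \<in> k ` J r" "b \<in> k ` J s"
        then show "a < b" using mm_mono[of "Suc r" s] k by (auto simp: J_def strict_mono_less)
      qed
    qed (use v0 J_sub in auto)
    finally show ?thesis using N by simp
  qed

  have v_sh: "(\<Sum>i=m..<mm N. if (1 / 2) ^ Suc D < g (k (i + s)) then g (k (i + s)) * v i else 0) \<le> \<epsilon>"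
    if g: "norming g" and s: "s \<le> S" for g s
    using g
  proof cases
    case (leaf j)
    have "(\<Sum>i=m..<mm N. if (1 / 2) ^ Suc D < g (k (i + s)) then g (k (i + s)) * v i else 0)
        \<le> 1 / real N"
    proof (cases "\<exists>i\<in>{m..<mm N}. k (i + s) = j")
      case True
      then obtain i where i: "i \<in> {m..<mm N}" "k (i + s) = j" by auto
      have "(\<Sum>i=m..<mm N. if (1 / 2) ^ Suc D < g (k (i + s)) then g (k (i + s)) * v i else 0)
          \<le> (\<Sum>q=m..<mm N. if q = i then v i else 0)"
      proof (rule sum_mono)
        fix q
        have "g (k (q + s)) = (if q = i then 1 else 0)" using i(2) k by (auto simp: leaf strict_mono_eq)
        then show "(if (1 / 2) ^ Suc D < g (k (q + s)) then g (k (q + s)) * v q else 0) \<le> (if q = i then v i else 0)"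
          using v0[of q] by auto
      qed
      also have "\<dots> = v i" using i by simp
      also have "\<dots> \<le> 1 / N"
      proof (cases "\<exists>l<N. i \<in> J l")
        case True
        then obtain l where l: "l < N" "i \<in> J l" by auto
        have "u l i \<le> (\<Sum>i\<in>J l. u l i)" using l u by (intro member_le_sum) (auto simp: J_def)
        then show ?thesis using v_J[OF l(2,1)] u(2)[of l] by (simp add: divide_right_mono)
      next
        case False
        then have "(\<Sum>l<N. if i \<in> J l then u l i else 0) = 0" by (intro sum.neutral) auto
        then show ?thesis by (simp add: v_def)
      qed
      finally show ?thesis .
    next
      case False
      then have "(\<Sum>i=m..<mm N. if (1 / 2) ^ Suc D < g (k (i + s)) then g (k (i + s)) * v i else 0) = 0"
        by (intro sum.neutral) (auto simp: leaf)
      then show ?thesis by simp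
    qed
    then show ?thesis using N_eps Suc.prems by simp
  next
    case (node n P h)
    \<comment> \<open>Halving at the node turns the threshold \<open>(1 / 2) ^ Suc D\<close> for
      \<open>g\<close> into \<open>(1 / 2) ^ D\<close> for its children, to which the estimate for
      depth \<open>D\<close> applies.\<close>
    define T where "T l = (\<Sum>i\<in>J l. if (1 / 2) ^ Suc D < g (k (i + s)) then g (k (i + s)) * u l i else 0)" for l
    define hit where "hit l \<longleftrightarrow> (\<exists>i\<in>J l. \<exists>r<n. k (i + s) \<in> P r)" for l
    have T_nohit: "T l = 0" if "\<not> hit l" for l
      unfolding T_def
    proof (intro sum.neutral ballI)
      fix i assume "i \<in> J l"
      then have "g (k (i + s)) = 0"
        using that unfolding node(1) hit_def by (auto intro!: sum.neutral)
      then show "(if (1 / 2) ^ Suc D < g (k (i + s)) then g (k (i + s)) * u l i else 0) = 0" by simp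
    qed
    have T_le_1: "T l \<le> 1" for l
    proof -
      have "T l \<le> (\<Sum>i\<in>J l. u l i)"
        unfolding T_def using u(1) norming_bounds[OF g]
        by (intro sum_mono) (auto intro: mult_left_le_one_le)
      then show ?thesis using u(2) by simp
    qed
    have T_later: "T l \<le> \<epsilon> / 2" if "hit l0" "l0 < l" for l0 l
    proof -
      obtain i r where i: "i \<in> J l0" "r < n" "k (i + s) \<in> P r" using \<open>hit l0\<close> unfolding hit_def by blast
      have "n \<le> Suc (k (i + s))" by (rule successive_count[OF node(2) i(2,3)])
      also have "k (i + s) \<le> k (mm l + S)"
        using i(1) s mm_mono[of "Suc l0" l] that(2) k by (simp add: strict_mono_less_eq J_def)
      finally have n: "n \<le> Suc (k (mm l + S))" by simp
      let ?h = "\<lambda>r i. if (1 / 2) ^ D < h r (k (i + s)) then h r (k (i + s)) * u l i else 0"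
      have h0: "0 \<le> ?h r i" if "r < n" for r i using norming_nonneg[OF node(3)[OF that]] u(1) by simp
      have "T l \<le> (\<Sum>i\<in>J l. (\<Sum>r<n. ?h r i) / 2)"
        unfolding T_def
      proof (rule sum_mono)
        fix i
        show "(if (1 / 2) ^ Suc D < g (k (i + s)) then g (k (i + s)) * u l i else 0) \<le> (\<Sum>r<n. ?h r i) / 2"
        proof (cases "\<exists>r<n. k (i + s) \<in> P r")
          case True
          then obtain r where r: "r < n" "k (i + s) \<in> P r" by auto
          have "g (k (i + s)) = h r (k (i + s)) / 2"
            unfolding node(1) using sum_successive[OF node(2) r, of "\<lambda>r. h r (k (i + s))"] by simp
          then have "(if (1 / 2) ^ Suc D < g (k (i + s)) then g (k (i + s)) * u l i else 0) = ?h r i / 2"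
            by simp
          also have "\<dots> \<le> (\<Sum>r<n. ?h r i) / 2"
            using r h0 by (intro divide_right_mono member_le_sum) auto
          finally show ?thesis .
        next
          case False
          then have "g (k (i + s)) = 0" unfolding node(1) by (auto intro!: sum.neutral)
          moreover have "0 \<le> (\<Sum>r<n. ?h r i)" using h0 by (intro sum_nonneg) blast
          ultimately show ?thesis by simp
        qed
      qed
      also have "\<dots> = (\<Sum>r<n. \<Sum>i\<in>J l. ?h r i) / 2"
        unfolding sum_divide_distrib[symmetric] by (subst sum.swap) (rule refl)
      also have "\<dots> \<le> (\<Sum>r<n. \<epsilon> / real (Suc (k (mm l + S)))) / 2"
        using u_sh[OF node(3) s] by (intro divide_right_mono sum_mono) auto
      also have "\<dots> = \<epsilon> * (real n / real (Suc (k (mm l + S)))) / 2" by simp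
      also have "\<dots> \<le> \<epsilon> * 1 / 2"
        using n Suc.prems by (intro divide_right_mono mult_left_mono) (simp_all add: divide_le_eq_1)
      finally show ?thesis by simp
    qed
    have T_sum: "(\<Sum>l<N. T l) \<le> 1 + N * (\<epsilon> / 2)"
    proof (cases "\<exists>l. hit l")
      case True
      define l0 where "l0 = (LEAST l. hit l)"
      have l0: "hit l0" "\<And>l. hit l \<Longrightarrow> l0 \<le> l"
        using True unfolding l0_def by (auto intro: LeastI Least_le)
      have "T l \<le> (if l = l0 then 1 else 0) + \<epsilon> / 2" for l
      proof -
        consider "l = l0" | "l0 < l" | "\<not> hit l" using l0(2)[of l] by linarith
        then show ?thesis
          using T_le_1[of l] T_later[OF l0(1), of l] T_nohit[of l] Suc.prems by cases auto
      qed
      then have "(\<Sum>l<N. T l) \<le> (\<Sum>l<N. (if l = l0 then 1 else 0) + \<epsilon> / 2)" by (rule sum_mono)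
      also have "\<dots> \<le> 1 + N * (\<epsilon> / 2)" by (simp add: sum.distrib)
      finally show ?thesis .
    next
      case False
      then have "(\<Sum>l<N. T l) = 0" using T_nohit by simp
      then show ?thesis using Suc.prems by simp
    qed
    have "(\<Sum>i=m..<mm N. if (1 / 2) ^ Suc D < g (k (i + s)) then g (k (i + s)) * v i else 0)
        = (\<Sum>l<N. \<Sum>i\<in>J l. if (1 / 2) ^ Suc D < g (k (i + s)) then g (k (i + s)) * v i else 0)"
      using v_low by (intro split) simp
    also have "\<dots> = (\<Sum>l<N. T l / N)"
      unfolding T_def sum_divide_distrib using v_J by (intro sum.cong refl) auto
    also have "\<dots> \<le> (1 + N * (\<epsilon> / 2)) / N"
      unfolding sum_divide_distrib[symmetric] using T_sum by (intro divide_right_mono) auto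
    also have "\<dots> \<le> \<epsilon>" using N N_eps by (simp add: add_divide_distrib)
    finally show ?thesis .
  qed
  have "m < mm N"
    using mm_less[of 0] mm_mono[of "Suc 0" N] N(1) by (simp add: mm0)
  then show ?case using v0 v_sum v_tau v_sh by blast
qed

subsection \<open>Tsirelson's norm as a supremum over norming functionals\<close>

lemma restrict_seq_restrict_seq: "restrict_seq A (restrict_seq B x) = restrict_seq (A \<inter> B) x"
  by (auto simp: restrict_seq_def)

lemma successive_subset:
  assumes "successive n P" "\<And>r. r < n \<Longrightarrow> Q r \<subseteq> P r"
  shows "successive n Q"
  unfolding successive_def
proof (intro conjI allI impI ballI)
  fix r a assume r: "r < n" "a \<in> Q r"
  then show "n \<le> Suc a" using assms(2)[OF r(1)] by (intro successive_count[OF assms(1) r(1)]) blast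
next
  fix r s a b assume r: "r < n" "s < n" "r < s" "a \<in> Q r" "b \<in> Q s"
  have "a \<in> P r" "b \<in> P s" using r(4,5) assms(2)[OF r(1)] assms(2)[OF r(2)] by blast+
  then show "a < b" by (rule successive_less[OF assms(1) r(3,2)])
qed

lemma successive_admissible:
  assumes "admissible As"
  shows "successive (length As) (\<lambda>r. As ! r)"
  unfolding successive_def
proof (intro conjI allI impI ballI)
  have fin: "finite (As ! r)" "As ! r \<noteq> {}" if "r < length As" for r
    using assms that unfolding admissible_def by (meson nth_mem)+
  have le: "length As \<le> Suc (Min (As ! 0))"
    using assms unfolding admissible_def by (metis hd_conv_nth)
  have Max_less: "Max (As ! r) < Min (As ! s)" if "r < s" "s < length As" for r s
    using assms that unfolding admissible_def sorted_wrt_iff_nth_less by blast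
  show less: "a < b" if "r < s" "r < length As" "s < length As" "a \<in> As ! r" "b \<in> As ! s" for r s a b
  proof -
    have "a \<le> Max (As ! r)" "Min (As ! s) \<le> b" using fin that by auto
    then show ?thesis using Max_less[OF that(1,3)] by linarith
  qed
  show "length As \<le> Suc a" if "r < length As" "a \<in> As ! r" for r a
  proof -
    have "Min (As ! 0) \<le> a"
    proof (cases "r = 0")
      case True
      then show ?thesis using fin[of 0] that by simp
    next
      case False
      have "0 < length As" using that by linarith
      then have "Min (As ! 0) \<in> As ! 0" using fin[of 0] by (intro Min_in)
      then show ?thesis using less[of 0 r] False that by force
    qed
    then show ?thesis using le by linarith
  qed
qed

text \<open>Admissible lists consist of finite nonempty sets, whereas a node may have infinite or
  empty ones. Cutting down to \<open>V\<close> settles the first point and filtering the second;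
  fewer sets only relax the bound on their number.\<close>

lemma admissible_filter_successive:
  assumes "successive n P" "finite V"
    and As: "As = filter (\<lambda>A. A \<noteq> {}) (map (\<lambda>r. P r \<inter> V) [0..<n])" and "As \<noteq> []"
  shows "admissible As"
proof -
  have *: "finite A \<and> A \<noteq> {} \<and> (\<forall>a\<in>A. n \<le> Suc a)" if "A \<in> set As" for A
  proof -
    have A: "A \<in> (\<lambda>r. P r \<inter> V) ` {0..<n}" "A \<noteq> {}" using \<open>A \<in> set As\<close> unfolding As by auto
    obtain r where r: "A = P r \<inter> V" "r \<in> {0..<n}" using A(1) by (rule imageE)
    then have "n \<le> Suc a" if "a \<in> A" for a
      using that by (intro successive_count[OF assms(1), of r]) simp_all
    then show ?thesis using A(2) r(1) assms(2) by simp
  qed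
  have "sorted_wrt (\<lambda>A A'. \<forall>a\<in>A. \<forall>b\<in>A'. a < b) (map (\<lambda>r. P r \<inter> V) [0..<n])"
    unfolding sorted_wrt_iff_nth_less
  proof (intro allI impI)
    fix i j assume "i < j" "j < length (map (\<lambda>r. P r \<inter> V) [0..<n])"
    then show "\<forall>a\<in>map (\<lambda>r. P r \<inter> V) [0..<n] ! i. \<forall>b\<in>map (\<lambda>r. P r \<inter> V) [0..<n] ! j. a < b"
      using successive_less[OF assms(1), of i j] by simp
  qed
  then have "sorted_wrt (\<lambda>A A'. \<forall>a\<in>A. \<forall>b\<in>A'. a < b) As"
    unfolding As by (rule sorted_wrt_filter)
  then have sorted: "sorted_wrt (\<lambda>A A'. Max A < Min A') As"
  proof (rule sorted_wrt_mono_rel[rotated])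
    fix A A' assume "A \<in> set As" "A' \<in> set As" "\<forall>a\<in>A. \<forall>b\<in>A'. a < b"
    then show "Max A < Min A'" using *[of A] *[of A'] by (meson Max_in Min_in)
  qed
  have "length As \<le> n" unfolding As using length_filter_le[of _ "map (\<lambda>r. P r \<inter> V) [0..<n]"] by simp
  moreover have "n \<le> Suc (Min (hd As))"
    using *[of "hd As"] \<open>As \<noteq> []\<close> Min_in[of "hd As"] by auto
  ultimately show ?thesis
    unfolding admissible_def using * sorted \<open>As \<noteq> []\<close> by auto
qed

text \<open>The passage from one step to the next rests on \<open>tau_successive\<close>. The bound
  has a second use: the supremum over admissible lists is taken over a set bounded above, as
  \<open>cSUP_upper\<close> requires.\<close>

lemma admissible_sum_le_tau:
  assumes step: "\<And>V. finite V \<Longrightarrow> tsirelson_step n (restrict_seq V x) \<le> tau_id V (\<lambda>j. cmod (x j))"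
    and V: "finite V" and As: "admissible As"
  shows "(\<Sum>A\<leftarrow>As. tsirelson_step n (restrict_seq A (restrict_seq V x))) \<le> 2 * tau_id V (\<lambda>j. cmod (x j))"
proof -
  have "(\<Sum>A\<leftarrow>As. tsirelson_step n (restrict_seq A (restrict_seq V x)))
      = (\<Sum>r<length As. tsirelson_step n (restrict_seq (As ! r \<inter> V) x))"
    by (simp add: sum_list_sum_nth atLeast0LessThan restrict_seq_restrict_seq)
  also have "\<dots> \<le> (\<Sum>r<length As. tau_id (As ! r \<inter> V) (\<lambda>j. cmod (x j)))"
    by (intro sum_mono step) (simp add: V)
  also have "\<dots> \<le> 2 * tau_id V (\<lambda>j. cmod (x j))"
  proof -
    have "successive (length As) (\<lambda>r. (\<lambda>j. j) ` (As ! r \<inter> V))"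
      by (rule successive_subset[OF successive_admissible[OF As]]) simp
    then have "(\<Sum>r<length As. tau_id (As ! r \<inter> V) (\<lambda>j. cmod (x j))) / 2 \<le> tau_id V (\<lambda>j. cmod (x j))"
      using V by (intro tau_successive) auto
    then show ?thesis by simp
  qed
  finally show ?thesis .
qed

lemma tsirelson_step_le_tau:
  "finite V \<Longrightarrow> tsirelson_step n (restrict_seq V x) \<le> tau_id V (\<lambda>j. cmod (x j))"
proof (induction n arbitrary: V)
  case 0
  show ?case
    unfolding tsirelson_step.simps
  proof (rule cSUP_least)
    fix j
    show "cmod (restrict_seq V x j) \<le> tau_id V (\<lambda>j. cmod (x j))"
      using tau_member[of V j "\<lambda>j. cmod (x j)"] tau_nonneg[of "\<lambda>j. cmod (x j)"] 0
      by (auto simp: restrict_seq_def)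
  qed simp
next
  case (Suc n)
  \<comment> \<open>A witness of nonemptiness for \<open>cSUP_least\<close>.\<close>
  have "admissible [{0}]" by (simp add: admissible_def)
  then have "(SUP As\<in>{As. admissible As}. \<Sum>A\<leftarrow>As. tsirelson_step n (restrict_seq A (restrict_seq V x)))
      \<le> 2 * tau_id V (\<lambda>j. cmod (x j))"
    using admissible_sum_le_tau[OF Suc.IH Suc.prems] by (intro cSUP_least) auto
  then show ?case using Suc.IH[OF Suc.prems] by simp
qed

lemma tsirelson_step_mono: "m \<le> n \<Longrightarrow> tsirelson_step m x \<le> tsirelson_step n x"
  by (rule lift_Suc_mono_le[of "\<lambda>n. tsirelson_step n x", rotated]) simp_all

lemma norm_le_tsirelson_step:
  assumes "finite V"
  shows "cmod (restrict_seq V x j) \<le> tsirelson_step n (restrict_seq V x)"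
proof -
  have "finite (range (\<lambda>j. cmod (restrict_seq V x j)))"
  proof (rule finite_subset)
    show "range (\<lambda>j. cmod (restrict_seq V x j)) \<subseteq> insert 0 ((\<lambda>j. cmod (x j)) ` V)"
      by (auto simp: restrict_seq_def)
  qed (use assms in auto)
  then have "cmod (restrict_seq V x j) \<le> tsirelson_step 0 (restrict_seq V x)"
    unfolding tsirelson_step.simps by (intro cSUP_upper bdd_above_finite) auto
  also have "\<dots> \<le> tsirelson_step n (restrict_seq V x)" by (rule tsirelson_step_mono) simp
  finally show ?thesis .
qed

text \<open>A functional is a finite tree, so finitely many steps reach its value: one more than the
  largest number needed by a child. Monotonicity of the steps lets all children share that
  number.\<close>

lemma norming_le_tsirelson_step:
  assumes "norming g" "finite V"
  shows "\<exists>m. (\<Sum>j\<in>V. g j * cmod (x j)) \<le> tsirelson_step m (restrict_seq V x)"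
  using assms
proof (induction arbitrary: V rule: norming.induct)
  case (leaf i)
  have "(\<Sum>j\<in>V. (if j = i then 1 else 0) * cmod (x j)) = (\<Sum>j\<in>V. if j = i then cmod (x j) else 0)"
    by (intro sum.cong) auto
  also have "\<dots> = cmod (restrict_seq V x i)" using leaf by (simp add: restrict_seq_def)
  also have "\<dots> \<le> tsirelson_step 0 (restrict_seq V x)" by (rule norm_le_tsirelson_step[OF leaf])
  finally show ?case by blast
next
  case (node n P h)
  let ?F = "\<lambda>m A. tsirelson_step m (restrict_seq A (restrict_seq V x))"
  have "\<exists>m. (\<Sum>j\<in>P r \<inter> V. h r j * cmod (x j)) \<le> ?F m (P r \<inter> V)" if "r < n" for r
    using node(3)[OF that, of "P r \<inter> V"] node(4) by (simp add: restrict_seq_restrict_seq)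
  then obtain mr where mr: "\<And>r. r < n \<Longrightarrow> (\<Sum>j\<in>P r \<inter> V. h r j * cmod (x j)) \<le> ?F (mr r) (P r \<inter> V)"
    by metis
  \<comment> \<open>\<open>insert 0\<close> keeps the maximum meaningful for a node without
    children.\<close>
  define m where "m = Max (insert 0 (mr ` {..<n}))"
  have m: "(\<Sum>j\<in>P r \<inter> V. h r j * cmod (x j)) \<le> ?F m (P r \<inter> V)" if "r < n" for r
  proof -
    have "mr r \<le> m" unfolding m_def using that by (intro Max_ge) auto
    then show ?thesis using mr[OF that] tsirelson_step_mono order_trans by blast
  qed
  define As where "As = filter (\<lambda>A. A \<noteq> {}) (map (\<lambda>r. P r \<inter> V) [0..<n])"
  have "(\<Sum>j\<in>V. (\<Sum>r<n. if j \<in> P r then h r j else 0) / 2 * cmod (x j))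
      = (\<Sum>j\<in>V. (\<Sum>r<n. if j \<in> (\<lambda>j. j) ` (P r \<inter> V) then h r j else 0) / 2 * cmod (x j))"
    by (intro sum.cong) auto
  also have "\<dots> = (\<Sum>r<n. \<Sum>j\<in>P r \<inter> V. h r j * cmod (x j)) / 2"
    using node(4) by (intro sum_node[where \<kappa>="\<lambda>j. j"]) auto
  also have "(\<Sum>r<n. \<Sum>j\<in>P r \<inter> V. h r j * cmod (x j)) \<le> (\<Sum>r<n. if P r \<inter> V \<noteq> {} then ?F m (P r \<inter> V) else 0)"
    using m by (intro sum_mono) auto
  also have "\<dots> = (\<Sum>A\<leftarrow>As. ?F m A)"
    unfolding As_def sum_list_map_filter'
    by (simp add: interv_sum_list_conv_sum_set_nat atLeast0LessThan comp_def)
  finally have le: "(\<Sum>j\<in>V. (\<Sum>r<n. if j \<in> P r then h r j else 0) / 2 * cmod (x j))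
      \<le> (\<Sum>A\<leftarrow>As. ?F m A) / 2" by simp
  show ?case
  proof (cases "As = []")
    case True
    have "0 \<le> tsirelson_step 0 (restrict_seq V x)"
      using norm_le_tsirelson_step[OF node(4)] norm_ge_zero order_trans by blast
    then show ?thesis using le True by (intro exI[of _ 0]) simp
  next
    case False
    have "(\<Sum>A\<leftarrow>As. ?F m A) \<le> (SUP As\<in>{As. admissible As}. \<Sum>A\<leftarrow>As. ?F m A)"
    proof (rule cSUP_upper)
      show "As \<in> {As. admissible As}"
        using admissible_filter_successive[OF node(1,4) As_def False] by simp
      show "bdd_above ((\<lambda>As. \<Sum>A\<leftarrow>As. ?F m A) ` {As. admissible As})"
        using admissible_sum_le_tau[OF tsirelson_step_le_tau node(4)]
        by (intro bdd_aboveI2[where M="2 * tau_id V (\<lambda>j. cmod (x j))"]) auto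
    qed
    then have "(\<Sum>A\<leftarrow>As. ?F m A) / 2 \<le> tsirelson_step (Suc m) (restrict_seq V x)" by simp
    then show ?thesis using le order_trans by blast
  qed
qed

lemma tsirelson_norm_restrict_seq:
  assumes "finite V"
  shows "tsirelson_norm (restrict_seq V x) = tau_id V (\<lambda>j. cmod (x j))"
proof -
  have "(\<lambda>n. tsirelson_step n (restrict_seq V x)) \<longlonglongrightarrow> tau_id V (\<lambda>j. cmod (x j))"
  proof (rule increasing_tendsto)
    show "\<forall>\<^sub>F n in sequentially. tsirelson_step n (restrict_seq V x) \<le> tau_id V (\<lambda>j. cmod (x j))"
      using tsirelson_step_le_tau[OF assms] by simp
  next
    fix y assume "y < tau_id V (\<lambda>j. cmod (x j))"
    then obtain g where g: "norming g" "y < (\<Sum>j\<in>V. g j * cmod (x j))" by (rule tau_approx)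
    obtain m where "(\<Sum>j\<in>V. g j * cmod (x j)) \<le> tsirelson_step m (restrict_seq V x)"
      using norming_le_tsirelson_step[OF g(1) assms] by blast
    then have "y < tsirelson_step n (restrict_seq V x)" if "m \<le> n" for n
      using tsirelson_step_mono[OF that, of "restrict_seq V x"] g(2) by linarith
    then show "\<forall>\<^sub>F n in sequentially. y < tsirelson_step n (restrict_seq V x)"
      by (rule eventually_sequentiallyI)
  qed
  then show ?thesis unfolding tsirelson_norm_def by (rule limI)
qed

subsection \<open>Analytic functions on the strip\<close>

lemma closed_strip: "closed strip"
  unfolding strip_def by (intro closed_Collect_conj closed_Collect_le continuous_intros)

lemma interior_strip: "interior strip = {z. 0 < Re z \<and> Re z < 1}"
proof -
  have "strip = {z. 1 \<bullet> z \<ge> 0} \<inter> {z. 1 \<bullet> z \<le> 1}" by (auto simp: strip_def inner_complex_def)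
  then have "interior strip = interior {z. 1 \<bullet> z \<ge> 0} \<inter> interior {z. 1 \<bullet> z \<le> 1}"
    using interior_Int by metis
  moreover have "interior {z::complex. 1 \<bullet> z \<ge> 0} = {z. 1 \<bullet> z > 0}" by (rule interior_halfspace_ge) simp
  moreover have "interior {z::complex. 1 \<bullet> z \<le> 1} = {z. 1 \<bullet> z < 1}" by (rule interior_halfspace_le) simp
  ultimately have "interior strip = {z. 1 \<bullet> z > 0} \<inter> {z. 1 \<bullet> z < 1}" by metis
  then show ?thesis by (auto simp: inner_complex_def)
qed

lemma half_in_interior_strip: "1 / 2 \<in> interior strip"
  by (simp add: interior_strip)

definition strip_function :: "(complex \<Rightarrow> complex) \<Rightarrow> bool" where
  "strip_function f \<longleftrightarrow>
    bounded (f ` strip) \<and> continuous_on strip f \<and> f holomorphic_on interior strip"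

lemma strip_function_bound:
  assumes "strip_function f"
  obtains K where "0 < K" "\<And>z. z \<in> strip \<Longrightarrow> cmod (f z) \<le> K"
  using assms unfolding strip_function_def bounded_pos by auto

lemma strip_functionI:
  assumes "\<And>z. z \<in> strip \<Longrightarrow> cmod (f z) \<le> K" "continuous_on strip f" "f holomorphic_on interior strip"
  shows "strip_function f"
  using assms unfolding strip_function_def bounded_iff by blast

lemma strip_function_const: "strip_function (\<lambda>z. c)"
  by (rule strip_functionI[where K="cmod c"]) auto

lemma strip_function_add:
  assumes "strip_function f" "strip_function g"
  shows "strip_function (\<lambda>z. f z + g z)"
proof -
  obtain K L where "\<And>z. z \<in> strip \<Longrightarrow> cmod (f z) \<le> K" "\<And>z. z \<in> strip \<Longrightarrow> cmod (g z) \<le> L"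
    using assms strip_function_bound by metis
  then show ?thesis using assms unfolding strip_function_def
    by (intro conjI strip_functionI[where K="K + L", unfolded strip_function_def, THEN conjunct1])
      (auto intro!: continuous_intros holomorphic_intros intro: norm_triangle_mono)
qed

lemma strip_function_mult:
  assumes "strip_function f" "strip_function g"
  shows "strip_function (\<lambda>z. f z * g z)"
proof -
  obtain K L where "\<And>z. z \<in> strip \<Longrightarrow> cmod (f z) \<le> K" "\<And>z. z \<in> strip \<Longrightarrow> cmod (g z) \<le> L" "0 < K"
    using assms strip_function_bound by metis
  then show ?thesis using assms unfolding strip_function_def
    by (intro conjI strip_functionI[where K="K * L", unfolded strip_function_def, THEN conjunct1])
      (auto intro!: continuous_intros holomorphic_intros mult_mono simp: norm_mult)
qed

lemma strip_function_sum:
  "(\<And>i. i \<in> J \<Longrightarrow> strip_function (f i)) \<Longrightarrow> strip_function (\<lambda>z. \<Sum>i\<in>J. f i z)"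
  by (induction J rule: infinite_finite_induct) (auto intro: strip_function_const strip_function_add)

text \<open>\<open>0 powr z\<close> is \<open>0\<close> for every \<open>z\<close>, so a vanishing
  coefficient gives the zero function, also on the line \<open>Re z = 0\<close>; otherwise the
  modulus is \<open>g\<close> to the power \<open>Re z\<close>.\<close>

lemma strip_function_powr:
  assumes "0 \<le> g" "g \<le> 1"
  shows "strip_function (\<lambda>z. of_real g powr z)"
proof (cases "g = 0")
  case True
  then show ?thesis using strip_function_const[of 0] by simp
next
  case False
  have *: "continuous_on S (\<lambda>z. of_real g powr z)" "(\<lambda>z. of_real g powr z) holomorphic_on S" for S :: "complex set"
    using False by (auto intro!: holomorphic_on_imp_continuous_on holomorphic_intros)
  show ?thesis
  proof (rule strip_functionI[where K=1])
    fix z assume "z \<in> strip"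
    then have "0 \<le> Re z" by (simp add: strip_def)
    then show "cmod (of_real g powr z) \<le> 1"
      using False assms by (simp add: norm_powr_real_powr powr_le1)
  qed (use * in auto)
qed

lemma reflection_in_strip: "z \<in> strip \<Longrightarrow> 1 - cnj z \<in> strip"
  by (auto simp: strip_def)

text \<open>The map from \<open>z\<close> to \<open>1 - cnj z\<close> reflects the strip in the line
  \<open>Re z = 1 / 2\<close>: it swaps the boundary lines, keeps the height and fixes
  \<open>1 / 2\<close>. The outer conjugation restores analyticity.\<close>

lemma strip_function_reflection:
  assumes "strip_function f"
  shows "strip_function (\<lambda>z. cnj (f (1 - cnj z)))"
proof -
  obtain K where K: "\<And>z. z \<in> strip \<Longrightarrow> cmod (f z) \<le> K" using assms strip_function_bound by metis
  have hol: "(\<lambda>z. f (1 - z)) holomorphic_on interior strip"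
  proof -
    have "f \<circ> (\<lambda>z. 1 - z) holomorphic_on interior strip"
      by (rule holomorphic_on_compose_gen[where t="interior strip"])
        (use assms in \<open>auto simp: strip_function_def interior_strip intro!: holomorphic_intros\<close>)
    then show ?thesis by (simp add: comp_def)
  qed
  have "cnj ` interior strip = interior strip"
    by (auto simp: interior_strip image_cnj_conv_vimage_cnj)
  then have "cnj \<circ> (\<lambda>z. f (1 - z)) \<circ> cnj holomorphic_on interior strip"
    using hol by (intro holomorphic_on_compose_cnj_cnj) auto
  then have "(\<lambda>z. cnj (f (1 - cnj z))) holomorphic_on interior strip" by (simp add: comp_def)
  moreover have "continuous_on strip (\<lambda>z. cnj (f (1 - cnj z)))"
    using assms by (intro continuous_intros continuous_on_compose2[where f="\<lambda>z. 1 - cnj z" and g=f])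
      (auto simp: strip_function_def reflection_in_strip)
  ultimately show ?thesis
    using K reflection_in_strip by (intro strip_functionI[where K=K]) auto
qed

text \<open>The function is damped by a Gaussian factor, the maximum principle is applied on a
  rectangle so high that its horizontal sides contribute at most \<open>d\<close>, and then
  \<open>e\<close> and \<open>d\<close> tend to \<open>0\<close>.\<close>

lemma three_lines:
  assumes f: "strip_function f"
    and left: "\<And>t. cmod (f (\<i> * of_real t)) \<le> M" and right: "\<And>t. cmod (f (1 + \<i> * of_real t)) \<le> M"
  shows "cmod (f (1 / 2)) \<le> M"
proof -
  obtain K where K: "0 < K" "\<And>z. z \<in> strip \<Longrightarrow> cmod (f z) \<le> K" using f strip_function_bound by metis
  have M0: "0 \<le> M" using left[of 0] norm_ge_zero order_trans by blast
  have side: "cmod (f z) \<le> M" if "Re z = 0 \<or> Re z = 1" for z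
    using that left[of "Im z"] right[of "Im z"] complex_eq[of z] by auto
  have approx: "cmod (f (1 / 2)) * exp (- (3 / 4) * e) \<le> M + d" if e: "0 < e" and d: "0 < d" for e d :: real
  proof -
    \<comment> \<open>On the strip the real part of \<open>z\<^sup>2 - 1\<close> is at most
      \<open>- (Im z)\<^sup>2\<close>, so the new factor has modulus at most \<open>1\<close> and
      decays vertically; at \<open>1 / 2\<close> it is \<open>exp (- (3 / 4) * e)\<close>.\<close>
    define g where "g z = f z * exp (of_real e * (z\<^sup>2 - 1))" for z
    have norm_g: "cmod (g z) = cmod (f z) * exp (e * ((Re z)\<^sup>2 - 1 - (Im z)\<^sup>2))" for z
      by (simp add: g_def norm_mult power2_eq_square algebra_simps)
    obtain R where R: "0 < R" "K * exp (- e * R\<^sup>2) \<le> d"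
    proof -
      have "((\<lambda>R. K * exp (- e * R\<^sup>2)) \<longlongrightarrow> 0) at_top" using e by real_asymp
      then have "eventually (\<lambda>R. K * exp (- e * R\<^sup>2) < d) at_top" using d by (simp add: order_tendsto_iff)
      then have "eventually (\<lambda>R. 0 < R \<and> K * exp (- e * R\<^sup>2) < d) at_top"
        using eventually_gt_at_top[of 0] by eventually_elim auto
      then show thesis using that less_imp_le by (metis (mono_tags, lifting) eventually_happens trivial_limit_at_top_linorder)
    qed
    define S where "S = cbox (Complex 0 (- R)) (Complex 1 R)"
    have S: "z \<in> S \<longleftrightarrow> 0 \<le> Re z \<and> Re z \<le> 1 \<and> - R \<le> Im z \<and> Im z \<le> R" for z
      by (auto simp: S_def in_cbox_complex_iff)
    have "S \<subseteq> strip" by (auto simp: S strip_def)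
    have "cmod (g (1 / 2)) \<le> M + d"
    proof (rule maximum_modulus_frontier[where S=S and f=g and \<xi>="1 / 2"])
      show "g holomorphic_on interior S"
        unfolding g_def using f interior_mono[OF \<open>S \<subseteq> strip\<close>]
        by (auto simp: strip_function_def intro!: holomorphic_intros intro: holomorphic_on_subset)
      have "continuous_on S f"
        using f \<open>S \<subseteq> strip\<close> by (auto simp: strip_function_def intro: continuous_on_subset)
      then show "continuous_on (closure S) g"
        unfolding g_def S_def by (auto intro!: continuous_intros)
      show "bounded S" by (simp add: S_def)
      show "1 / 2 \<in> S" using R(1) by (simp add: S)
    next
      fix z assume "z \<in> frontier S"
      then have z: "z \<in> S" "z \<notin> interior S"
        unfolding S_def by (auto simp: frontier_def)
      have "interior S = {z. 0 < Re z \<and> Re z < 1 \<and> - R < Im z \<and> Im z < R}"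
        unfolding S_def interior_cbox by (auto simp: in_box_complex_iff)
      then have "\<not> (0 < Re z \<and> Re z < 1 \<and> - R < Im z \<and> Im z < R)" using z(2) by simp
      moreover have "0 \<le> Re z \<and> Re z \<le> 1 \<and> - R \<le> Im z \<and> Im z \<le> R" using z(1) S by simp
      ultimately have "(Re z = 0 \<or> Re z = 1) \<or> Im z = R \<or> Im z = - R" by linarith
      then consider "Re z = 0 \<or> Re z = 1" | "(Im z)\<^sup>2 = R\<^sup>2" by force
      then show "cmod (g z) \<le> M + d"
      proof cases
        case 1
        then have "(Re z)\<^sup>2 \<le> 1" by auto
        then have "(Re z)\<^sup>2 - 1 - (Im z)\<^sup>2 \<le> 0" using zero_le_power2[of "Im z"] by linarith
        then have "e * ((Re z)\<^sup>2 - 1 - (Im z)\<^sup>2) \<le> 0" using e by (simp add: mult_le_0_iff)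
        then have "cmod (g z) \<le> M * 1"
          unfolding norm_g using side[OF 1] M0 by (intro mult_mono) auto
        then show ?thesis using d by simp
      next
        case 2
        have "(Re z)\<^sup>2 \<le> 1" using z by (simp add: S power_le_one)
        then have "e * ((Re z)\<^sup>2 - 1 - (Im z)\<^sup>2) \<le> - e * R\<^sup>2"
          using e 2 by (simp add: algebra_simps)
        then have "cmod (g z) \<le> K * exp (- e * R\<^sup>2)"
          unfolding norm_g using K z \<open>S \<subseteq> strip\<close> by (intro mult_mono) auto
        then show ?thesis using R M0 by simp
      qed
    qed
    then show ?thesis by (simp add: norm_g power2_eq_square algebra_simps)
  qed
  have "((\<lambda>e. cmod (f (1 / 2)) * exp (- (3 / 4) * e)) \<longlongrightarrow> cmod (f (1 / 2)) * exp (- (3 / 4) * 0)) (at_right 0)"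
    by (intro tendsto_intros)
  then have "((\<lambda>e. cmod (f (1 / 2)) * exp (- (3 / 4) * e)) \<longlongrightarrow> cmod (f (1 / 2))) (at_right 0)" by simp
  then have "cmod (f (1 / 2)) \<le> M + d" if "0 < d" for d
    by (rule tendsto_upperbound) (use approx that in \<open>auto simp: eventually_at_right_less intro: eventually_mono[OF eventually_at_right_less]\<close>)
  then show ?thesis by (rule field_le_epsilon)
qed

text \<open>The singularity at \<open>1 / 2\<close> is removable. Boundedness comes from compactness
  near \<open>1 / 2\<close> and from \<open>1 < cmod (z - 1 / 2)\<close> elsewhere.\<close>

lemma strip_function_divided_difference:
  assumes f: "strip_function f"
  shows "strip_function (\<lambda>z. if z = 1 / 2 then deriv f (1 / 2) else (f z - f (1 / 2)) / (z - 1 / 2))"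
    (is "strip_function ?q")
proof -
  obtain K where K: "0 < K" "\<And>z. z \<in> strip \<Longrightarrow> cmod (f z) \<le> K" using f strip_function_bound by metis
  have hol: "?q holomorphic_on interior strip"
    using f by (intro pole_lemma_open) (auto simp: strip_function_def)
  have cont: "continuous_on strip ?q"
  proof -
    have "continuous_on (strip - {1 / 2}) (\<lambda>z. (f z - f (1 / 2)) / (z - 1 / 2))"
      using f by (intro continuous_intros) (auto simp: strip_function_def intro: continuous_on_subset)
    then have off: "continuous_on (strip - {1 / 2}) ?q"
      by (rule continuous_on_eq) auto
    have "continuous (at z within strip) ?q" if z: "z \<in> strip" for z
    proof (cases "z = 1 / 2")
      case True
      then have "isCont ?q z"
        using holomorphic_on_imp_continuous_on[OF hol] half_in_interior_strip
        by (simp only: continuous_on_eq_continuous_at[OF open_interior])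
      then show ?thesis by (rule continuous_at_imp_continuous_at_within)
    next
      case False
      then have "continuous (at z within strip - {1 / 2}) ?q"
        using off z by (simp add: continuous_on_eq_continuous_within)
      moreover have "at z within strip - {1 / 2} = at z within strip"
        using False by (intro at_within_nhd[of z "- {1 / 2}"]) auto
      ultimately show ?thesis by simp
    qed
    then show ?thesis by (simp add: continuous_on_eq_continuous_within)
  qed
  have "compact (strip \<inter> cball (1 / 2) 1)" using closed_strip by (simp add: closed_Int_compact)
  then have "compact (?q ` (strip \<inter> cball (1 / 2) 1))"
    using cont by (intro compact_continuous_image) (auto intro: continuous_on_subset)
  then obtain L where L: "\<And>z. z \<in> strip \<inter> cball (1 / 2) 1 \<Longrightarrow> cmod (?q z) \<le> L"
    using compact_imp_bounded bounded_iff by (metis (no_types, lifting) imageI)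
  have "cmod (?q z) \<le> max L (2 * K)" if z: "z \<in> strip" for z
  proof (cases "z \<in> cball (1 / 2) 1")
    case True
    then have "cmod (?q z) \<le> L" using z by (intro L) simp
    then show ?thesis by (rule max.coboundedI1)
  next
    case False
    then have far: "1 < cmod (z - 1 / 2)" by (simp add: dist_norm norm_minus_commute)
    have "cmod (f z - f (1 / 2)) \<le> 2 * K"
      using norm_triangle_ineq4[of "f z" "f (1 / 2)"] K(2)[OF z] K(2)[of "1 / 2"] by (simp add: strip_def)
    also have "\<dots> \<le> 2 * K * cmod (z - 1 / 2)" using K far by simp
    finally have "cmod (f z - f (1 / 2)) / cmod (z - 1 / 2) \<le> 2 * K"
      using far K(1) by (simp add: divide_le_eq)
    moreover have "z \<noteq> 1 / 2"
    proof
      assume "z = 1 / 2"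
      then have "cmod (z - 1 / 2) = 0" by (simp only: diff_self norm_zero)
      then show False using far by linarith
    qed
    ultimately have "cmod (?q z) \<le> 2 * K" by (simp only: if_False norm_divide)
    then show ?thesis by simp
  qed
  then show ?thesis using cont hol by (rule strip_functionI)
qed

subsection \<open>The 2-convexified norm and its dual\<close>

text \<open>For finite \<open>V\<close> this is the norm in the space \<open>T2\<close> of the
  truncation of \<open>x\<close> to \<open>V\<close>; for truncations membership is
  automatic.\<close>

definition t2norm :: "nat set \<Rightarrow> cseq \<Rightarrow> real" where
  "t2norm V x = sqrt (tau_id V (\<lambda>j. (cmod (x j))\<^sup>2))"

lemma t2norm_nonneg: "0 \<le> t2norm V x"
  by (simp add: t2norm_def tau_nonneg)

lemma t2norm_power2: "(t2norm V x)\<^sup>2 = tau_id V (\<lambda>j. (cmod (x j))\<^sup>2)"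
  by (simp add: t2norm_def tau_nonneg)

lemma t2norm_mono:
  assumes "finite V'" "V \<subseteq> V'" "\<And>j. j \<in> V \<Longrightarrow> cmod (x j) \<le> cmod (y j)"
  shows "t2norm V x \<le> t2norm V' y"
  unfolding t2norm_def using assms by (intro real_sqrt_le_mono tau_mono power_mono) auto

lemma t2norm_cong:
  assumes "finite V" "\<And>j. j \<in> V \<Longrightarrow> cmod (x j) = cmod (y j)"
  shows "t2norm V x = t2norm V y"
  using assms by (intro antisym t2norm_mono) auto

lemma t2norm_restrict_seq:
  assumes "finite V"
  shows "t2norm V (restrict_seq W x) \<le> t2norm (V \<inter> W) x"
  unfolding t2norm_def
proof (intro real_sqrt_le_mono tau_least)
  fix g assume g: "norming g"
  have "(\<Sum>j\<in>V. g j * (cmod (restrict_seq W x j))\<^sup>2) = (\<Sum>j\<in>V \<inter> W. g j * (cmod (x j))\<^sup>2)"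
    using assms by (auto simp: restrict_seq_def sum.inter_restrict intro!: sum.cong)
  also have "\<dots> \<le> tau_id (V \<inter> W) (\<lambda>j. (cmod (x j))\<^sup>2)"
    using tau_upper[OF g, where \<kappa>="\<lambda>j. j"] by simp
  finally show "(\<Sum>j\<in>V. g j * (cmod (restrict_seq W x j))\<^sup>2) \<le> tau_id (V \<inter> W) (\<lambda>j. (cmod (x j))\<^sup>2)" .
qed

lemma t2norm_empty: "t2norm {} x = 0"
  using tau_le_sum[of "\<lambda>j. (cmod (x j))\<^sup>2" "\<lambda>j. j" "{}"] tau_nonneg[of "\<lambda>j. (cmod (x j))\<^sup>2" "\<lambda>j. j" "{}"]
  by (simp add: t2norm_def)

lemma t2norm_scale: "t2norm V (\<lambda>j. c * x j) \<le> cmod c * t2norm V x"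
proof (rule power2_le_imp_le)
  show "(t2norm V (\<lambda>j. c * x j))\<^sup>2 \<le> (cmod c * t2norm V x)\<^sup>2"
    using tau_le_scale[of "\<lambda>j. (cmod (x j))\<^sup>2" "(cmod c)\<^sup>2"]
    by (simp add: t2norm_power2 power_mult_distrib norm_mult)
qed (simp add: t2norm_nonneg)

text \<open>Each fixed \<open>g\<close> gives a Euclidean seminorm with weights
  \<open>sqrt (g j)\<close>, to which Minkowski's inequality applies; \<open>t2norm\<close> is the
  supremum of these seminorms.\<close>

lemma t2norm_triangle: "t2norm V (\<lambda>j. x j + y j) \<le> t2norm V x + t2norm V y"
proof (rule power2_le_imp_le)
  show "(t2norm V (\<lambda>j. x j + y j))\<^sup>2 \<le> (t2norm V x + t2norm V y)\<^sup>2"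
    unfolding t2norm_power2
  proof (rule tau_least)
    fix g assume g: "norming g"
    have L2_le: "L2_set (\<lambda>j. sqrt (g j) * cmod (u j)) V \<le> t2norm V u" for u
      using tau_upper[OF g, where \<kappa>="\<lambda>j. j" and f="\<lambda>j. (cmod (u j))\<^sup>2"] norming_nonneg[OF g]
      by (simp add: L2_set_def t2norm_def power_mult_distrib)
    have "L2_set (\<lambda>j. sqrt (g j) * cmod (x j + y j)) V
        \<le> L2_set (\<lambda>j. sqrt (g j) * cmod (x j) + sqrt (g j) * cmod (y j)) V"
      unfolding distrib_left[symmetric]
      by (intro L2_set_mono mult_left_mono norm_triangle_ineq) (simp_all add: norming_nonneg[OF g])
    also have "\<dots> \<le> L2_set (\<lambda>j. sqrt (g j) * cmod (x j)) V + L2_set (\<lambda>j. sqrt (g j) * cmod (y j)) V"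
      by (rule L2_set_triangle_ineq)
    also have "\<dots> \<le> t2norm V x + t2norm V y" by (intro add_mono L2_le)
    finally have "(L2_set (\<lambda>j. sqrt (g j) * cmod (x j + y j)) V)\<^sup>2 \<le> (t2norm V x + t2norm V y)\<^sup>2"
      by (intro power_mono) (auto simp: L2_set_nonneg)
    then show "(\<Sum>j\<in>V. g j * (cmod (x j + y j))\<^sup>2) \<le> (t2norm V x + t2norm V y)\<^sup>2"
      using norming_nonneg[OF g]
      by (simp add: L2_set_def power_mult_distrib sum_nonneg)
  qed
qed (simp add: t2norm_nonneg)

lemma convexify2_restrict_seq:
  assumes "finite V"
  shows "convexify2 tsirelson_norm (restrict_seq V x) = t2norm V x"
proof -
  have "(\<lambda>j. complex_of_real ((cmod (restrict_seq V x j))\<^sup>2)) = restrict_seq V (\<lambda>j. of_real ((cmod (x j))\<^sup>2))"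
    by (auto simp: restrict_seq_def fun_eq_iff)
  then show ?thesis
    using tsirelson_norm_restrict_seq[OF assms] by (simp add: convexify2_def t2norm_def norm_power)
qed

lemma restrict_seq_in_T2:
  assumes "finite V"
  shows "restrict_seq V x \<in> pts T2" "nrm T2 (restrict_seq V x) = t2norm V x"
proof -
  obtain m where m: "V \<subseteq> {..<m}" using finite_nat_bounded[OF assms] by blast
  have eq: "restrict_seq {..<n} (restrict_seq V x) = restrict_seq V x" if "m \<le> n" for n
    using m that by (auto simp: restrict_seq_def fun_eq_iff)
  have zero: "convexify2 tsirelson_norm (z - z) = 0" for z
  proof -
    have "z - z = restrict_seq {} z" by (auto simp: restrict_seq_def fun_eq_iff)
    then show ?thesis using convexify2_restrict_seq[of "{}" z] by (simp add: t2norm_empty)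
  qed
  show "restrict_seq V x \<in> pts T2"
    unfolding T2_def basis_completion_def using eq zero
    by (auto intro!: exI[of _ m])
  have "(\<lambda>n. convexify2 tsirelson_norm (restrict_seq {..<n} (restrict_seq V x))) \<longlonglongrightarrow> t2norm V x"
    using eq convexify2_restrict_seq[OF assms]
    by (intro tendsto_eventually eventually_sequentiallyI[of m]) metis
  then show "nrm T2 (restrict_seq V x) = t2norm V x"
    unfolding T2_def basis_completion_def by (simp add: limI)
qed

text \<open>The norm of \<open>T2\<close> is a limit along initial segments. Their norms increase,
  and the Cauchy condition for \<open>\<epsilon> = 1\<close> bounds them, so the limit exists and
  dominates each of them.\<close>

lemma t2norm_le_nrm:
  assumes x: "x \<in> pts T2" and V: "finite V"
  shows "t2norm V x \<le> nrm T2 x"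
proof -
  let ?s = "\<lambda>n. t2norm {..<n} x"
  have s: "?s = (\<lambda>n. convexify2 tsirelson_norm (restrict_seq {..<n} x))"
    by (simp add: convexify2_restrict_seq)
  have inc: "incseq ?s" by (auto intro!: incseq_SucI t2norm_mono)
  obtain M where M: "\<And>m. M \<le> m \<Longrightarrow>
      convexify2 tsirelson_norm (restrict_seq {..<m} x - restrict_seq {..<M} x) < 1"
    using x unfolding T2_def basis_completion_def by (auto dest!: spec[of _ "1::real"])
  have "?s m \<le> ?s M + 1" if "M \<le> m" for m
  proof -
    let ?d = "restrict_seq {..<m} x - restrict_seq {..<M} x"
    have "?s m = t2norm {..<m} (\<lambda>j. restrict_seq {..<M} x j + ?d j)"
      by (intro t2norm_cong) (auto simp: restrict_seq_def)
    also have "\<dots> \<le> t2norm {..<m} (restrict_seq {..<M} x) + t2norm {..<m} ?d"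
      by (rule t2norm_triangle)
    also have "t2norm {..<m} (restrict_seq {..<M} x) \<le> ?s M"
      using t2norm_restrict_seq[of "{..<m}" "{..<M}" x] that by (simp add: Int_absorb1)
    also have "t2norm {..<m} ?d \<le> 1"
    proof -
      have "?d = restrict_seq {..<m} ?d" using that by (auto simp: restrict_seq_def fun_eq_iff)
      then show ?thesis using M[OF that] convexify2_restrict_seq[of "{..<m}" ?d] by simp
    qed
    finally show ?thesis by simp
  qed
  then have "?s m \<le> ?s M + 1" for m
    using inc[THEN incseqD, of m M] by (cases "M \<le> m") auto
  then obtain L where L: "?s \<longlonglongrightarrow> L" "\<And>n. ?s n \<le> L" using incseq_convergent[OF inc] by metis
  then have "nrm T2 x = L" unfolding T2_def basis_completion_def by (simp add: s[symmetric] limI)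
  moreover obtain m where "V \<subseteq> {..<m}" using finite_nat_bounded[OF V] by blast
  then have "t2norm V x \<le> ?s m" by (intro t2norm_mono) auto
  ultimately show ?thesis using L(2) order_trans by metis
qed

lemma T2_functional_restrict_seq:
  assumes \<phi>: "functional_bounded_by T2 \<phi> K" and b: "\<And>j. \<phi> (unit_seq j) = b j" and "finite V"
  shows "\<phi> (restrict_seq V x) = (\<Sum>j\<in>V. x j * b j)"
  using \<open>finite V\<close>
proof (induction V rule: finite_induct)
  case empty
  have "\<phi> (seq_scale 0 (restrict_seq {} x)) = 0 * \<phi> (restrict_seq {} x)"
    using \<phi> restrict_seq_in_T2(1)[of "{}" x] unfolding functional_bounded_by_def by blast
  moreover have "seq_scale 0 (restrict_seq {} x) = restrict_seq {} x"
    by (simp add: seq_scale_def restrict_seq_def)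
  ultimately show ?case by simp
next
  case (insert i V)
  have unit: "unit_seq i \<in> pts T2"
  proof -
    have "unit_seq i = restrict_seq {i} (\<lambda>j. 1)" by (auto simp: unit_seq_def restrict_seq_def fun_eq_iff)
    then show ?thesis using restrict_seq_in_T2(1)[of "{i}"] by simp
  qed
  have sc: "seq_scale (x i) (unit_seq i) = restrict_seq {i} x"
    by (auto simp: seq_scale_def unit_seq_def restrict_seq_def fun_eq_iff)
  have "restrict_seq (insert i V) x = restrict_seq {i} x + restrict_seq V x"
    using insert(2) by (auto simp: restrict_seq_def fun_eq_iff)
  then have "\<phi> (restrict_seq (insert i V) x) = \<phi> (restrict_seq {i} x) + \<phi> (restrict_seq V x)"
    using \<phi> restrict_seq_in_T2(1)[of "{i}" x] restrict_seq_in_T2(1)[OF insert(1), of x]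
    unfolding functional_bounded_by_def by simp
  also have "\<phi> (restrict_seq {i} x) = x i * b i"
    using \<phi> unit b[of i] sc unfolding functional_bounded_by_def by metis
  finally show ?case using insert by simp
qed

text \<open>Every constant in the infimum gives the estimate on finite vectors. The \<open>K\<close>
  from membership may have any sign, hence \<open>\<bar>K\<bar>\<close>; vectors of norm zero are
  treated apart because the infimum is reached by dividing by the norm.\<close>

lemma dual_pairing_le:
  assumes b: "b \<in> pts (dual_seq_space T2)" and V: "finite V"
  shows "cmod (\<Sum>j\<in>V. x j * b j) \<le> nrm (dual_seq_space T2) b * t2norm V x"
proof -
  let ?S = "{K. 0 \<le> K \<and> (\<exists>\<phi>. functional_bounded_by T2 \<phi> K \<and> (\<forall>j. \<phi> (unit_seq j) = b j))}"
  have nrm: "nrm (dual_seq_space T2) b = Inf ?S" by (simp add: dual_seq_space_def)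
  have "?S \<noteq> {}"
  proof -
    obtain \<phi> K where \<phi>: "functional_bounded_by T2 \<phi> K" "\<forall>j. \<phi> (unit_seq j) = b j"
      using b by (auto simp: dual_seq_space_def)
    have "cmod (\<phi> y) \<le> \<bar>K\<bar> * nrm T2 y" if "y \<in> pts T2" for y
    proof -
      have "0 \<le> nrm T2 y" using t2norm_le_nrm[OF that, of "{}"] by (simp add: t2norm_empty)
      then have "K * nrm T2 y \<le> \<bar>K\<bar> * nrm T2 y" by (intro mult_right_mono) auto
      then show ?thesis using \<phi>(1) that unfolding functional_bounded_by_def by (meson order_trans)
    qed
    then have "functional_bounded_by T2 \<phi> \<bar>K\<bar>" using \<phi>(1) unfolding functional_bounded_by_def by blast
    then have "\<bar>K\<bar> \<in> ?S" using \<phi>(2) by auto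
    then show ?thesis by blast
  qed
  have le: "cmod (\<Sum>j\<in>V. x j * b j) \<le> K * t2norm V x" if "K \<in> ?S" for K
  proof -
    obtain \<phi> where \<phi>: "functional_bounded_by T2 \<phi> K" "\<forall>j. \<phi> (unit_seq j) = b j" using \<open>K \<in> ?S\<close> by blast
    have "cmod (\<phi> (restrict_seq V x)) \<le> K * nrm T2 (restrict_seq V x)"
      using \<phi>(1) restrict_seq_in_T2(1)[OF V, of x] unfolding functional_bounded_by_def by blast
    then show ?thesis using T2_functional_restrict_seq[OF \<phi>(1) _ V] \<phi>(2) restrict_seq_in_T2(2)[OF V] by simp
  qed
  show ?thesis
  proof (cases "t2norm V x = 0")
    case False
    then have pos: "0 < t2norm V x" using t2norm_nonneg[of V x] by simp
    have "cmod (\<Sum>j\<in>V. x j * b j) / t2norm V x \<le> Inf ?S"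
      using \<open>?S \<noteq> {}\<close> le pos by (intro cInf_greatest) (auto simp: divide_le_eq)
    then show ?thesis using pos by (simp add: nrm divide_le_eq)
  next
    case True
    obtain K where "K \<in> ?S" using \<open>?S \<noteq> {}\<close> by blast
    then show ?thesis using le[of K] True by simp
  qed
qed

subsection \<open>Bounded functions into the interpolation couple\<close>

text \<open>The part of membership in \<^const>\<open>F_inf\<close> with norm at most \<open>M\<close> that survives cutting down to blocks:
  finite truncations are estimated, and norm continuity on the boundary is dropped.\<close>

definition tame :: "(complex \<Rightarrow> cseq) \<Rightarrow> real \<Rightarrow> bool" where
  "tame F M \<longleftrightarrow> 0 \<le> M \<and> (\<forall>j. strip_function (\<lambda>z. F z j)) \<and>
    (\<forall>V t. finite V \<longrightarrow> t2norm V (F (\<i> * of_real t)) \<le> M) \<and>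
    (\<forall>V t x. finite V \<longrightarrow>
      cmod (\<Sum>j\<in>V. x j * F (1 + \<i> * of_real t) j) \<le> M * t2norm V x)"

lemma tameI:
  assumes "0 \<le> M" "\<And>j. strip_function (\<lambda>z. F z j)"
    and "\<And>V t. finite V \<Longrightarrow> t2norm V (F (\<i> * of_real t)) \<le> M"
    and "\<And>V t x. finite V \<Longrightarrow>
      cmod (\<Sum>j\<in>V. x j * F (1 + \<i> * of_real t) j) \<le> M * t2norm V x"
  shows "tame F M"
  using assms unfolding tame_def by blast

lemma
  assumes "tame F M"
  shows tame_nonneg: "0 \<le> M" and tame_strip_function: "strip_function (\<lambda>z. F z j)"
    and tame_left: "finite V \<Longrightarrow> t2norm V (F (\<i> * of_real t)) \<le> M"
    and tame_right: "finite V \<Longrightarrow>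
      cmod (\<Sum>j\<in>V. x j * F (1 + \<i> * of_real t) j) \<le> M * t2norm V x"
  using assms unfolding tame_def by blast+

lemma tame_mono:
  assumes "tame F M" "M \<le> M'"
  shows "tame F M'"
proof (rule tameI)
  show "cmod (\<Sum>j\<in>V. x j * F (1 + \<i> * of_real t) j) \<le> M' * t2norm V x" if "finite V" for V t x
    using tame_right[OF assms(1) that, of x t] mult_right_mono[OF assms(2) t2norm_nonneg, of V x] by linarith
  show "t2norm V (F (\<i> * of_real t)) \<le> M'" if "finite V" for V t
    using tame_left[OF assms(1) that, of t] assms(2) by linarith
qed (use tame_nonneg[OF assms(1)] tame_strip_function[OF assms(1)] assms(2) in auto)

lemma tame_scale:
  assumes "tame F M"
  shows "tame (\<lambda>z j. c * F z j) (cmod c * M)"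
proof (rule tameI)
  show "strip_function (\<lambda>z. c * F z j)" for j
    by (intro strip_function_mult strip_function_const tame_strip_function[OF assms])
  show "t2norm V (\<lambda>j. c * F (\<i> * of_real t) j) \<le> cmod c * M" if "finite V" for V t
    using t2norm_scale[of V c "F (\<i> * of_real t)"] mult_left_mono[OF tame_left[OF assms that, of t], of "cmod c"]
    by simp
  show "cmod (\<Sum>j\<in>V. x j * (c * F (1 + \<i> * of_real t) j)) \<le> cmod c * M * t2norm V x" if "finite V" for V t x
  proof -
    have "(\<Sum>j\<in>V. x j * (c * F (1 + \<i> * of_real t) j)) = c * (\<Sum>j\<in>V. x j * F (1 + \<i> * of_real t) j)"
      by (simp add: sum_distrib_left algebra_simps)
    then show ?thesis
      using mult_left_mono[OF tame_right[OF assms that, of x t], of "cmod c"] by (simp add: norm_mult)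
  qed
qed (use tame_nonneg[OF assms] in simp)

lemma tame_add:
  assumes "tame F M" "tame G N"
  shows "tame (\<lambda>z j. F z j + G z j) (M + N)"
proof (rule tameI)
  show "strip_function (\<lambda>z. F z j + G z j)" for j
    using assms by (intro strip_function_add tame_strip_function)
  show "t2norm V (\<lambda>j. F (\<i> * of_real t) j + G (\<i> * of_real t) j) \<le> M + N" if "finite V" for V t
    using t2norm_triangle[of V "F (\<i> * of_real t)" "G (\<i> * of_real t)"]
      tame_left[OF assms(1) that, of t] tame_left[OF assms(2) that, of t] by linarith
  show "cmod (\<Sum>j\<in>V. x j * (F (1 + \<i> * of_real t) j + G (1 + \<i> * of_real t) j)) \<le> (M + N) * t2norm V x"
    if "finite V" for V t x
  proof -
    have "(\<Sum>j\<in>V. x j * (F (1 + \<i> * of_real t) j + G (1 + \<i> * of_real t) j))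
       = (\<Sum>j\<in>V. x j * F (1 + \<i> * of_real t) j) + (\<Sum>j\<in>V. x j * G (1 + \<i> * of_real t) j)"
      by (simp add: sum.distrib distrib_left)
    also have "cmod \<dots> \<le> M * t2norm V x + N * t2norm V x"
      by (rule norm_triangle_mono[OF tame_right[OF assms(1) that] tame_right[OF assms(2) that]])
    finally show ?thesis by (simp add: distrib_right)
  qed
qed (use tame_nonneg[OF assms(1)] tame_nonneg[OF assms(2)] in simp)

lemma tame_zero: "tame (\<lambda>z j. 0) 0"
proof (rule tameI)
  show "t2norm V (\<lambda>j. 0) \<le> 0" for V using t2norm_scale[of V 0 "\<lambda>j. 0"] by simp
qed (simp_all add: strip_function_const)

lemma tame_sum:
  "(\<And>i. i \<in> J \<Longrightarrow> tame (F i) (M i)) \<Longrightarrow> tame (\<lambda>z j. \<Sum>i\<in>J. F i z j) (\<Sum>i\<in>J. M i)"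
proof (induction J rule: infinite_finite_induct)
  case (insert i J)
  then have "tame (\<lambda>z j. F i z j + (\<Sum>i\<in>J. F i z j)) (M i + (\<Sum>i\<in>J. M i))" by (intro tame_add) auto
  then show ?case using insert by simp
qed (simp_all add: tame_zero)

lemma tame_restrict:
  assumes "tame F M"
  shows "tame (\<lambda>z j. if j \<in> I then F z j else 0) M"
proof (rule tameI)
  show "strip_function (\<lambda>z. if j \<in> I then F z j else 0)" for j
    using tame_strip_function[OF assms] strip_function_const by (cases "j \<in> I") auto
  show "t2norm V (\<lambda>j. if j \<in> I then F (\<i> * of_real t) j else 0) \<le> M" if "finite V" for V t
  proof -
    have "t2norm V (\<lambda>j. if j \<in> I then F (\<i> * of_real t) j else 0) \<le> t2norm V (F (\<i> * of_real t))"
      using that by (intro t2norm_mono) auto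
    then show ?thesis using tame_left[OF assms that, of t] by linarith
  qed
  show "cmod (\<Sum>j\<in>V. x j * (if j \<in> I then F (1 + \<i> * of_real t) j else 0)) \<le> M * t2norm V x"
    if "finite V" for V t x
  proof -
    have "(\<Sum>j\<in>V. x j * (if j \<in> I then F (1 + \<i> * of_real t) j else 0)) =
        (\<Sum>j\<in>V \<inter> I. x j * F (1 + \<i> * of_real t) j)"
      using that by (auto simp: sum.inter_restrict intro!: sum.cong)
    also have "cmod \<dots> \<le> M * t2norm (V \<inter> I) x" using that by (intro tame_right[OF assms]) auto
    also have "\<dots> \<le> M * t2norm V x"
      using that tame_nonneg[OF assms] by (intro mult_left_mono t2norm_mono) auto
    finally show ?thesis .
  qed
qed (rule tame_nonneg[OF assms])

text \<open>On the boundary of the strip, \<open>\<Sum>j\<in>V. F z j * cnj (F (1 - cnj z) j)\<close> pairs a value of \<open>F\<close> on one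
  side with one on the other.\<close>

lemma tame_half:
  assumes F: "tame F M" and V: "finite V"
  shows "(\<Sum>j\<in>V. (cmod (F (1 / 2) j))\<^sup>2) \<le> M\<^sup>2"
proof -
  define G where "G z = (\<Sum>j\<in>V. F z j * cnj (F (1 - cnj z) j))" for z
  have pair: "cmod (\<Sum>j\<in>V. cnj (F (\<i> * of_real t) j) * F (1 + \<i> * of_real t) j) \<le> M\<^sup>2" for t
  proof -
    have "cmod (\<Sum>j\<in>V. cnj (F (\<i> * of_real t) j) * F (1 + \<i> * of_real t) j)
        \<le> M * t2norm V (\<lambda>j. cnj (F (\<i> * of_real t) j))" by (rule tame_right[OF F V])
    also have "t2norm V (\<lambda>j. cnj (F (\<i> * of_real t) j)) = t2norm V (F (\<i> * of_real t))"
      using V by (intro t2norm_cong) auto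
    also have "M * t2norm V (F (\<i> * of_real t)) \<le> M * M"
      by (intro mult_left_mono tame_left[OF F V] tame_nonneg[OF F])
    finally show ?thesis by (simp add: power2_eq_square)
  qed
  have "cmod (G (1 / 2)) \<le> M\<^sup>2"
  proof (rule three_lines)
    show "strip_function G"
      unfolding G_def
      by (intro strip_function_sum strip_function_mult strip_function_reflection tame_strip_function[OF F])
    show "cmod (G (\<i> * of_real t)) \<le> M\<^sup>2" for t
    proof -
      have "G (\<i> * of_real t) = cnj (\<Sum>j\<in>V. cnj (F (\<i> * of_real t) j) * F (1 + \<i> * of_real t) j)"
        by (simp add: G_def)
      then show ?thesis using pair[of t] by (simp only: complex_mod_cnj)
    qed
    show "cmod (G (1 + \<i> * of_real t)) \<le> M\<^sup>2" for t
    proof -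
      have "G (1 + \<i> * of_real t) = (\<Sum>j\<in>V. cnj (F (\<i> * of_real t) j) * F (1 + \<i> * of_real t) j)"
        by (simp add: G_def mult.commute)
      then show ?thesis using pair[of t] by simp
    qed
  qed
  \<comment> \<open>The reflection fixes \<open>1 / 2\<close>, so each coordinate meets its own
    conjugate there.\<close>
  moreover have "G (1 / 2) = of_real (\<Sum>j\<in>V. (cmod (F (1 / 2) j))\<^sup>2)"
    unfolding G_def of_real_sum complex_norm_square by simp
  ultimately have "\<bar>\<Sum>j\<in>V. (cmod (F (1 / 2) j))\<^sup>2\<bar> \<le> M\<^sup>2" by (simp only: norm_of_real)
  then show ?thesis by linarith
qed

text \<open>The quotient by \<open>z - 1 / 2\<close> takes the derivative as its value at
  \<open>1 / 2\<close>. On both boundary lines \<open>1 / 2 \<le> cmod (z - 1 / 2)\<close>, so the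
  quotient is tame with bound \<open>2 * M\<close>, and \<open>tame_half\<close> applies to
  it.\<close>

lemma tame_deriv:
  assumes F: "tame F M" and zero: "\<And>j. F (1 / 2) j = 0" and V: "finite V"
  shows "(\<Sum>j\<in>V. (cmod (deriv (\<lambda>z. F z j) (1 / 2)))\<^sup>2) \<le> (2 * M)\<^sup>2"
proof -
  define H where "H z j = (if z = 1 / 2 then deriv (\<lambda>z. F z j) (1 / 2)
    else (F z j - F (1 / 2) j) / (z - 1 / 2))" for z j
  have H_off: "H z j = inverse (z - 1 / 2) * F z j" if "z \<noteq> 1 / 2" for z j
    using that by (simp add: H_def zero field_simps)
  have inv_le: "cmod (inverse (z - 1 / 2)) \<le> 2" "z \<noteq> 1 / 2" if "\<bar>Re z - 1 / 2\<bar> = 1 / 2" for z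
  proof -
    have "1 / 2 \<le> cmod (z - 1 / 2)" using abs_Re_le_cmod[of "z - 1 / 2"] that by simp
    then show "cmod (inverse (z - 1 / 2)) \<le> 2" unfolding norm_inverse
      using le_imp_inverse_le[of "1 / 2" "cmod (z - 1 / 2)"] by simp
    show "z \<noteq> 1 / 2"
    proof
      assume "z = 1 / 2"
      then have "Re z = Re (1 / 2)" by (rule arg_cong)
      then have "Re z = 1 / 2" by simp
      then show False using that by simp
    qed
  qed
  have "tame H (2 * M)"
  proof (rule tameI)
    show "strip_function (\<lambda>z. H z j)" for j
      unfolding H_def by (rule strip_function_divided_difference[OF tame_strip_function[OF F]])
    show "t2norm W (H (\<i> * of_real t)) \<le> 2 * M" if "finite W" for W t
    proof -
      let ?z = "\<i> * of_real t :: complex"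
      have z: "cmod (inverse (?z - 1 / 2)) \<le> 2" "?z \<noteq> 1 / 2" by (rule inv_le; simp)+
      have "t2norm W (H ?z) = t2norm W (\<lambda>j. inverse (?z - 1 / 2) * F ?z j)" using H_off[OF z(2)] by presburger
      also have "\<dots> \<le> cmod (inverse (?z - 1 / 2)) * t2norm W (F ?z)" by (rule t2norm_scale)
      also have "\<dots> \<le> 2 * M" using z(1) tame_left[OF F that, of t] t2norm_nonneg by (intro mult_mono) auto
      finally show ?thesis .
    qed
    show "cmod (\<Sum>j\<in>W. x j * H (1 + \<i> * of_real t) j) \<le> 2 * M * t2norm W x" if "finite W" for W t x
    proof -
      let ?z = "1 + \<i> * of_real t :: complex"
      have z: "cmod (inverse (?z - 1 / 2)) \<le> 2" "?z \<noteq> 1 / 2" by (rule inv_le; simp)+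
      have "(\<Sum>j\<in>W. x j * H ?z j) = inverse (?z - 1 / 2) * (\<Sum>j\<in>W. x j * F ?z j)"
        unfolding sum_distrib_left by (intro sum.cong refl) (simp only: H_off[OF z(2)] mult.left_commute)
      also have "cmod \<dots> \<le> 2 * (M * t2norm W x)"
        unfolding norm_mult using z(1) tame_right[OF F that, of x t] by (intro mult_mono) auto
      finally show ?thesis by simp
    qed
  qed (use tame_nonneg[OF F] in simp)
  from tame_half[OF this V] show ?thesis by (simp add: H_def)
qed

lemma tame_F_inf:
  assumes F: "F \<in> F_inf T2 (dual_seq_space T2)" and "F_inf_norm T2 (dual_seq_space T2) F \<le> M"
  shows "tame F M"
proof -
  let ?D = "dual_seq_space T2"
  have F': "\<And>j. bounded ((\<lambda>z. F z j) ` strip)" "continuous_on strip F"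
    "\<And>j. (\<lambda>z. F z j) holomorphic_on interior strip"
    "bounded_continuous_curve T2 (\<lambda>t. F (\<i> * complex_of_real t))"
    "bounded_continuous_curve ?D (\<lambda>t. F (1 + \<i> * complex_of_real t))"
    using F unfolding F_inf_def by auto
  have left: "F (\<i> * of_real t) \<in> pts T2" "nrm T2 (F (\<i> * of_real t)) \<le> M" for t
  proof -
    show "F (\<i> * of_real t) \<in> pts T2" using F'(4) by (auto simp: bounded_continuous_curve_def)
    have "nrm T2 (F (\<i> * of_real t)) \<le> (SUP t. nrm T2 (F (\<i> * complex_of_real t)))"
      using F'(4) by (intro cSUP_upper) (auto simp: bounded_continuous_curve_def)
    then show "nrm T2 (F (\<i> * of_real t)) \<le> M" using assms(2) by (simp add: F_inf_norm_def)
  qed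
  have right: "F (1 + \<i> * of_real t) \<in> pts ?D" "nrm ?D (F (1 + \<i> * of_real t)) \<le> M" for t
  proof -
    show "F (1 + \<i> * of_real t) \<in> pts ?D" using F'(5) by (auto simp: bounded_continuous_curve_def)
    have "nrm ?D (F (1 + \<i> * of_real t)) \<le> (SUP t. nrm ?D (F (1 + \<i> * complex_of_real t)))"
      using F'(5) by (intro cSUP_upper) (auto simp: bounded_continuous_curve_def)
    then show "nrm ?D (F (1 + \<i> * of_real t)) \<le> M" using assms(2) by (simp add: F_inf_norm_def)
  qed
  show ?thesis
  proof (rule tameI)
    show "0 \<le> M"
      using t2norm_le_nrm[OF left(1)[of 0], of "{}"] left(2)[of 0] by (simp add: t2norm_empty)
    show "strip_function (\<lambda>z. F z j)" for j
      unfolding strip_function_def using F'(1,3) continuous_on_coordinatewise_then_product F'(2)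
      by (auto intro: continuous_on_product_then_coordinatewise)
    show "t2norm V (F (\<i> * of_real t)) \<le> M" if "finite V" for V t
      using t2norm_le_nrm[OF left(1) that] left(2) order_trans by blast
    show "cmod (\<Sum>j\<in>V. x j * F (1 + \<i> * of_real t) j) \<le> M * t2norm V x" if "finite V" for V t x
      using dual_pairing_le[OF right(1) that] mult_right_mono[OF right(2) t2norm_nonneg] order_trans by blast
  qed
qed

subsection \<open>Functions built on blocks\<close>

text \<open>Averaging over signs made deterministic. When a vector is added with either sign, the
  parallelogram law removes the cross terms from the mean of the two squared norms, and one sign
  does at least as well as the mean.\<close>

lemma sign_choice:
  fixes u :: "nat \<Rightarrow> nat \<Rightarrow> complex"
  assumes "finite J"
  shows "\<exists>e. (\<forall>i. cmod (e i) = 1) \<and>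
    (\<Sum>i\<in>J. \<Sum>j\<in>V. (cmod (u i j))\<^sup>2) \<le> (\<Sum>j\<in>V. (cmod (\<Sum>i\<in>J. e i * u i j))\<^sup>2)"
  using assms
proof (induction J rule: finite_induct)
  case empty
  show ?case by (intro exI[of _ "\<lambda>_. 1"]) simp
next
  case (insert i J)
  then obtain e where e: "\<And>i. cmod (e i) = 1"
    "(\<Sum>i\<in>J. \<Sum>j\<in>V. (cmod (u i j))\<^sup>2) \<le> (\<Sum>j\<in>V. (cmod (\<Sum>i\<in>J. e i * u i j))\<^sup>2)" by blast
  define A where "A j = (\<Sum>i\<in>J. e i * u i j)" for j
  have "(cmod (c * u i j + A j))\<^sup>2 + (cmod (- c * u i j + A j))\<^sup>2 = 2 * (cmod (A j))\<^sup>2 + 2 * (cmod (u i j))\<^sup>2"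
    if "c = 1" for c :: complex and j
    using that by (simp add: cmod_power2) (simp add: power2_eq_square algebra_simps)
  then have "(\<Sum>j\<in>V. (cmod (1 * u i j + A j))\<^sup>2) + (\<Sum>j\<in>V. (cmod (- 1 * u i j + A j))\<^sup>2)
      = 2 * (\<Sum>j\<in>V. (cmod (A j))\<^sup>2) + 2 * (\<Sum>j\<in>V. (cmod (u i j))\<^sup>2)"
    by (simp add: sum.distrib[symmetric] sum_distrib_left)
  then consider
      "(\<Sum>j\<in>V. (cmod (A j))\<^sup>2) + (\<Sum>j\<in>V. (cmod (u i j))\<^sup>2) \<le> (\<Sum>j\<in>V. (cmod (1 * u i j + A j))\<^sup>2)"
    | "(\<Sum>j\<in>V. (cmod (A j))\<^sup>2) + (\<Sum>j\<in>V. (cmod (u i j))\<^sup>2) \<le> (\<Sum>j\<in>V. (cmod (- 1 * u i j + A j))\<^sup>2)"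
    by argo
  then obtain c :: complex where c: "cmod c = 1"
    "(\<Sum>j\<in>V. (cmod (A j))\<^sup>2) + (\<Sum>j\<in>V. (cmod (u i j))\<^sup>2) \<le> (\<Sum>j\<in>V. (cmod (c * u i j + A j))\<^sup>2)"
  proof cases
    case 1
    then show thesis by (rule that[rotated]) simp
  next
    case 2
    then show thesis by (rule that[rotated]) simp
  qed
  have "(\<Sum>q\<in>insert i J. (e(i := c)) q * u q j) = c * u i j + A j" for j
  proof -
    have "(\<Sum>q\<in>J. (e(i := c)) q * u q j) = A j"
      unfolding A_def using insert(2) by (intro sum.cong) auto
    then show ?thesis using insert by simp
  qed
  then have "(\<Sum>q\<in>insert i J. \<Sum>j\<in>V. (cmod (u q j))\<^sup>2)
      \<le> (\<Sum>j\<in>V. (cmod (\<Sum>q\<in>insert i J. (e(i := c)) q * u q j))\<^sup>2)"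
    using c(2) e(2) insert by (simp add: A_def)
  then show ?case using e(1) c(1) by (intro exI[of _ "e(i := c)"]) auto
qed

lemma of_real_powr_half: "0 \<le> g \<Longrightarrow> complex_of_real g powr (1 / 2) = of_real (sqrt g)"
  using powr_of_real[of g "1 / 2"] by (simp add: powr_half_sqrt)

text \<open>The source of the logarithm. The formula persists for \<open>g = 0\<close>, where the
  function and \<open>sqrt g\<close> both vanish.\<close>

lemma has_field_derivative_of_real_powr_half:
  assumes "0 \<le> g"
  shows "((\<lambda>z. complex_of_real g powr z) has_field_derivative of_real (ln g * sqrt g)) (at (1 / 2))"
proof (cases "g = 0")
  case False
  then show ?thesis
    using assms has_field_derivative_powr_right[of "complex_of_real g" "1 / 2"]
    by (simp add: of_real_powr_half Ln_of_real)
qed simp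

lemma block_index_unique:
  assumes "strict_mono \<kappa>" and I: "\<And>i j. j \<in> I i \<Longrightarrow> \<kappa> i \<le> j \<and> j < \<kappa> (Suc i)"
    and j: "j \<in> I i" "j \<in> I i'"
  shows "i = i'"
proof -
  have "\<kappa> i < \<kappa> (Suc i')" using I[OF j(1)] I[OF j(2)] by (meson le_less_trans)
  moreover have "\<kappa> i' < \<kappa> (Suc i)" using I[OF j(1)] I[OF j(2)] by (meson le_less_trans)
  ultimately show ?thesis using assms(1) by (simp add: strict_mono_less)
qed

text \<open>On the left line the coefficients have modulus at most \<open>a i\<close>, and the upper
  block estimate passes to the vector of the \<open>a i\<close> at positions
  \<open>\<kappa> (Suc i)\<close>. On the right line they have modulus
  \<open>a i * g (\<kappa> i)\<close>. With \<open>g\<close> split into two square roots,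
  Cauchy-Schwarz leaves the sum in \<open>ag\<close> and one that the lower block estimate bounds by
  the squared norm of the test vector. The two block estimates use positions one step apart, and so
  do \<open>tau_a\<close> and \<open>ag\<close>.\<close>

lemma tame_block_sum:
  assumes \<kappa>: "strict_mono \<kappa>" and I: "\<And>i j. j \<in> I i \<Longrightarrow> \<kappa> i \<le> j \<and> 2 * Suc j \<le> \<kappa> (Suc i)"
    and J: "finite J" and F: "\<And>i. tame (F i) C" and g: "norming g"
    and e: "\<And>i. cmod (e i) = 1" and a: "\<And>i. 0 \<le> a i"
    and tau_a: "tau (\<lambda>i. \<kappa> (Suc i)) J (\<lambda>i. (a i)\<^sup>2) \<le> 4" and ag: "(\<Sum>i\<in>J. (a i)\<^sup>2 * g (\<kappa> i)) \<le> 1"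
  shows "tame (\<lambda>z j. \<Sum>i\<in>J. e i * of_real (a i) * of_real (g (\<kappa> i)) powr z * (if j \<in> I i then F i z j else 0)) (3 * C)"
    (is "tame ?G _")
proof (rule tameI)
  have C: "0 \<le> C" using tame_nonneg[OF F] .
  then show "0 \<le> 3 * C" by simp
  have I': "\<kappa> i \<le> j \<and> j < \<kappa> (Suc i)" if "j \<in> I i" for i j using I[OF that] by auto
  have single: "?G z j = e i * of_real (a i) * of_real (g (\<kappa> i)) powr z * F i z j"
    if "i \<in> J" "j \<in> I i" for i j z
  proof -
    have "?G z j = (\<Sum>q\<in>J. if q = i then e i * of_real (a i) * of_real (g (\<kappa> i)) powr z * F i z j else 0)"
    proof (intro sum.cong refl)
      fix q
      have "j \<in> I q \<longleftrightarrow> q = i" using block_index_unique[where I=I, OF \<kappa> I' _ that(2), of q] that(2) by blast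
      then show "e q * of_real (a q) * of_real (g (\<kappa> q)) powr z * (if j \<in> I q then F q z j else 0)
          = (if q = i then e i * of_real (a i) * of_real (g (\<kappa> i)) powr z * F i z j else 0)" by simp
    qed
    then show ?thesis using that J by simp
  qed
  show "strip_function (\<lambda>z. ?G z j)" for j
    using norming_bounds[OF g] tame_strip_function[OF tame_restrict[OF F]]
    by (intro strip_function_sum strip_function_mult strip_function_const strip_function_powr) auto

  show "t2norm V (?G (\<i> * of_real t)) \<le> 3 * C" if V: "finite V" for V t
  proof (rule power2_le_imp_le)
    let ?z = "\<i> * of_real t :: complex"
    let ?f = "\<lambda>j. (cmod (?G ?z j))\<^sup>2"
    have block: "tau_id (V \<inter> I i) ?f \<le> C\<^sup>2 * (a i)\<^sup>2" if i: "i \<in> J" for i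
    proof -
      have pw: "cmod (of_real (g (\<kappa> i)) powr ?z) \<le> 1"
        using norming_nonneg[OF g, of "\<kappa> i"] by (cases "g (\<kappa> i) = 0") (simp_all add: norm_powr_real_powr)
      have "t2norm (V \<inter> I i) (?G ?z) \<le> t2norm (V \<inter> I i) (\<lambda>j. of_real (a i) * F i ?z j)"
      proof (rule t2norm_mono)
        fix j assume "j \<in> V \<inter> I i"
        then have "cmod (?G ?z j) = a i * cmod (of_real (g (\<kappa> i)) powr ?z) * cmod (F i ?z j)"
          using single[OF i, of j ?z] e[of i] a[of i] by (simp add: norm_mult)
        also have "\<dots> \<le> a i * 1 * cmod (F i ?z j)"
          using pw a by (intro mult_right_mono mult_left_mono) auto
        finally show "cmod (?G ?z j) \<le> cmod (of_real (a i) * F i ?z j)"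
          using a[of i] by (simp add: norm_mult)
      qed (use V in auto)
      also have "\<dots> \<le> cmod (of_real (a i)) * t2norm (V \<inter> I i) (F i ?z)" by (rule t2norm_scale)
      also have "\<dots> \<le> a i * C" using a[of i] tame_left[OF F, of "V \<inter> I i" i t] V by (simp add: mult_left_mono)
      finally have "(t2norm (V \<inter> I i) (?G ?z))\<^sup>2 \<le> (a i * C)\<^sup>2"
        by (intro power_mono t2norm_nonneg)
      then show ?thesis by (simp add: t2norm_power2 power_mult_distrib mult.commute)
    qed
    show "(t2norm V (?G ?z))\<^sup>2 \<le> (3 * C)\<^sup>2"
      unfolding t2norm_power2
    proof (rule tau_least)
      fix g' assume g': "norming g'"
      have "(\<Sum>j\<in>V. g' j * ?f j) \<le> (\<Sum>j\<in>V. \<Sum>i\<in>J. if j \<in> I i then g' j * ?f j else 0)"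
      proof (rule sum_mono)
        fix j
        show "g' j * ?f j \<le> (\<Sum>i\<in>J. if j \<in> I i then g' j * ?f j else 0)"
        proof (cases "\<exists>i\<in>J. j \<in> I i")
          case True
          then obtain i where i: "i \<in> J" "j \<in> I i" by blast
          then have "g' j * ?f j = (if j \<in> I i then g' j * ?f j else 0)" by simp
          also have "\<dots> \<le> (\<Sum>i\<in>J. if j \<in> I i then g' j * ?f j else 0)"
            using i(1) J norming_nonneg[OF g'] by (intro member_le_sum) auto
          finally show ?thesis .
        next
          case False
          then have "?G ?z j = 0" by (intro sum.neutral) auto
          then have "?f j = 0" by simp
          then show ?thesis by (simp only: mult_zero_right if_cancel sum.neutral_const order_refl)
        qed
      qed
      also have "\<dots> = (\<Sum>i\<in>J. \<Sum>j\<in>V. if j \<in> I i then g' j * ?f j else 0)" by (rule sum.swap)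
      also have "\<dots> = (\<Sum>i\<in>J. \<Sum>j\<in>V \<inter> I i. g' j * ?f j)"
        using V by (simp only: sum.inter_restrict)
      also have "\<dots> \<le> 2 * tau (\<lambda>i. \<kappa> (Suc i)) J (\<lambda>i. C\<^sup>2 * (a i)\<^sup>2)"
        using block I by (intro upper_block_estimate[OF g' J V \<kappa>]) auto
      also have "\<dots> \<le> 2 * (C\<^sup>2 * tau (\<lambda>i. \<kappa> (Suc i)) J (\<lambda>i. (a i)\<^sup>2))"
        by (intro mult_left_mono tau_le_scale) auto
      also have "\<dots> \<le> 2 * (C\<^sup>2 * 4)" using tau_a by (intro mult_left_mono) auto
      \<comment> \<open>The block estimate contributes \<open>2\<close> and \<open>tau_a\<close>
        contributes \<open>4\<close>; \<open>8 \<le> 9\<close> explains the constant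
        \<open>3\<close>.\<close>
      also have "\<dots> \<le> (3 * C)\<^sup>2" by (simp add: power_mult_distrib)
      finally show "(\<Sum>j\<in>V. g' j * ?f j) \<le> (3 * C)\<^sup>2" .
    qed
  qed (use C in simp)

  show "cmod (\<Sum>j\<in>V. x j * ?G (1 + \<i> * of_real t) j) \<le> 3 * C * t2norm V x" if V: "finite V" for V t x
  proof -
    let ?z = "1 + \<i> * of_real t :: complex"
    let ?c = "\<lambda>i. e i * of_real (a i) * of_real (g (\<kappa> i)) powr ?z"
    let ?T = "\<lambda>i. t2norm (V \<inter> I i) x"
    have g0: "0 \<le> g (\<kappa> i)" for i using norming_nonneg[OF g] .
    have c: "cmod (?c i) = a i * g (\<kappa> i)" for i
      using e[of i] a[of i] g0[of i] by (cases "g (\<kappa> i) = 0") (simp_all add: norm_mult norm_powr_real_powr)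
    have "(\<Sum>j\<in>V. x j * ?G ?z j) = (\<Sum>j\<in>V. \<Sum>i\<in>J. ?c i * (x j * (if j \<in> I i then F i ?z j else 0)))"
      unfolding sum_distrib_left by (intro sum.cong refl) (simp only: mult_ac)
    also have "\<dots> = (\<Sum>i\<in>J. \<Sum>j\<in>V. ?c i * (x j * (if j \<in> I i then F i ?z j else 0)))" by (rule sum.swap)
    also have "\<dots> = (\<Sum>i\<in>J. ?c i * (\<Sum>j\<in>V \<inter> I i. x j * F i ?z j))"
      unfolding sum_distrib_left sum.inter_restrict[OF V] by (intro sum.cong refl) auto
    finally have "cmod (\<Sum>j\<in>V. x j * ?G ?z j) \<le> (\<Sum>i\<in>J. cmod (?c i * (\<Sum>j\<in>V \<inter> I i. x j * F i ?z j)))"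
      by (simp only: norm_sum)
    also have "\<dots> \<le> (\<Sum>i\<in>J. C * ((a i * sqrt (g (\<kappa> i))) * (sqrt (g (\<kappa> i)) * ?T i)))"
    proof (rule sum_mono)
      fix i
      have "cmod (?c i * (\<Sum>j\<in>V \<inter> I i. x j * F i ?z j))
          = (a i * g (\<kappa> i)) * cmod (\<Sum>j\<in>V \<inter> I i. x j * F i ?z j)"
        by (simp only: norm_mult[of "?c i"] c)
      also have "\<dots> \<le> (a i * g (\<kappa> i)) * (C * ?T i)"
      proof (rule mult_left_mono)
        show "cmod (\<Sum>j\<in>V \<inter> I i. x j * F i ?z j) \<le> C * ?T i"
          by (rule tame_right[OF F]) (simp add: V)
      qed (simp add: a g0)
      also have "\<dots> = C * ((a i * sqrt (g (\<kappa> i))) * (sqrt (g (\<kappa> i)) * ?T i))"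
      proof -
        have "g (\<kappa> i) = sqrt (g (\<kappa> i)) * sqrt (g (\<kappa> i))" using g0 by simp
        then show ?thesis by algebra
      qed
      finally show "cmod (?c i * (\<Sum>j\<in>V \<inter> I i. x j * F i ?z j))
          \<le> C * ((a i * sqrt (g (\<kappa> i))) * (sqrt (g (\<kappa> i)) * ?T i))" .
    qed
    also have "\<dots> = C * (\<Sum>i\<in>J. (a i * sqrt (g (\<kappa> i))) * (sqrt (g (\<kappa> i)) * ?T i))"
      by (simp only: sum_distrib_left)
    also have "\<dots> \<le> C * t2norm V x"
    proof (intro mult_left_mono C power2_le_imp_le[OF _ t2norm_nonneg])
      have "(\<Sum>i\<in>J. (a i * sqrt (g (\<kappa> i))) * (sqrt (g (\<kappa> i)) * ?T i))\<^sup>2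
          \<le> (\<Sum>i\<in>J. (a i * sqrt (g (\<kappa> i)))\<^sup>2) * (\<Sum>i\<in>J. (sqrt (g (\<kappa> i)) * ?T i)\<^sup>2)"
        by (rule Cauchy_Schwarz_ineq_sum)
      also have "(\<Sum>i\<in>J. (a i * sqrt (g (\<kappa> i)))\<^sup>2) = (\<Sum>i\<in>J. (a i)\<^sup>2 * g (\<kappa> i))"
        using g0 by (simp add: power_mult_distrib)
      also have "(\<Sum>i\<in>J. (sqrt (g (\<kappa> i)) * ?T i)\<^sup>2)
          = (\<Sum>i\<in>J. g (\<kappa> i) * tau_id (V \<inter> I i) (\<lambda>j. (cmod (x j))\<^sup>2))"
        using g0 by (simp add: power_mult_distrib t2norm_power2)
      also have "(\<Sum>i\<in>J. (a i)\<^sup>2 * g (\<kappa> i)) * \<dots> \<le> 1 * (t2norm V x)\<^sup>2"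
        unfolding t2norm_power2
        using ag g0 tau_nonneg[of "\<lambda>j. (cmod (x j))\<^sup>2"] lower_block_estimate[OF g J V \<kappa> _ I']
        by (intro mult_mono sum_nonneg mult_nonneg_nonneg) auto
      finally show "(\<Sum>i\<in>J. (a i * sqrt (g (\<kappa> i))) * (sqrt (g (\<kappa> i)) * ?T i))\<^sup>2 \<le> (t2norm V x)\<^sup>2" by simp
    qed
    also have "\<dots> \<le> 3 * C * t2norm V x" using C t2norm_nonneg[of V x] by (simp add: mult_right_mono)
    finally show ?thesis .
  qed
qed

text \<open>The norm of the averages on the positions \<open>k (i + s)\<close> increases with \<open>s\<close> from at least \<open>1 / 2 ^ D\<close>
  to at most \<open>1\<close>, so it at most doubles at some step \<open>s \<le> D\<close>. This makes up for the shift by one between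
  the lower and the upper block estimate.\<close>

lemma deep_combination:
  assumes k: "strict_mono k"
  shows "\<exists>s b a g. norming g \<and> (\<forall>i. 0 \<le> a i) \<and> tau (\<lambda>i. k (Suc i + s)) {..<b} (\<lambda>i. (a i)\<^sup>2) \<le> 4 \<and>
    (\<Sum>i<b. (a i)\<^sup>2 * g (k (i + s))) = 1 \<and>
    1 / 2 \<le> (\<Sum>i<b. if g (k (i + s)) \<le> (1 / 2) ^ D then (a i)\<^sup>2 * g (k (i + s)) else 0)"
proof -
  \<comment> \<open>With this error the shallow part is at most \<open>\<sigma> / 2\<close>, since
    \<open>\<sigma>\<close> will exceed \<open>\<Phi> s / 2\<close>, which is at least
    \<open>(1 / 2) ^ D / 2\<close>.\<close>
  have "(0::real) < (1 / 2) ^ D / 4" by simp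
  from repeated_averages[OF k this, of 0 D D]
  obtain b v where bv: "(\<forall>i. 0 \<le> v i) \<and> (\<Sum>i<b. v i) = 1 \<and> (1 / 2) ^ D \<le> tau k {..<b} v \<and>
    (\<forall>s\<le>D. \<forall>g. norming g \<longrightarrow>
      (\<Sum>i<b. if (1 / 2) ^ D < g (k (i + s)) then g (k (i + s)) * v i else 0) \<le> (1 / 2) ^ D / 4)"
    unfolding atLeast0LessThan by blast
  then have v: "\<And>i. 0 \<le> v i" "(\<Sum>i<b. v i) = 1" "(1 / 2) ^ D \<le> tau k {..<b} v"
    and sh: "\<And>s g. s \<le> D \<Longrightarrow> norming g \<Longrightarrow>
      (\<Sum>i<b. if (1 / 2) ^ D < g (k (i + s)) then g (k (i + s)) * v i else 0) \<le> (1 / 2) ^ D / 4"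
    by blast+
  define \<Phi> where "\<Phi> s = tau (\<lambda>i. k (i + s)) {..<b} v" for s
  have \<Phi>_le: "\<Phi> s \<le> 1" for s using tau_le_sum[where f=v and \<kappa>="\<lambda>i. k (i + s)" and J="{..<b}", OF v(1)] v(2) by (simp add: \<Phi>_def)
  have "\<exists>s\<le>D. \<Phi> (Suc s) \<le> 2 * \<Phi> s \<and> (1 / 2) ^ D \<le> \<Phi> s"
  proof (rule ccontr)
    assume no: "\<not> ?thesis"
    \<comment> \<open>More than doubling at each of \<open>D + 1\<close> steps would take the norm
      from \<open>(1 / 2) ^ D\<close> to at least \<open>2\<close>, above its bound
      \<open>1\<close>.\<close>
    have "2 ^ t * (1 / 2) ^ D \<le> \<Phi> t" if "t \<le> Suc D" for t
      using that
    proof (induction t)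
      case 0
      then show ?case using v(3) by (simp add: \<Phi>_def)
    next
      case (Suc t)
      have "1 * (1 / 2) ^ D \<le> (2 ^ t :: real) * (1 / 2) ^ D" by (intro mult_right_mono) auto
      moreover have IH: "2 ^ t * (1 / 2) ^ D \<le> \<Phi> t" using Suc by simp
      ultimately have "(1 / 2) ^ D \<le> \<Phi> t" by linarith
      moreover have "t \<le> D" using Suc.prems by simp
      ultimately have "2 * \<Phi> t < \<Phi> (Suc t)" using no not_le by blast
      then show ?case using IH by simp
    qed
    from this[of "Suc D"] have "2 \<le> \<Phi> (Suc D)" by (simp add: power_divide)
    then show False using \<Phi>_le[of "Suc D"] by simp
  qed
  then obtain s where s: "s \<le> D" "\<Phi> (Suc s) \<le> 2 * \<Phi> s" "(1 / 2) ^ D \<le> \<Phi> s" by blast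
  have pos: "0 < \<Phi> s" using s(3) zero_less_power[of "1 / 2 :: real" D] by linarith
  then have "\<Phi> s / 2 < tau (\<lambda>i. k (i + s)) {..<b} v" by (simp add: \<Phi>_def)
  then obtain g where g: "norming g" "\<Phi> s / 2 < (\<Sum>i<b. g (k (i + s)) * v i)" by (rule tau_approx)
  define \<sigma> where "\<sigma> = (\<Sum>i<b. g (k (i + s)) * v i)"
  have \<sigma>: "\<Phi> s / 2 < \<sigma>" "0 < \<sigma>" using g(2) pos by (simp_all add: \<sigma>_def)
  \<comment> \<open>Division by \<open>\<sigma>\<close> makes \<open>g\<close> take the value
    \<open>1\<close> on the squares. The bound \<open>4\<close> below has one factor
    \<open>2\<close> from the step from \<open>s\<close> to \<open>Suc s\<close> and one because
    \<open>g\<close> attains only half of the norm.\<close>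
  define a where "a i = sqrt (v i / \<sigma>)" for i
  have a2: "(a i)\<^sup>2 = (1 / \<sigma>) * v i" for i using v(1)[of i] \<sigma> by (simp add: a_def)
  have "tau (\<lambda>i. k (Suc i + s)) {..<b} (\<lambda>i. (a i)\<^sup>2) \<le> (1 / \<sigma>) * \<Phi> (Suc s)"
    unfolding a2 using tau_le_scale[where f=v and c="1 / \<sigma>" and \<kappa>="\<lambda>i. k (Suc i + s)" and J="{..<b}", OF v(1)] \<sigma>(2) by (simp add: \<Phi>_def)
  also have "\<dots> \<le> (1 / \<sigma>) * (4 * \<sigma>)" using \<sigma> s(2) by (intro mult_left_mono) auto
  finally have tau_a: "tau (\<lambda>i. k (Suc i + s)) {..<b} (\<lambda>i. (a i)\<^sup>2) \<le> 4" using \<sigma> by simp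
  have total: "(\<Sum>i<b. (a i)\<^sup>2 * g (k (i + s))) = 1"
  proof -
    have "(\<Sum>i<b. (a i)\<^sup>2 * g (k (i + s))) = (1 / \<sigma>) * \<sigma>"
      unfolding a2 \<sigma>_def[of] sum_distrib_left by (intro sum.cong refl) (simp add: mult.commute)
    then show ?thesis using \<sigma> by simp
  qed
  have "(\<Sum>i<b. (a i)\<^sup>2 * g (k (i + s))) = (\<Sum>i<b. if g (k (i + s)) \<le> (1 / 2) ^ D then (a i)\<^sup>2 * g (k (i + s)) else 0)
      + (1 / \<sigma>) * (\<Sum>i<b. if (1 / 2) ^ D < g (k (i + s)) then g (k (i + s)) * v i else 0)"
    unfolding sum_distrib_left sum.distrib[symmetric] by (intro sum.cong refl) (auto simp: a2)
  moreover have "(1 / \<sigma>) * (\<Sum>i<b. if (1 / 2) ^ D < g (k (i + s)) then g (k (i + s)) * v i else 0) \<le> 1 / 2"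
  proof -
    have "(\<Sum>i<b. if (1 / 2) ^ D < g (k (i + s)) then g (k (i + s)) * v i else 0) \<le> \<sigma> / 2"
      using sh[OF s(1) g(1)] s(3) \<sigma>(1) by linarith
    then show ?thesis using \<sigma>(2) by (simp add: field_simps)
  qed
  ultimately have "1 / 2 \<le> (\<Sum>i<b. if g (k (i + s)) \<le> (1 / 2) ^ D then (a i)\<^sup>2 * g (k (i + s)) else 0)"
    using total by linarith
  then show ?thesis using g(1) tau_a total v(1) \<sigma>(2) by (intro exI[of _ s] exI[of _ b] exI[of _ a] exI[of _ g]) (simp add: a_def)
qed

subsection \<open>Gliding hump\<close>

lemma nrm_ell2_nonneg: "y \<in> pts ell2 \<Longrightarrow> 0 \<le> nrm ell2 y"
  by (simp add: ell2_def suminf_nonneg)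

lemma sum_le_nrm_ell2:
  assumes "y \<in> pts ell2" "finite V"
  shows "(\<Sum>j\<in>V. (cmod (y j))\<^sup>2) \<le> (nrm ell2 y)\<^sup>2"
  using assms by (simp add: ell2_def sum_le_suminf suminf_nonneg)

lemma ell2_bound:
  assumes "\<And>V. finite V \<Longrightarrow> (\<Sum>j\<in>V. (cmod (y j))\<^sup>2) \<le> M\<^sup>2" "0 \<le> M"
  shows "y \<in> pts ell2" "nrm ell2 y \<le> M"
proof -
  have sm: "summable (\<lambda>j. (cmod (y j))\<^sup>2)"
    by (rule summableI_nonneg_bounded[where x="M\<^sup>2"]) (simp_all add: assms(1))
  then show "y \<in> pts ell2" by (simp add: ell2_def)
  have "(\<Sum>j. (cmod (y j))\<^sup>2) \<le> M\<^sup>2" using sm assms(1) by (intro suminf_le_const) simp_all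
  then show "nrm ell2 y \<le> M" using assms(2) by (simp add: ell2_def real_le_lsqrt)
qed

lemma nrm_ell2_eq_0:
  assumes "y \<in> pts ell2" "nrm ell2 y = 0"
  shows "y = 0"
proof
  fix j
  have "(\<Sum>j\<in>{j}. (cmod (y j))\<^sup>2) \<le> 0" using sum_le_nrm_ell2[OF assms(1), of "{j}"] assms(2) by simp
  then show "y j = 0 j" by simp
qed

lemma nrm_ell2_scale:
  assumes "y \<in> pts ell2"
  shows "nrm ell2 (seq_scale c y) = cmod c * nrm ell2 y"
proof -
  have "(\<Sum>j. (cmod c)\<^sup>2 * (cmod (y j))\<^sup>2) = (cmod c)\<^sup>2 * (\<Sum>j. (cmod (y j))\<^sup>2)"
    using assms by (intro suminf_mult) (simp add: ell2_def)
  then show ?thesis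
    by (simp add: ell2_def seq_scale_def norm_mult power_mult_distrib real_sqrt_mult)
qed

lemma ell2_tail:
  assumes y: "y \<in> pts ell2" and "0 < d"
  shows "\<exists>n\<ge>m. restrict_seq {n..} y \<in> pts ell2 \<and> nrm ell2 (restrict_seq {n..} y) \<le> d"
proof -
  let ?f = "\<lambda>j. (cmod (y j))\<^sup>2"
  have sm: "summable ?f" using y by (simp add: ell2_def)
  then have "(\<lambda>n. \<Sum>j<n. ?f j) \<longlonglongrightarrow> suminf ?f" by (rule summable_LIMSEQ)
  moreover have "suminf ?f - d\<^sup>2 < suminf ?f" using assms(2) by simp
  ultimately have "\<forall>\<^sub>F n in sequentially. suminf ?f - d\<^sup>2 < (\<Sum>j<n. ?f j)" by (rule order_tendstoD)
  then have "\<forall>\<^sub>F n in sequentially. m \<le> n \<and> suminf ?f - d\<^sup>2 < (\<Sum>j<n. ?f j)"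
    using eventually_ge_at_top[of m] by eventually_elim simp
  then obtain n where n: "m \<le> n" "suminf ?f - d\<^sup>2 < (\<Sum>j<n. ?f j)"
    using eventually_happens by (metis (no_types, lifting) trivial_limit_sequentially)
  have "(\<Sum>j\<in>V. (cmod (restrict_seq {n..} y j))\<^sup>2) \<le> d\<^sup>2" if V: "finite V" for V
  proof -
    have "(\<Sum>j\<in>V. (cmod (restrict_seq {n..} y j))\<^sup>2) = (\<Sum>j\<in>V \<inter> {n..}. ?f j)"
      using V by (auto simp: restrict_seq_def sum.inter_restrict intro!: sum.cong)
    moreover have "(\<Sum>j\<in>V \<inter> {n..}. ?f j) + (\<Sum>j<n. ?f j) = (\<Sum>j\<in>(V \<inter> {n..}) \<union> {..<n}. ?f j)"
      using V by (intro sum.union_disjoint[symmetric]) auto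
    moreover have "\<dots> \<le> suminf ?f" using V by (intro sum_le_suminf sm) auto
    ultimately show ?thesis using n(2) by linarith
  qed
  from ell2_bound[OF this] show ?thesis using n(1) assms(2) by (intro exI[of _ n]) auto
qed

text \<open>Used in contrapositive form: an infinite-dimensional subspace contains nonzero elements
  whose second component vanishes on a given initial segment. Each coordinate is a linear
  functional, and passing to its kernel loses at most one spanning vector.\<close>

lemma finite_codimension:
  assumes E: "module.subspace pair_scale E"
    and zero: "\<And>p. p \<in> E \<Longrightarrow> \<forall>j<m. snd p j = 0 \<Longrightarrow> p = 0"
  shows "\<exists>S. finite S \<and> E \<subseteq> module.span pair_scale S"
proof -
  interpret vs: vector_space pair_scale by (rule vector_space_pair_scale)
  show ?thesis
    using assms
  proof (induction m arbitrary: E)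
    case 0
    then have "E \<subseteq> vs.span {}" by auto
    then show ?case by blast
  next
    case (Suc m)
    define E' where "E' = {p \<in> E. snd p m = 0}"
    have "vs.subspace E'"
      using Suc.prems(1) unfolding vs.subspace_def E'_def
      by (auto simp: pair_scale_def seq_scale_def)
    moreover have "p = 0" if "p \<in> E'" "\<forall>j<m. snd p j = 0" for p
      using that Suc.prems(2)[of p] by (auto simp: E'_def less_Suc_eq)
    ultimately obtain S where S: "finite S" "E' \<subseteq> vs.span S" using Suc.IH by blast
    show ?case
    proof (cases "E \<subseteq> E'")
      case True
      then show ?thesis using S by blast
    next
      case False
      then obtain q where q: "q \<in> E" "snd q m \<noteq> 0" by (auto simp: E'_def)
      have "p \<in> vs.span (insert q S)" if "p \<in> E" for p
      proof -
        let ?c = "snd p m / snd q m"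
        have "p - pair_scale ?c q \<in> E"
          using Suc.prems(1) that q(1) by (intro vs.subspace_diff vs.subspace_scale)
        then have "p - pair_scale ?c q \<in> E'"
          using q(2) by (simp add: E'_def pair_scale_def seq_scale_def)
        then have "p - pair_scale ?c q \<in> vs.span (insert q S)"
          using S(2) vs.span_mono[of S "insert q S"] by blast
        then have "(p - pair_scale ?c q) + pair_scale ?c q \<in> vs.span (insert q S)"
          by (rule vs.span_add[OF _ vs.span_scale[OF vs.span_base]]) simp
        then show ?thesis by simp
      qed
      then show ?thesis using S(1) by (intro exI[of _ "insert q S"]) auto
    qed
  qed
qed

text \<open>A nonzero element of \<open>E\<close> has nonzero second component by injectivity of
  \<open>snd\<close>, so it can be normalized and its tail made small.
  \<open>2 * l i \<le> k (Suc i)\<close> is the doubling demanded by the upper block estimate, and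
  the bounds on the tails have sum \<open>1\<close>.\<close>

lemma gliding_hump:
  assumes E: "module.subspace pair_scale E" and inf: "infinite_dimensional pair_scale E"
    and inj: "inj_on snd E" and ell2: "\<And>p. p \<in> E \<Longrightarrow> snd p \<in> pts ell2"
  shows "\<exists>k l p. strict_mono k \<and> (\<forall>i. k i \<le> l i \<and> 2 * l i \<le> k (Suc i) \<and> p i \<in> E \<and>
    nrm ell2 (snd (p i)) = 1 \<and> (\<forall>j<k i. snd (p i) j = 0) \<and>
    restrict_seq {l i..} (snd (p i)) \<in> pts ell2 \<and>
    nrm ell2 (restrict_seq {l i..} (snd (p i))) \<le> (1 / 2) ^ Suc i)"
proof -
  interpret vs: vector_space pair_scale by (rule vector_space_pair_scale)
  have hump: "\<exists>p n. p \<in> E \<and> nrm ell2 (snd p) = 1 \<and> (\<forall>j<m. snd p j = 0) \<and> m \<le> n \<and>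
      restrict_seq {n..} (snd p) \<in> pts ell2 \<and> nrm ell2 (restrict_seq {n..} (snd p)) \<le> d"
    if "0 < d" for m :: nat and d :: real
  proof -
    obtain q where q: "q \<in> E" "\<forall>j<m. snd q j = 0" "q \<noteq> 0"
      using finite_codimension[OF E, of m] inf unfolding infinite_dimensional_def by blast
    have "snd q \<noteq> 0"
      using inj q(1,3) vs.subspace_0[OF E] by (metis inj_onD snd_zero)
    then have c: "0 < nrm ell2 (snd q)"
      using nrm_ell2_eq_0[OF ell2[OF q(1)]] nrm_ell2_nonneg[OF ell2[OF q(1)]] by fastforce
    define p where "p = pair_scale (of_real (1 / nrm ell2 (snd q))) q"
    have p: "p \<in> E" unfolding p_def by (intro vs.subspace_scale E q)
    have "nrm ell2 (snd p) = 1"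
      unfolding p_def pair_scale_def using c nrm_ell2_scale[OF ell2[OF q(1)]] by (simp del: of_real_divide)
    moreover have "\<forall>j<m. snd p j = 0" using q(2) by (simp add: p_def pair_scale_def seq_scale_def)
    ultimately show ?thesis using p ell2_tail[OF ell2[OF p] that, of m] by blast
  qed
  define good where "good m i q n \<longleftrightarrow> q \<in> E \<and> nrm ell2 (snd q) = 1 \<and> (\<forall>j<m. snd q j = 0) \<and> m \<le> n \<and>
      restrict_seq {n..} (snd q) \<in> pts ell2 \<and> nrm ell2 (restrict_seq {n..} (snd q)) \<le> (1 / 2) ^ Suc i"
    for m n i :: nat and q
  have "\<exists>q n. good m i q n" for m i unfolding good_def by (rule hump) simp
  then obtain q n where qn: "\<And>m i. good m i (q m i) (n m i)" by metis
  \<comment> \<open>\<open>Suc\<close> makes \<open>k\<close> strictly increasing even when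
    \<open>n m i = 0\<close>.\<close>
  define k where "k = rec_nat 0 (\<lambda>i m. Suc (2 * n m i))"
  have kS: "k (Suc i) = Suc (2 * n (k i) i)" for i by (simp add: k_def)
  have good: "good (k i) i (q (k i) i) (n (k i) i)" for i by (rule qn)
  have "k i < k (Suc i)" for i using good[of i] unfolding kS good_def by linarith
  then have "strict_mono k" by (simp add: strict_mono_Suc_iff)
  then show ?thesis
    using good unfolding good_def by (intro exI[of _ k] exI[of _ "\<lambda>i. n (k i) i"] exI[of _ "\<lambda>i. q (k i) i"]) (simp add: kS)
qed

subsection \<open>Strict singularity\<close>

lemma L2_set_le: "(\<Sum>j\<in>V. (f j)\<^sup>2) \<le> m\<^sup>2 \<Longrightarrow> 0 \<le> m \<Longrightarrow> L2_set f V \<le> m"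
  unfolding L2_set_def by (rule real_le_lsqrt) (auto intro: sum_nonneg)

lemma L2_set_power2: "(L2_set f V)\<^sup>2 = (\<Sum>j\<in>V. (f j)\<^sup>2)"
  by (simp add: L2_set_def sum_nonneg)

lemma L2_set_norm_triangle:
  "L2_set (\<lambda>j. cmod (x j + y j)) V \<le> L2_set (\<lambda>j. cmod (x j)) V + L2_set (\<lambda>j. cmod (y j)) V"
  using L2_set_mono[of V "\<lambda>j. cmod (x j + y j)" "\<lambda>j. cmod (x j) + cmod (y j)"]
    L2_set_triangle_ineq[of "\<lambda>j. cmod (x j)" "\<lambda>j. cmod (y j)" V]
  by (simp add: norm_triangle_ineq)

lemma sum_geometric_half_le_1: "(\<Sum>i<b. (1 / 2 :: real) ^ Suc i) \<le> 1"
proof -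
  have "(\<Sum>i<b. (1 / 2 :: real) ^ Suc i) = 1 - (1 / 2) ^ b" by (induction b) (auto simp: field_simps)
  then show ?thesis by simp
qed

lemma sum_pair_scale:
  "fst (\<Sum>i\<in>J. pair_scale (c i) (p i)) j = (\<Sum>i\<in>J. c i * fst (p i) j)"
  "snd (\<Sum>i\<in>J. pair_scale (c i) (p i)) j = (\<Sum>i\<in>J. c i * snd (p i) j)"
  by (induction J rule: infinite_finite_induct) (simp_all add: pair_scale_def seq_scale_def)

lemma Omega_has_field_derivative:
  assumes "tame (B y) M"
  shows "((\<lambda>z. B y z j) has_field_derivative Omega B y j) (at (1 / 2))"
  using tame_strip_function[OF assms, of j] holomorphic_derivI[OF _ open_interior half_in_interior_strip]
  unfolding strip_function_def Omega_def by blast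

text \<open>The right-hand side does not depend on \<open>D\<close>, which gives the contradiction.
  Assumption \<open>triv\<close> is the form in which continuity of the inverse of
  \<open>snd\<close> on \<open>E\<close> enters.\<close>

lemma logarithm_bound:
  assumes C: "0 \<le> C" and K: "0 \<le> K"
    and B: "\<And>y. y \<in> pts ell2 \<Longrightarrow> tame (B y) (C * nrm ell2 y)" "\<And>y. y \<in> pts ell2 \<Longrightarrow> B y (1 / 2) = y"
    and E: "module.subspace pair_scale E" "\<And>p. p \<in> E \<Longrightarrow> snd p \<in> pts ell2"
    and triv: "\<And>p V. p \<in> E \<Longrightarrow> finite V \<Longrightarrow>
      (\<Sum>j\<in>V. (cmod (fst p j - Omega B (snd p) j))\<^sup>2) \<le> (K * nrm ell2 (snd p))\<^sup>2"
    and k: "strict_mono k" and kl: "\<And>i. k i \<le> l i" "\<And>i. 2 * l i \<le> k (Suc i)"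
    and p: "\<And>i. p i \<in> E" "\<And>i. nrm ell2 (snd (p i)) = 1" "\<And>i j. j < k i \<Longrightarrow> snd (p i) j = 0"
    and r: "\<And>i. restrict_seq {l i..} (snd (p i)) \<in> pts ell2"
      "\<And>i. nrm ell2 (restrict_seq {l i..} (snd (p i))) \<le> (1 / 2) ^ Suc i"
  shows "(real D * ln 2)\<^sup>2 / 2 \<le> 8 * (2 * (4 * C + C * (4 * C)) + K * (4 * C))\<^sup>2 + 8 * (K + 2 * C)\<^sup>2"
proof -
  interpret vs: vector_space pair_scale by (rule vector_space_pair_scale)
  obtain s b a g where g: "norming g" and a: "\<And>i. 0 \<le> a i"
    and tau_a: "tau (\<lambda>i. k (Suc i + s)) {..<b} (\<lambda>i. (a i)\<^sup>2) \<le> 4"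
    and total: "(\<Sum>i<b. (a i)\<^sup>2 * g (k (i + s))) = 1"
    and deep: "1 / 2 \<le> (\<Sum>i<b. if g (k (i + s)) \<le> (1 / 2) ^ D then (a i)\<^sup>2 * g (k (i + s)) else 0)"
    using deep_combination[OF k, of D] by blast
  define \<kappa> where "\<kappa> i = k (i + s)" for i
  define I where "I i = {\<kappa> i..<l (i + s)}" for i
  define W where "W i = snd (p (i + s))" for i
  define X where "X i = fst (p (i + s))" for i
  define R where "R i = restrict_seq {l (i + s)..} (W i)" for i
  define c where "c i = a i * sqrt (g (\<kappa> i))" for i
  define L where "L i = ln (g (\<kappa> i))" for i
  \<comment> \<open>What the \<open>i\<close>-th block and tail contribute to the derivative,
    without the sign, minus the first component, which stands in for \<open>Omega\<close> because it
    is linear on \<open>E\<close>. No sign occurs in \<open>u\<close>, so the signs can be chosen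
    from it before the functions are built.\<close>
  define u where "u i j = of_real (c i) *
    ((if j \<in> I i then of_real (L i) * W i j + Omega B (W i) j else 0) + Omega B (R i) j - X i j)" for i j
  define V where "V = (\<Union>i<b. I i)"
  have V: "finite V" by (simp add: V_def I_def)
  have \<kappa>: "strict_mono \<kappa>" using k by (simp add: \<kappa>_def strict_mono_def)
  have I: "\<kappa> i \<le> j \<and> 2 * Suc j \<le> \<kappa> (Suc i)" if "j \<in> I i" for i j
    using that kl(2)[of "i + s"] by (auto simp: I_def \<kappa>_def)
  have g0: "0 \<le> g n" for n using norming_nonneg[OF g] .
  have W: "W i \<in> pts ell2" "nrm ell2 (W i) = 1" "\<And>j. j < \<kappa> i \<Longrightarrow> W i j = 0" for i
    using E(2)[OF p(1)] p(2,3) by (auto simp: W_def \<kappa>_def)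
  have R: "R i \<in> pts ell2" "nrm ell2 (R i) \<le> (1 / 2) ^ Suc i" "0 \<le> nrm ell2 (R i)" for i
  proof -
    show R1: "R i \<in> pts ell2" using r(1) by (simp add: R_def W_def)
    have "(1 / 2 :: real) ^ Suc (i + s) \<le> (1 / 2) ^ Suc i" by (rule power_decreasing) auto
    then show "nrm ell2 (R i) \<le> (1 / 2) ^ Suc i" using r(2)[of "i + s"] unfolding R_def W_def by linarith
    show "0 \<le> nrm ell2 (R i)" by (rule nrm_ell2_nonneg[OF R1])
  qed
  have W_split: "W i j = (if j \<in> I i then W i j else 0) + R i j" for i j
    using W(3)[of j i] kl(1)[of "i + s"] by (auto simp: I_def R_def restrict_seq_def not_le)
  have c0: "0 \<le> c i" and c2: "(c i)\<^sup>2 = (a i)\<^sup>2 * g (\<kappa> i)" for i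
    using a[of i] g0[of "\<kappa> i"] by (simp_all add: c_def power_mult_distrib)
  have c_total: "(\<Sum>i<b. (c i)\<^sup>2) = 1" using total by (simp add: c2 \<kappa>_def)
  have c_le: "c i \<le> 1" if "i < b" for i
  proof (rule power2_le_imp_le)
    show "(c i)\<^sup>2 \<le> 1\<^sup>2"
      using member_le_sum[of i "{..<b}" "\<lambda>i. (c i)\<^sup>2"] that c_total by simp
  qed simp

  obtain e where e: "\<And>i. cmod (e i) = 1"
    and signs: "(\<Sum>i<b. \<Sum>j\<in>V. (cmod (u i j))\<^sup>2) \<le> (\<Sum>j\<in>V. (cmod (\<Sum>i<b. e i * u i j))\<^sup>2)"
    using sign_choice[of "{..<b}" u V] by blast
  define q where "q = (\<Sum>i<b. pair_scale (e i * of_real (c i)) (p (i + s)))"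
  have q: "q \<in> E" unfolding q_def by (intro vs.subspace_sum[OF E(1)] vs.subspace_scale[OF E(1)] p(1))
  have q_fst: "fst q j = (\<Sum>i<b. e i * of_real (c i) * X i j)"
    and q_snd: "snd q j = (\<Sum>i<b. e i * of_real (c i) * W i j)" for j
    by (simp_all add: q_def sum_pair_scale X_def W_def)

  define T1 where "T1 z j = (\<Sum>i<b. e i * of_real (a i) * of_real (g (\<kappa> i)) powr z *
    (if j \<in> I i then B (W i) z j else 0))" for z j
  \<comment> \<open>A local function, not the space of that name. It puts back the tails cut off
    from the blocks, so that the value at \<open>1 / 2\<close> is exactly \<open>snd q\<close>; the
    geometric decay of the tails keeps its bound at \<open>C\<close>.\<close>
  define T2 where "T2 z j = (\<Sum>i<b. e i * of_real (c i) * B (R i) z j)" for z j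
  have T1: "tame T1 (3 * C)"
    unfolding T1_def
  proof (rule tame_block_sum[OF \<kappa> I _ _ g])
    show "tame (B (W i)) C" for i using B(1)[OF W(1)[of i]] W(2)[of i] by simp
    show "tau (\<lambda>i. \<kappa> (Suc i)) {..<b} (\<lambda>i. (a i)\<^sup>2) \<le> 4" using tau_a by (simp add: \<kappa>_def)
    show "(\<Sum>i<b. (a i)\<^sup>2 * g (\<kappa> i)) \<le> 1" using total by (simp add: \<kappa>_def)
  qed (use e a in auto)
  have T2: "tame T2 C"
  proof (rule tame_mono)
    show "tame T2 (\<Sum>i<b. cmod (e i * of_real (c i)) * (C * nrm ell2 (R i)))"
      unfolding T2_def by (intro tame_sum tame_scale B(1) R(1))
    have "(\<Sum>i<b. cmod (e i * of_real (c i)) * (C * nrm ell2 (R i))) \<le> (\<Sum>i<b. C * (1 / 2) ^ Suc i)"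
    proof (rule sum_mono)
      fix i assume "i \<in> {..<b}"
      then have "cmod (e i * of_real (c i)) * (C * nrm ell2 (R i)) \<le> 1 * (C * (1 / 2) ^ Suc i)"
        using e[of i] c0[of i] c_le[of i] C R(2,3)[of i]
        by (intro mult_mono mult_left_mono) (auto simp: norm_mult)
      then show "cmod (e i * of_real (c i)) * (C * nrm ell2 (R i)) \<le> C * (1 / 2) ^ Suc i" by simp
    qed
    also have "\<dots> \<le> C * 1"
      unfolding sum_distrib_left[symmetric] by (intro mult_left_mono sum_geometric_half_le_1 C)
    finally show "(\<Sum>i<b. cmod (e i * of_real (c i)) * (C * nrm ell2 (R i))) \<le> C" by simp
  qed
  have T: "tame (\<lambda>z j. T1 z j + T2 z j) (4 * C)" using tame_add[OF T1 T2] by simp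
  have T_half: "T1 (1 / 2) j + T2 (1 / 2) j = snd q j" for j
    unfolding T1_def T2_def q_snd sum.distrib[symmetric]
  proof (intro sum.cong refl)
    fix i
    have "e i * of_real (a i) * of_real (g (\<kappa> i)) powr (1 / 2) * (if j \<in> I i then B (W i) (1 / 2) j else 0)
        + e i * of_real (c i) * B (R i) (1 / 2) j
        = e i * of_real (c i) * ((if j \<in> I i then W i j else 0) + R i j)"
      using of_real_powr_half[OF g0] B(2)[OF W(1)] B(2)[OF R(1)]
      by (simp add: c_def algebra_simps)
    then show "e i * of_real (a i) * of_real (g (\<kappa> i)) powr (1 / 2) * (if j \<in> I i then B (W i) (1 / 2) j else 0)
        + e i * of_real (c i) * B (R i) (1 / 2) j = e i * of_real (c i) * W i j"
      using W_split[of i j] by simp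
  qed
  \<comment> \<open>The vectors \<open>W i\<close> overlap through their tails, so the norm of the
    combination is read off from the tame function instead of orthogonality.\<close>
  have q_ell2: "snd q \<in> pts ell2" "nrm ell2 (snd q) \<le> 4 * C"
  proof -
    have "(\<Sum>j\<in>V. (cmod (snd q j))\<^sup>2) \<le> (4 * C)\<^sup>2" if "finite V" for V
      using tame_half[OF T that] by (simp add: T_half)
    from ell2_bound[OF this] show "snd q \<in> pts ell2" "nrm ell2 (snd q) \<le> 4 * C" using C by auto
  qed

  define H where "H z j = (T1 z j + T2 z j) + (- 1) * B (snd q) z j" for z j
  have H: "tame H (4 * C + C * (4 * C))"
  proof (rule tame_mono)
    show "tame H (4 * C + cmod (- 1) * (C * nrm ell2 (snd q)))"
      unfolding H_def by (intro tame_add[OF T] tame_scale B(1) q_ell2(1))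
    show "4 * C + cmod (- 1) * (C * nrm ell2 (snd q)) \<le> 4 * C + C * (4 * C)"
      using q_ell2(2) C by (simp add: mult_left_mono)
  qed
  define H' where "H' j = (\<Sum>i<b. e i * of_real (c i) *
      (if j \<in> I i then of_real (L i) * W i j + Omega B (W i) j else 0))
    + (\<Sum>i<b. e i * of_real (c i) * Omega B (R i) j) + (- 1) * Omega B (snd q) j" for j
  have H_deriv: "((\<lambda>z. H z j) has_field_derivative H' j) (at (1 / 2))" for j
  proof -
    have "((\<lambda>z. e i * of_real (a i) * of_real (g (\<kappa> i)) powr z * (if j \<in> I i then B (W i) z j else 0))
      has_field_derivative e i * of_real (c i) * (if j \<in> I i then of_real (L i) * W i j + Omega B (W i) j else 0))
      (at (1 / 2))" for i
    proof (cases "j \<in> I i")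
      case True
      have "((\<lambda>z. e i * of_real (a i) * of_real (g (\<kappa> i)) powr z * B (W i) z j) has_field_derivative
          e i * of_real (a i) * of_real (ln (g (\<kappa> i)) * sqrt (g (\<kappa> i))) * B (W i) (1 / 2) j
          + Omega B (W i) j * (e i * of_real (a i) * of_real (g (\<kappa> i)) powr (1 / 2))) (at (1 / 2))"
        by (rule DERIV_mult[OF DERIV_cmult[OF has_field_derivative_of_real_powr_half[OF g0]]
              Omega_has_field_derivative[where B=B, OF B(1)[OF W(1)]]])
      then show ?thesis
        using True B(2)[OF W(1)] of_real_powr_half[OF g0]
        by (simp add: c_def L_def algebra_simps)
    qed simp
    then show ?thesis
      unfolding H_def H'_def T1_def T2_def
      by (intro DERIV_add DERIV_sum DERIV_cmult Omega_has_field_derivative[where B=B, OF B(1)] R(1) q_ell2(1))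
  qed
  have H_half: "H (1 / 2) j = 0" for j using B(2)[OF q_ell2(1)] by (simp add: H_def T_half)
  have H'_le: "L2_set (\<lambda>j. cmod (H' j)) V \<le> 2 * (4 * C + C * (4 * C))"
    using tame_deriv[OF H H_half V] DERIV_imp_deriv[OF H_deriv] tame_nonneg[OF H]
    by (intro L2_set_le) simp_all

  have sum_u: "(\<Sum>i<b. e i * u i j) = H' j + (Omega B (snd q) j - fst q j)" for j
  proof -
    have "(\<Sum>i<b. e i * u i j) = (\<Sum>i<b. e i * of_real (c i) *
        (if j \<in> I i then of_real (L i) * W i j + Omega B (W i) j else 0)
      + e i * of_real (c i) * Omega B (R i) j - e i * of_real (c i) * X i j)"
      unfolding u_def by (intro sum.cong refl) (simp add: algebra_simps)
    then show ?thesis by (simp add: H'_def q_fst sum.distrib sum_subtractf)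
  qed
  have "L2_set (\<lambda>j. cmod (\<Sum>i<b. e i * u i j)) V
      \<le> L2_set (\<lambda>j. cmod (H' j)) V + L2_set (\<lambda>j. cmod (Omega B (snd q) j - fst q j)) V"
    unfolding sum_u by (rule L2_set_norm_triangle)
  also have "L2_set (\<lambda>j. cmod (Omega B (snd q) j - fst q j)) V \<le> K * (4 * C)"
  proof -
    have "L2_set (\<lambda>j. cmod (Omega B (snd q) j - fst q j)) V \<le> K * nrm ell2 (snd q)"
      using triv[OF q V] K nrm_ell2_nonneg[OF q_ell2(1)]
      by (intro L2_set_le) (simp_all add: norm_minus_commute)
    also have "\<dots> \<le> K * (4 * C)" using q_ell2(2) K by (rule mult_left_mono)
    finally show ?thesis .
  qed
  finally have "L2_set (\<lambda>j. cmod (\<Sum>i<b. e i * u i j)) V \<le> 2 * (4 * C + C * (4 * C)) + K * (4 * C)"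
    using H'_le by simp
  then have "(L2_set (\<lambda>j. cmod (\<Sum>i<b. e i * u i j)) V)\<^sup>2 \<le> (2 * (4 * C + C * (4 * C)) + K * (4 * C))\<^sup>2"
    by (intro power_mono L2_set_nonneg)
  then have u_total: "(\<Sum>i<b. \<Sum>j\<in>V. (cmod (u i j))\<^sup>2) \<le> (2 * (4 * C + C * (4 * C)) + K * (4 * C))\<^sup>2"
    using signs unfolding L2_set_power2 by linarith

  \<comment> \<open>On its own block \<open>u i\<close> is the logarithmic term up to two errors:
    \<open>X i - Omega B (W i)\<close> costs \<open>K\<close> by \<open>triv\<close>, and
    \<open>Omega B (R i)\<close> costs \<open>2 * C\<close>. Both carry the factor
    \<open>c i\<close>, hence are square summable over \<open>i\<close>.\<close>
  have block: "(c i * L i)\<^sup>2 / 4 \<le> 2 * (\<Sum>j\<in>V. (cmod (u i j))\<^sup>2) + 2 * (c i)\<^sup>2 * (K + 2 * C)\<^sup>2"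
    if i: "i < b" for i
  proof -
    have fin: "finite (I i)" "I i \<subseteq> V" using i by (auto simp: I_def V_def)
    define U where "U = L2_set (\<lambda>j. cmod (u i j)) (I i)"
    have U: "U\<^sup>2 \<le> (\<Sum>j\<in>V. (cmod (u i j))\<^sup>2)"
      unfolding U_def L2_set_power2 using fin V by (intro sum_mono2) auto
    define S where "S = (\<Sum>j\<in>I i. (cmod (W i j))\<^sup>2)"
    have S0: "0 \<le> S" by (simp add: S_def sum_nonneg)
    have "(\<Sum>j\<in>V'. (cmod (W i j))\<^sup>2) \<le> (sqrt (S + 1 / 4))\<^sup>2" if V': "finite V'" for V'
    proof -
      have "(cmod (W i j))\<^sup>2 = (if j \<in> I i then (cmod (W i j))\<^sup>2 else 0) + (cmod (R i j))\<^sup>2" for j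
        using W_split[of i j] by (cases "j \<in> I i") (auto simp: I_def R_def restrict_seq_def)
      then have "(\<Sum>j\<in>V'. (cmod (W i j))\<^sup>2)
          = (\<Sum>j\<in>V'. if j \<in> I i then (cmod (W i j))\<^sup>2 else 0) + (\<Sum>j\<in>V'. (cmod (R i j))\<^sup>2)"
        unfolding sum.distrib[symmetric] by (rule sum.cong[OF refl])
      also have "(\<Sum>j\<in>V'. if j \<in> I i then (cmod (W i j))\<^sup>2 else 0) = (\<Sum>j\<in>V' \<inter> I i. (cmod (W i j))\<^sup>2)"
        using V' by (simp only: sum.inter_restrict)
      also have "\<dots> \<le> S" unfolding S_def using fin by (intro sum_mono2) auto
      also have "(\<Sum>j\<in>V'. (cmod (R i j))\<^sup>2) \<le> (nrm ell2 (R i))\<^sup>2" by (rule sum_le_nrm_ell2[OF R(1) V'])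
      also have "\<dots> \<le> (1 / 2)\<^sup>2"
      proof (rule power_mono)
        have "(1 / 2 :: real) ^ Suc i \<le> (1 / 2) ^ Suc 0" by (rule power_decreasing) auto
        then show "nrm ell2 (R i) \<le> 1 / 2" using R(2)[of i] by simp
      qed (rule R(3))
      finally show ?thesis using S0 by (simp add: power_divide)
    qed
    from ell2_bound(2)[OF this] have "1 \<le> sqrt (S + 1 / 4)" using W(2)[of i] S0 by simp
    \<comment> \<open>The tail takes at most \<open>1 / 4\<close> of the squared norm
      \<open>1\<close>, so the block retains at least \<open>3 / 4\<close>, of which
      \<open>1 / 4\<close> is used.\<close>
    then have S: "1 / 4 \<le> S" by simp
    have "L2_set (\<lambda>j. cmod (of_real (c i * L i) * W i j)) (I i)
        \<le> U + L2_set (\<lambda>j. cmod (of_real (c i) * ((X i j - Omega B (W i) j) + - Omega B (R i) j))) (I i)"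
    proof -
      have "L2_set (\<lambda>j. cmod (of_real (c i * L i) * W i j)) (I i)
          = L2_set (\<lambda>j. cmod (u i j + of_real (c i) * ((X i j - Omega B (W i) j) + - Omega B (R i) j))) (I i)"
        by (intro L2_set_cong refl arg_cong[where f=cmod]) (simp add: u_def algebra_simps)
      also have "\<dots> \<le> U + L2_set (\<lambda>j. cmod (of_real (c i) * ((X i j - Omega B (W i) j) + - Omega B (R i) j))) (I i)"
        unfolding U_def by (rule L2_set_norm_triangle)
      finally show ?thesis .
    qed
    also have "L2_set (\<lambda>j. cmod (of_real (c i) * ((X i j - Omega B (W i) j) + - Omega B (R i) j))) (I i)
        = c i * L2_set (\<lambda>j. cmod ((X i j - Omega B (W i) j) + - Omega B (R i) j)) (I i)"
      unfolding norm_mult using c0[of i] by (simp add: L2_set_right_distrib)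
    also have "L2_set (\<lambda>j. cmod ((X i j - Omega B (W i) j) + - Omega B (R i) j)) (I i)
        \<le> L2_set (\<lambda>j. cmod (X i j - Omega B (W i) j)) (I i) + L2_set (\<lambda>j. cmod (- Omega B (R i) j)) (I i)"
      by (rule L2_set_norm_triangle)
    also have "L2_set (\<lambda>j. cmod (X i j - Omega B (W i) j)) (I i) \<le> K"
      using triv[OF p(1)[of "i + s"] fin(1)] p(2)[of "i + s"] K by (intro L2_set_le) (simp_all add: X_def W_def)
    also have "L2_set (\<lambda>j. cmod (- Omega B (R i) j)) (I i) \<le> 2 * C"
    proof (rule L2_set_le)
      let ?F = "\<lambda>z j. if j \<in> I i then B (R i) z j else 0"
      have "tame (B (R i)) C"
      proof (rule tame_mono[OF B(1)[OF R(1)]])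
        have "(1 / 2 :: real) ^ Suc i \<le> 1" by (rule power_le_one) auto
        then have "nrm ell2 (R i) \<le> 1" using R(2)[of i] by linarith
        then show "C * nrm ell2 (R i) \<le> C" using C by (simp add: mult_left_le)
      qed
      then have F: "tame ?F C" by (rule tame_restrict)
      \<comment> \<open>\<open>R i\<close> vanishes on the block but not beyond it, so
        \<open>B (R i)\<close> is cut down to the block before \<open>tame_deriv\<close> is
        applied.\<close>
      have zero: "?F (1 / 2) j = 0" for j
        using B(2)[OF R(1)] by (auto simp: I_def R_def restrict_seq_def)
      have "(\<Sum>j\<in>I i. (cmod (- Omega B (R i) j))\<^sup>2) = (\<Sum>j\<in>I i. (cmod (deriv (\<lambda>z. ?F z j) (1 / 2)))\<^sup>2)"
        by (intro sum.cong refl) (simp add: Omega_def)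
      also have "\<dots> \<le> (2 * C)\<^sup>2" by (rule tame_deriv[OF F zero fin(1)])
      finally show "(\<Sum>j\<in>I i. (cmod (- Omega B (R i) j))\<^sup>2) \<le> (2 * C)\<^sup>2" .
    qed (use C in simp)
    finally have le: "L2_set (\<lambda>j. cmod (of_real (c i * L i) * W i j)) (I i) \<le> U + c i * (K + 2 * C)"
      using c0[of i] by (simp add: mult_left_mono)
    have "(c i * L i)\<^sup>2 * (1 / 4) \<le> (c i * L i)\<^sup>2 * S" using S by (intro mult_left_mono) auto
    also have "\<dots> = (L2_set (\<lambda>j. cmod (of_real (c i * L i) * W i j)) (I i))\<^sup>2"
      unfolding L2_set_power2 S_def sum_distrib_left
      by (intro sum.cong refl) (simp add: norm_mult power_mult_distrib)
    also have "\<dots> \<le> (U + c i * (K + 2 * C))\<^sup>2" using le by (intro power_mono L2_set_nonneg)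
    also have "\<dots> \<le> 2 * U\<^sup>2 + 2 * (c i * (K + 2 * C))\<^sup>2"
      using zero_le_power2[of "U - c i * (K + 2 * C)"] by (simp add: power2_sum power2_diff)
    finally show ?thesis using U by (simp add: power_mult_distrib)
  qed

  have "(real D * ln 2)\<^sup>2 / 2 \<le> (real D * ln 2)\<^sup>2 *
      (\<Sum>i<b. if g (k (i + s)) \<le> (1 / 2) ^ D then (a i)\<^sup>2 * g (k (i + s)) else 0)"
    using mult_left_mono[OF deep, of "(real D * ln 2)\<^sup>2"] by simp
  also have "\<dots> \<le> (\<Sum>i<b. (c i * L i)\<^sup>2)"
    unfolding sum_distrib_left
  proof (rule sum_mono)
    fix i
    show "(real D * ln 2)\<^sup>2 * (if g (k (i + s)) \<le> (1 / 2) ^ D then (a i)\<^sup>2 * g (k (i + s)) else 0) \<le> (c i * L i)\<^sup>2"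
    \<comment> \<open>A vanishing coefficient adds nothing to the left side; the comparison of
      logarithms needs a positive one.\<close>
    proof (cases "g (\<kappa> i) \<le> (1 / 2) ^ D \<and> g (\<kappa> i) \<noteq> 0")
      case True
      then have "0 < g (\<kappa> i)" using g0[of "\<kappa> i"] by simp
      then have "L i \<le> ln ((1 / 2) ^ D)" unfolding L_def using True by (intro ln_mono) auto
      also have "\<dots> = - (real D * ln 2)" by (simp add: ln_realpow ln_div)
      finally have "real D * ln 2 \<le> \<bar>L i\<bar>" by simp
      then have "(real D * ln 2)\<^sup>2 \<le> \<bar>L i\<bar>\<^sup>2" by (intro power_mono) auto
      then have "(real D * ln 2)\<^sup>2 * (c i)\<^sup>2 \<le> (L i)\<^sup>2 * (c i)\<^sup>2" by (intro mult_right_mono) auto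
      then show ?thesis using True c2[of i] by (simp add: \<kappa>_def power_mult_distrib mult.commute)
    next
      case False
      then show ?thesis by (auto simp: \<kappa>_def)
    qed
  qed
  also have "\<dots> = 4 * (\<Sum>i<b. (c i * L i)\<^sup>2 / 4)" by (simp add: sum_divide_distrib[symmetric])
  also have "\<dots> \<le> 4 * (\<Sum>i<b. 2 * (\<Sum>j\<in>V. (cmod (u i j))\<^sup>2) + 2 * (c i)\<^sup>2 * (K + 2 * C)\<^sup>2)"
    using block by (intro mult_left_mono sum_mono) auto
  also have "\<dots> = 8 * (\<Sum>i<b. \<Sum>j\<in>V. (cmod (u i j))\<^sup>2) + 8 * (\<Sum>i<b. (c i)\<^sup>2) * (K + 2 * C)\<^sup>2"
    by (simp add: sum.distrib sum_distrib_left[symmetric] sum_distrib_right[symmetric])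
  also have "\<dots> \<le> 8 * (2 * (4 * C + C * (4 * C)) + K * (4 * C))\<^sup>2 + 8 * (K + 2 * C)\<^sup>2"
    using u_total unfolding c_total by simp
  finally show ?thesis .
qed

theorem corollary5:
  fixes B :: "cseq \<Rightarrow> complex \<Rightarrow> cseq"
  assumes "homogeneous_selection T2 B"
  shows "strictly_singular pair_scale seq_scale (Z_space B) ell2 (\<lambda>(x, y). y)"
proof -
  have snd_eq: "(\<lambda>(x, y). y) = (snd :: cseq \<times> cseq \<Rightarrow> cseq)" by (auto simp: fun_eq_iff)
  have Z_pts: "snd p \<in> pts ell2" "fst p - Omega B (snd p) \<in> pts ell2" if "p \<in> pts (Z_space B)" for p
    using that by (auto simp: Z_space_def)
  have Z_nrm: "nrm (Z_space B) p = nrm ell2 (fst p - Omega B (snd p)) + nrm ell2 (snd p)" for p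
    by (simp add: Z_space_def case_prod_unfold)
  have "bounded_operator pair_scale seq_scale (Z_space B) ell2 snd"
    unfolding bounded_operator_def
  proof (intro conjI ballI allI exI[of _ 1])
    show "snd ` pts (Z_space B) \<subseteq> pts ell2" using Z_pts by auto
    show "nrm ell2 (snd p) \<le> 1 * nrm (Z_space B) p" if "p \<in> pts (Z_space B)" for p
      using nrm_ell2_nonneg[OF Z_pts(2)[OF that]] by (simp add: Z_nrm)
  qed (simp_all add: pair_scale_def)
  moreover have False
    if E: "closed_subspace pair_scale (Z_space B) E" "infinite_dimensional pair_scale E"
      "isomorphism_onto_image (Z_space B) ell2 snd E" for E
  proof -
    have sub: "E \<subseteq> pts (Z_space B)" "module.subspace pair_scale E"
      using E(1) by (auto simp: closed_subspace_def)
    obtain K where inj: "inj_on snd E"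
      and K: "\<And>w. w \<in> snd ` E \<Longrightarrow> nrm (Z_space B) (inv_into E snd w) \<le> K * nrm ell2 w"
      using E(3) unfolding isomorphism_onto_image_def by blast
    have ell2: "snd p \<in> pts ell2" if "p \<in> E" for p using Z_pts(1) sub(1) that by blast
    \<comment> \<open>The norm of \<open>Z_space B\<close> contains that of
      \<open>fst p - Omega B (snd p)\<close>, so the bound on the inverse controls this difference.
      The sign of \<open>K\<close> is unknown, hence \<open>\<bar>K\<bar>\<close>.\<close>
    have triv: "(\<Sum>j\<in>V. (cmod (fst p j - Omega B (snd p) j))\<^sup>2) \<le> (\<bar>K\<bar> * nrm ell2 (snd p))\<^sup>2"
      if p: "p \<in> E" and V: "finite V" for p V
    proof -
      have d: "fst p - Omega B (snd p) \<in> pts ell2" using Z_pts(2) sub(1) p by blast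
      have "(\<Sum>j\<in>V. (cmod (fst p j - Omega B (snd p) j))\<^sup>2) \<le> (nrm ell2 (fst p - Omega B (snd p)))\<^sup>2"
        using sum_le_nrm_ell2[OF d V] by simp
      also have "\<dots> \<le> (\<bar>K\<bar> * nrm ell2 (snd p))\<^sup>2"
      proof (rule power_mono)
        have "nrm (Z_space B) p \<le> K * nrm ell2 (snd p)"
          using K[of "snd p"] p inv_into_f_f[OF inj p] by auto
        also have "\<dots> \<le> \<bar>K\<bar> * nrm ell2 (snd p)"
          by (intro mult_right_mono nrm_ell2_nonneg ell2 p) simp
        finally show "nrm ell2 (fst p - Omega B (snd p)) \<le> \<bar>K\<bar> * nrm ell2 (snd p)"
          using nrm_ell2_nonneg[OF ell2[OF p]] by (simp add: Z_nrm)
      qed (rule nrm_ell2_nonneg[OF d])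
      finally show ?thesis .
    qed
    obtain C where C: "\<And>y. y \<in> pts ell2 \<Longrightarrow> F_inf_norm T2 (dual_seq_space T2) (B y) \<le> C * nrm ell2 y"
      and B: "\<And>y. y \<in> pts ell2 \<Longrightarrow> B y \<in> F_inf T2 (dual_seq_space T2)" "\<And>y. y \<in> pts ell2 \<Longrightarrow> B y (1 / 2) = y"
      using assms unfolding homogeneous_selection_def by blast
    have tame: "tame (B y) (\<bar>C\<bar> * nrm ell2 y)" if "y \<in> pts ell2" for y
    proof (rule tame_F_inf[OF B(1)[OF that]])
      have "C * nrm ell2 y \<le> \<bar>C\<bar> * nrm ell2 y"
        by (intro mult_right_mono nrm_ell2_nonneg that) simp
      then show "F_inf_norm T2 (dual_seq_space T2) (B y) \<le> \<bar>C\<bar> * nrm ell2 y" using C[OF that] by linarith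
    qed
    obtain k l p where k: "strict_mono k" and kl: "\<And>i. k i \<le> l i" "\<And>i. 2 * l i \<le> k (Suc i)"
      and p: "\<And>i. p i \<in> E" "\<And>i. nrm ell2 (snd (p i)) = 1" "\<And>i j. j < k i \<Longrightarrow> snd (p i) j = 0"
      and r: "\<And>i. restrict_seq {l i..} (snd (p i)) \<in> pts ell2"
        "\<And>i. nrm ell2 (restrict_seq {l i..} (snd (p i))) \<le> (1 / 2) ^ Suc i"
      using gliding_hump[OF sub(2) E(2) inj ell2] by blast
    define M where "M = 8 * (2 * (4 * \<bar>C\<bar> + \<bar>C\<bar> * (4 * \<bar>C\<bar>)) + \<bar>K\<bar> * (4 * \<bar>C\<bar>))\<^sup>2 + 8 * (\<bar>K\<bar> + 2 * \<bar>C\<bar>)\<^sup>2"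
    have "(real D * ln 2)\<^sup>2 / 2 \<le> M" for D
      unfolding M_def
      by (rule logarithm_bound[OF abs_ge_zero abs_ge_zero tame B(2) sub(2) ell2 triv k kl p r])
    moreover have "filterlim (\<lambda>D. (real D * ln 2)\<^sup>2 / 2) at_top sequentially" by real_asymp
    then obtain D where "M < (real D * ln 2)\<^sup>2 / 2"
      using eventually_happens[of _ sequentially] by (metis filterlim_at_top_dense trivial_limit_sequentially)
    ultimately show False by (meson not_le)
  qed
  ultimately show ?thesis unfolding strictly_singular_def snd_eq by blast
qed

end
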